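(* Let $G$ be a tree on the vertex set $[n]=\{1,\dots,n\}$. Then $$\beta_2(S/L_G)=\beta_{2,4}(S/L_G)=\binom{n-1}{2}+\sum_{v\in V(G)}\binom{\deg_G(v)}{3}.$$
   Context: Let $\mathbb{K}$ be any field and $S=\mathbb{K}[x_1,\dots,x_n,y_1,\dots,y_n]$ with the standard grading. For a finite simple graph $G$ on $[n]$, the Lovász-Saks-Schrijver (LSS) ideal is $L_G=(x_ix_j+y_iy_j : \{i,j\}\in E(G))\subset S$. $\beta_{i,j}(M)$ denotes the $(i,j)$-th graded Betti number of a finitely generated graded $S$-module $M$ (the number of generators of degree $j$ in homological position $i$ of the minimal graded free resolution), and $\beta_i(M)=\sum_j\beta_{i,j}(M)$. *)

theory Defs
  imports "HOL-Algebra.QuotRing" "HOL-Algebra.Module" "HOL-Library.Poly_Mapping"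
begin

section \<open>Polynomial rings\<close>

text \<open>
  A polynomial maps monomials to coefficients; a monomial \<open>m\<close> maps each variable to its exponent.
  The ring \<open>K[V]\<close> consists of the polynomials all of whose monomials use variables from \<open>V\<close> only.
\<close>

type_synonym ('v, 'a) mpoly = "('v \<Rightarrow>\<^sub>0 nat) \<Rightarrow>\<^sub>0 'a"

definition polys :: "'v set \<Rightarrow> ('v, 'a::zero) mpoly set" where
  "polys V = {p. \<forall>m \<in> Poly_Mapping.keys p. Poly_Mapping.keys m \<subseteq> V}"

definition poly_ring :: "'v set \<Rightarrow> ('v, 'a::comm_ring_1) mpoly ring" where
  "poly_ring V = \<lparr>carrier = polys V, mult = (*), one = 1, zero = 0, add = (+)\<rparr>"

definition var :: "'v \<Rightarrow> ('v, 'a::comm_ring_1) mpoly" where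
  "var v = Poly_Mapping.single (Poly_Mapping.single v 1) 1"

definition mdeg :: "('v \<Rightarrow>\<^sub>0 nat) \<Rightarrow> nat" where
  "mdeg m = (\<Sum>v \<in> Poly_Mapping.keys m. Poly_Mapping.lookup m v)"

text \<open>
  Degree-\<open>d\<close> component of the standard grading; it contains 0 and is \<open>{0}\<close> for \<open>d < 0\<close>.
\<close>

definition hom_polys :: "'v set \<Rightarrow> int \<Rightarrow> ('v, 'a::zero) mpoly set" where
  "hom_polys V d = {p \<in> polys V. \<forall>m \<in> Poly_Mapping.keys p. int (mdeg m) = d}"

definition irrelevant_ideal :: "'v set \<Rightarrow> ('v, 'a::zero) mpoly set" where
  "irrelevant_ideal V = {p \<in> polys V. Poly_Mapping.lookup p 0 = 0}"

lemma polys_mult_closed: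
  fixes p q :: "('v, 'a::comm_ring_1) mpoly"
  assumes "p \<in> polys V" "q \<in> polys V"
  shows "p * q \<in> polys V"
  unfolding polys_def
proof (intro CollectI ballI)
  fix m assume "m \<in> Poly_Mapping.keys (p * q)"
  then obtain a b where m: "m = a + b" "a \<in> Poly_Mapping.keys p" "b \<in> Poly_Mapping.keys q"
    using keys_mult[of p q] by blast
  then show "Poly_Mapping.keys m \<subseteq> V"
    using assms Poly_Mapping.keys_add[of a b] unfolding polys_def by blast
qed

lemma polys_add_closed:
  fixes p q :: "('v, 'a::comm_ring_1) mpoly"
  assumes "p \<in> polys V" "q \<in> polys V"
  shows "p + q \<in> polys V"
  using assms Poly_Mapping.keys_add[of p q] unfolding polys_def by blast

lemma zero_in_polys: "0 \<in> polys V"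
  by (simp add: polys_def)

lemma one_in_polys: "(1 :: ('v, 'a::comm_ring_1) mpoly) \<in> polys V"
  by (simp add: polys_def keys_one)

lemma cring_poly_ring: "cring (poly_ring V :: ('v, 'a::comm_ring_1) mpoly ring)"
proof (rule cringI)
  show "abelian_group (poly_ring V :: ('v, 'a) mpoly ring)"
  proof (rule abelian_groupI)
    fix x :: "('v, 'a) mpoly"
    assume "x \<in> carrier (poly_ring V)"
    then have "- x \<in> polys V" by (simp add: poly_ring_def polys_def)
    then show "\<exists>y \<in> carrier (poly_ring V). y \<oplus>\<^bsub>poly_ring V\<^esub> x = \<zero>\<^bsub>poly_ring V\<^esub>"
      unfolding poly_ring_def by (intro bexI[of _ "- x"]) auto
  qed (use polys_add_closed in \<open>auto simp: poly_ring_def add.assoc add.commute zero_in_polys\<close>)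
  show "Group.comm_monoid (poly_ring V :: ('v, 'a) mpoly ring)"
    by (rule comm_monoidI)
      (simp_all add: poly_ring_def polys_mult_closed one_in_polys mult_ac)
qed (simp add: poly_ring_def algebra_simps)

section \<open>Graded modules and minimal graded free resolutions\<close>

record ('r, 'b) graded_module = "('r, 'b) module" +
  component :: "int \<Rightarrow> 'b set"

definition quotient_module ::
  "'v set \<Rightarrow> ('v, 'a::comm_ring_1) mpoly set \<Rightarrow> (('v, 'a) mpoly, ('v, 'a) mpoly set) graded_module" where
  "quotient_module V I =
     (let S = poly_ring V; Q = S Quot I in
       \<lparr>carrier = carrier Q, mult = mult Q, one = one Q, zero = zero Q, add = add Q,
        smult = (\<lambda>a X. (I +>\<^bsub>S\<^esub> a) \<otimes>\<^bsub>Q\<^esub> X),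
        component = (\<lambda>d. (\<lambda>p. I +>\<^bsub>S\<^esub> p) ` hom_polys V d)\<rparr>)"

lemma module_quotient_module:
  assumes "ideal I (poly_ring V)"
  shows "module (poly_ring V) (quotient_module V I)"
proof -
  interpret I: ideal I "poly_ring V" by fact
  interpret S: cring "poly_ring V" by (rule cring_poly_ring)
  interpret Q: cring "poly_ring V Quot I"
    by (rule I.quotient_is_cring) (rule cring_poly_ring)
  interpret h: ring_hom_ring "poly_ring V" "poly_ring V Quot I" "(+>\<^bsub>poly_ring V\<^esub>) I"
    by (rule I.rcos_ring_hom_ring)
  have ag: "abelian_group (quotient_module V I)"
    by (rule abelian_groupI)
      (auto simp: quotient_module_def Let_def Q.a_ac intro!: Q.add.l_inv_ex)
  show ?thesis
    by (rule moduleI[OF cring_poly_ring ag])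
      (auto simp: quotient_module_def Let_def Q.l_distr Q.r_distr Q.m_assoc h.hom_add h.hom_mult)
qed

definition free_module :: "'v set \<Rightarrow> nat \<Rightarrow> (nat \<Rightarrow> ('v, 'a::zero) mpoly) set" where
  "free_module V r = {c. (\<forall>k < r. c k \<in> polys V) \<and> (\<forall>k \<ge> r. c k = 0)}"

text \<open>
  The linear map \<open>S\<^sup>s \<rightarrow> S\<^sup>r\<close> given by an \<open>r \<times> s\<close> matrix \<open>A\<close> (row index first).
\<close>

definition matrix_map ::
  "nat \<Rightarrow> nat \<Rightarrow> (nat \<Rightarrow> nat \<Rightarrow> ('v, 'a::comm_ring_1) mpoly) \<Rightarrow>
   (nat \<Rightarrow> ('v, 'a) mpoly) \<Rightarrow> nat \<Rightarrow> ('v, 'a) mpoly" where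
  "matrix_map r s A c = (\<lambda>k. if k < r then \<Sum>l < s. A k l * c l else 0)"

text \<open>The linear map \<open>S\<^sup>r \<rightarrow> M\<close> sending the \<open>k\<close>-th basis element to \<open>e k\<close>.\<close>

definition augmentation ::
  "(('v, 'a::comm_ring_1) mpoly, 'b) graded_module \<Rightarrow> nat \<Rightarrow> (nat \<Rightarrow> 'b) \<Rightarrow>
   (nat \<Rightarrow> ('v, 'a) mpoly) \<Rightarrow> 'b" where
  "augmentation M r e c = (\<Oplus>\<^bsub>M\<^esub>k \<in> {..<r}. c k \<odot>\<^bsub>M\<^esub> e k)"

text \<open>
  A graded free resolution \<open>\<dots> \<rightarrow> F\<^sub>2 \<rightarrow> F\<^sub>1 \<rightarrow> F\<^sub>0 \<rightarrow> M \<rightarrow> 0\<close> of \<open>M\<close> over \<open>S = K[V]\<close> by finitely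
  generated free modules, presented in homogeneous bases: the list \<open>d i\<close> contains the degrees of
  the basis elements of \<open>F\<^sub>i\<close>, so that \<open>F\<^sub>i = \<Oplus>\<^sub>k S(- d i ! k)\<close>; the matrix \<open>A i\<close> describes
  \<open>F\<^sub>i\<^sub>+\<^sub>1 \<rightarrow> F\<^sub>i\<close>, and \<open>e k\<close> is the image in \<open>M\<close> of the \<open>k\<close>-th basis element of \<open>F\<^sub>0\<close>.
  All maps are homogeneous of degree 0.
\<close>

definition graded_free_resolution ::
  "'v set \<Rightarrow> (('v, 'a::field) mpoly, 'b) graded_module \<Rightarrow> (nat \<Rightarrow> int list) \<Rightarrow>
   (nat \<Rightarrow> nat \<Rightarrow> nat \<Rightarrow> ('v, 'a) mpoly) \<Rightarrow> (nat \<Rightarrow> 'b) \<Rightarrow> bool" where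
  "graded_free_resolution V M d A e \<longleftrightarrow>
     (let r = (\<lambda>i. length (d i));
          F = (\<lambda>i. free_module V (r i));
          \<phi> = (\<lambda>i. matrix_map (r i) (r (Suc i)) (A i));
          \<epsilon> = augmentation M (r 0) e
      in
        (\<forall>k < r 0. e k \<in> component M (d 0 ! k)) \<and>
        (\<forall>i. \<forall>k < r i. \<forall>l < r (Suc i). A i k l \<in> hom_polys V (d (Suc i) ! l - d i ! k)) \<and>
        \<epsilon> ` F 0 = carrier M \<and>
        {c \<in> F 0. \<epsilon> c = \<zero>\<^bsub>M\<^esub>} = \<phi> 0 ` F 1 \<and>
        (\<forall>i. {c \<in> F (Suc i). \<phi> i c = (\<lambda>_. 0)} = \<phi> (Suc i) ` F (Suc (Suc i))))"

text \<open>Minimality: the image of \<open>F\<^sub>i\<^sub>+\<^sub>1 \<rightarrow> F\<^sub>i\<close> lies in \<open>\<mm> F\<^sub>i\<close>, i.e. all matrix entries lie in \<open>\<mm>\<close>.\<close>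

definition minimal_graded_free_resolution ::
  "'v set \<Rightarrow> (('v, 'a::field) mpoly, 'b) graded_module \<Rightarrow> (nat \<Rightarrow> int list) \<Rightarrow>
   (nat \<Rightarrow> nat \<Rightarrow> nat \<Rightarrow> ('v, 'a) mpoly) \<Rightarrow> (nat \<Rightarrow> 'b) \<Rightarrow> bool" where
  "minimal_graded_free_resolution V M d A e \<longleftrightarrow>
     graded_free_resolution V M d A e \<and>
     (\<forall>i. \<forall>k < length (d i). \<forall>l < length (d (Suc i)). A i k l \<in> irrelevant_ideal V)"

text \<open>
  For finite \<open>V\<close> and a finitely generated graded module \<open>M\<close> a minimal graded free resolution
  exists, and the multisets of degrees do not depend on its choice.
\<close>

definition graded_betti ::
  "'v set \<Rightarrow> (('v, 'a::field) mpoly, 'b) graded_module \<Rightarrow> nat \<Rightarrow> int \<Rightarrow> nat" where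
  "graded_betti V M i j =
     count_list ((SOME d. \<exists>A e. minimal_graded_free_resolution V M d A e) i) j"

text \<open>The sum over all integers \<open>j\<close>, restricted to its finite support.\<close>

definition betti :: "'v set \<Rightarrow> (('v, 'a::field) mpoly, 'b) graded_module \<Rightarrow> nat \<Rightarrow> nat" where
  "betti V M i = (\<Sum>j | graded_betti V M i j \<noteq> 0. graded_betti V M i j)"

section \<open>Trees\<close>

definition simple_graph :: "'v set \<Rightarrow> 'v set set \<Rightarrow> bool" where
  "simple_graph V E \<longleftrightarrow> finite V \<and> (\<forall>e \<in> E. e \<subseteq> V \<and> card e = 2)"

definition connected_graph :: "'v set \<Rightarrow> 'v set set \<Rightarrow> bool" where
  "connected_graph V E \<longleftrightarrow> V \<noteq> {} \<and> (\<forall>u \<in> V. \<forall>v \<in> V. (u, v) \<in> {(a, b). {a, b} \<in> E}\<^sup>*)"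

definition graph_cycle :: "'v set set \<Rightarrow> 'v list \<Rightarrow> bool" where
  "graph_cycle E c \<longleftrightarrow> 3 \<le> length c \<and> distinct c \<and>
     (\<forall>i < length c. {c ! i, c ! (Suc i mod length c)} \<in> E)"

definition is_tree :: "'v set \<Rightarrow> 'v set set \<Rightarrow> bool" where
  "is_tree V E \<longleftrightarrow> simple_graph V E \<and> connected_graph V E \<and> (\<nexists>c. graph_cycle E c)"

definition vertex_degree :: "'v set set \<Rightarrow> 'v \<Rightarrow> nat" where
  "vertex_degree E v = card {e \<in> E. v \<in> e}"

section \<open>LSS ideals\<close>

datatype lss_var = X nat | Y nat

definition lss_vars :: "nat \<Rightarrow> lss_var set" where
  "lss_vars n = X ` {1..n} \<union> Y ` {1..n}"

definition lss_ideal :: "nat \<Rightarrow> nat set set \<Rightarrow> (lss_var, 'a::field) mpoly set" where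
  "lss_ideal n E =
     Idl\<^bsub>poly_ring (lss_vars n)\<^esub>
       {var (X i) * var (X j) + var (Y i) * var (Y j) | i j. {i, j} \<in> E}"

definition lss_quotient ::
  "nat \<Rightarrow> nat set set \<Rightarrow> ((lss_var, 'a::field) mpoly, (lss_var, 'a) mpoly set) graded_module" where
  "lss_quotient n E = quotient_module (lss_vars n) (lss_ideal n E)"

lemma ideal_lss_ideal:
  assumes "simple_graph {1..n} E"
  shows "ideal (lss_ideal n E :: (lss_var, 'a::field) mpoly set) (poly_ring (lss_vars n))"
proof -
  interpret S: cring "poly_ring (lss_vars n) :: (lss_var, 'a) mpoly ring"
    by (rule cring_poly_ring)
  have v: "var v \<in> (polys (lss_vars n) :: (lss_var, 'a) mpoly set)" if "v \<in> lss_vars n" for v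
    using that by (auto simp: var_def polys_def split: if_splits)
  show ?thesis
    unfolding lss_ideal_def
  proof (rule S.genideal_ideal, clarify)
    fix i j assume "{i, j} \<in> E"
    then have "{i, j} \<subseteq> {1..n}" using assms by (auto simp: simple_graph_def)
    then have "X i \<in> lss_vars n" "X j \<in> lss_vars n" "Y i \<in> lss_vars n" "Y j \<in> lss_vars n"
      by (auto simp: lss_vars_def)
    then show "var (X i) * var (X j) + var (Y i) * var (Y j)
        \<in> carrier (poly_ring (lss_vars n) :: (lss_var, 'a) mpoly ring)"
      by (simp add: poly_ring_def v polys_mult_closed polys_add_closed)
  qed
qed

end

theory Submission
  imports Defs "HOL.Vector_Spaces" "HOL-Library.Function_Algebras" "HOL-Library.Product_Lexorder"
begin

text \<open>
  Write \<open>f\<^sub>e\<close> for the generator of \<open>L\<^sub>G\<close> attached to the edge \<open>e\<close>, and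
  \<open>\<Delta>\<^sub>i\<^sub>j = x\<^sub>i y\<^sub>j - x\<^sub>j y\<^sub>i\<close>. For a vertex \<open>v\<close> of a tree,
  \<open>L\<^sub>G : x\<^sub>v = L\<^sub>G : y\<^sub>v = L\<^sub>G + (\<Delta>\<^sub>i\<^sub>j : i, j \<in> N(v))\<close>. This follows by induction, joining two
  disjoint rooted trees by an edge \<open>{v, w}\<close>: setting \<open>x\<^sub>v = 0\<close> in a relation
  \<open>p x\<^sub>v \<in> L\<^sub>G\<close> leaves a relation of the form \<open>c y\<^sub>w \<in> B + L\<^sub>H\<close> with \<open>B\<close> and \<open>L\<^sub>H\<close> in
  disjoint sets of variables, and over a field \<open>(B + L\<^sub>H) : y\<^sub>w = B + (L\<^sub>H : y\<^sub>w)\<close>.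

  If a leaf \<open>u\<close> is attached at \<open>w\<close>, it follows that \<open>L\<^sub>G : f\<^sub>w\<^sub>u = L\<^sub>G + (\<Delta>\<^sub>i\<^sub>j : i, j \<in> N(w))\<close>,
  an ideal with \<open>|E(G)| + (deg w choose 2)\<close> minimal generators, all of degree 2. Each of them lifts to a
  new syzygy of total degree 4, so that growing the tree leaf by leaf gives the stated number of
  minimal generators of the syzygy module of the \<open>f\<^sub>e\<close>. A minimal resolution exists since graded
  submodules of free modules are finitely generated, and in any minimal resolution the degrees of
  \<open>F\<^sub>2\<close> are those of a minimal system of generators of this syzygy module.
\<close>

section \<open>Filtering the monomials of a polynomial\<close>

text \<open>The colon ideal by x_v is computed over joins of two rooted trees, because the relation
  left after setting x_v = 0 involves the other coordinate y_w at the root of the second tree. Hence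
  both coordinates are treated at once. Splitting K[V] \<otimes> K[-V] over the field K needs only
  linear algebra, so the characteristic never enters.

  The count is Pascal's rule. For a new leaf at \<open>w\<close>, the generators f_e of the colon
  ideal account for the growth of the first binomial coefficient, by |E|. The minors at
  \<open>w\<close> account for the passage from (d choose 3) to (d+1 choose 3), where d is the old
  degree of \<open>w\<close>.

  All f_e have degree 2 and all generating syzygies have entries of degree 2. With a single degree,
  being a minimal system of generators amounts to linear independence over K.

  Spans are formed over the polynomial ring in all variables of the type. Coefficients are brought
  back to K[V] by \<open>restrict_vars\<close> and \<open>hcomp\<close>.\<close>

lift_definition pfilter :: "('k \<Rightarrow> bool) \<Rightarrow> ('k \<Rightarrow>\<^sub>0 'a::zero) \<Rightarrow> 'k \<Rightarrow>\<^sub>0 'a"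
  is "\<lambda>P f k. if P k then f k else 0"
  by (rule finite_subset) auto

lemma lookup_pfilter: "Poly_Mapping.lookup (pfilter P p) k = (if P k then Poly_Mapping.lookup p k else 0)"
  by transfer simp

lemma keys_pfilter: "Poly_Mapping.keys (pfilter P p) = {k \<in> Poly_Mapping.keys p. P k}"
  by (auto simp: in_keys_iff lookup_pfilter split: if_splits)

lemma pfilter_zero [simp]: "pfilter P 0 = 0"
  by (rule poly_mapping_eqI) (simp add: lookup_pfilter)

lemma pfilter_add: "pfilter P (p + q) = pfilter P p + pfilter P (q :: 'k \<Rightarrow>\<^sub>0 'a::monoid_add)"
  by (rule poly_mapping_eqI) (simp add: lookup_pfilter lookup_add)

lemma pfilter_diff: "pfilter P (p - q) = pfilter P p - pfilter P (q :: 'k \<Rightarrow>\<^sub>0 'a::ab_group_add)"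
  by (rule poly_mapping_eqI) (simp add: lookup_pfilter lookup_minus)

lemma pfilter_sum: "pfilter P (sum f A) = (\<Sum>x\<in>A. pfilter P (f x :: 'k \<Rightarrow>\<^sub>0 'a::comm_monoid_add))"
  by (induction A rule: infinite_finite_induct) (simp_all add: pfilter_add)

lemma pfilter_id: "(\<And>k. k \<in> Poly_Mapping.keys p \<Longrightarrow> P k) \<Longrightarrow> pfilter P p = p"
  by (rule poly_mapping_eqI) (auto simp: lookup_pfilter in_keys_iff)

lemma pfilter_single: "pfilter P (Poly_Mapping.single k a) = (if P k then Poly_Mapping.single k a else 0)"
  by (rule poly_mapping_eqI) (auto simp: lookup_pfilter lookup_single when_def)

lemma sum_singles: "(\<Sum>k\<in>Poly_Mapping.keys p. Poly_Mapping.single k (Poly_Mapping.lookup p k)) = p"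
proof (rule poly_mapping_eqI)
  fix k
  have "(\<Sum>x\<in>Poly_Mapping.keys p. Poly_Mapping.lookup p x when x = k)
      = (if k \<in> Poly_Mapping.keys p then Poly_Mapping.lookup p k else 0)"
    unfolding when_def by (simp add: sum.delta)
  then show "Poly_Mapping.lookup (\<Sum>k\<in>Poly_Mapping.keys p. Poly_Mapping.single k (Poly_Mapping.lookup p k)) k
      = Poly_Mapping.lookup p k"
    by (simp add: lookup_sum lookup_single in_keys_iff)
qed

lemma mult_sum_singles:
  fixes p q :: "'k::monoid_add \<Rightarrow>\<^sub>0 'a::semiring_0"
  shows "p * q = (\<Sum>m\<in>Poly_Mapping.keys p. \<Sum>k\<in>Poly_Mapping.keys q.
     Poly_Mapping.single (m + k) (Poly_Mapping.lookup p m * Poly_Mapping.lookup q k))"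
proof -
  have "p * q = (\<Sum>m\<in>Poly_Mapping.keys p. Poly_Mapping.single m (Poly_Mapping.lookup p m)) *
     (\<Sum>m\<in>Poly_Mapping.keys q. Poly_Mapping.single m (Poly_Mapping.lookup q m))"
    by (simp only: sum_singles)
  then show ?thesis
    by (simp only: sum_product mult_single)
qed

text \<open>The hypothesis lets a product monomial be tested on its two factors. With
  \<open>P = Q = R\<close> it makes setting variables to 0 a ring homomorphism; with a shifted
  degree condition it extracts a homogeneous component of a multiple of a homogeneous polynomial;
  with the test \<open>m = 0\<close> it multiplies constant terms.\<close>

lemma pfilter_mult:
  fixes p q :: "'k::monoid_add \<Rightarrow>\<^sub>0 'a::semiring_0"
  assumes "\<And>m k. m \<in> Poly_Mapping.keys p \<Longrightarrow> k \<in> Poly_Mapping.keys q \<Longrightarrow> P (m + k) \<longleftrightarrow> Q m \<and> R k"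
  shows "pfilter P (p * q) = pfilter Q p * pfilter R q"
proof -
  let ?t = "\<lambda>m k. Poly_Mapping.single (m + k) (Poly_Mapping.lookup p m * Poly_Mapping.lookup q k)"
  have 1: "pfilter Q p = (\<Sum>m\<in>Poly_Mapping.keys p. if Q m then Poly_Mapping.single m (Poly_Mapping.lookup p m) else 0)"
    by (subst sum_singles[of p, symmetric]) (simp only: pfilter_sum pfilter_single)
  have 2: "pfilter R q = (\<Sum>m\<in>Poly_Mapping.keys q. if R m then Poly_Mapping.single m (Poly_Mapping.lookup q m) else 0)"
    by (subst sum_singles[of q, symmetric]) (simp only: pfilter_sum pfilter_single)
  have "pfilter P (p * q) =
      (\<Sum>m\<in>Poly_Mapping.keys p. \<Sum>k\<in>Poly_Mapping.keys q. if Q m \<and> R k then ?t m k else 0)"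
    unfolding mult_sum_singles[of p q] pfilter_sum pfilter_single
    by (intro sum.cong refl) (simp add: assms)
  also have "\<dots> = pfilter Q p * pfilter R q"
    unfolding 1 2 sum_product by (intro sum.cong refl) (simp add: mult_single)
  finally show ?thesis .
qed

section \<open>Homogeneous polynomials\<close>

lemma keys_plus_nat:
  "Poly_Mapping.keys (a + b :: 'v \<Rightarrow>\<^sub>0 nat) = Poly_Mapping.keys a \<union> Poly_Mapping.keys b"
  by (auto simp: in_keys_iff lookup_add)

lemma mdeg_superset:
  assumes "finite A" "Poly_Mapping.keys m \<subseteq> A"
  shows "mdeg m = (\<Sum>v\<in>A. Poly_Mapping.lookup m v)"
  unfolding mdeg_def using assms by (intro sum.mono_neutral_left) (auto simp: in_keys_iff)

lemma mdeg_add: "mdeg (a + b) = mdeg a + mdeg b"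
proof -
  let ?A = "Poly_Mapping.keys a \<union> Poly_Mapping.keys b"
  have "mdeg (a + b) = (\<Sum>v\<in>?A. Poly_Mapping.lookup (a + b) v)"
    by (rule mdeg_superset) (auto simp: keys_plus_nat)
  also have "\<dots> = mdeg a + mdeg b"
    by (simp add: lookup_add sum.distrib mdeg_superset[of ?A])
  finally show ?thesis .
qed

lemma mdeg_zero [simp]: "mdeg 0 = 0"
  by (simp add: mdeg_def)

lemma mdeg_eq_0_iff: "mdeg m = 0 \<longleftrightarrow> m = 0"
proof
  assume "mdeg m = 0"
  then have "Poly_Mapping.lookup m v = 0" for v
    by (cases "v \<in> Poly_Mapping.keys m") (auto simp: mdeg_def in_keys_iff)
  then show "m = 0" by (intro poly_mapping_eqI) simp
qed simp

lemma mdeg_single [simp]: "mdeg (Poly_Mapping.single v k) = k"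
  by (simp add: mdeg_def)

lemma polys_zero [simp]: "0 \<in> polys V"
  by (rule zero_in_polys)

lemma polys_uminus: "p \<in> polys V \<Longrightarrow> - p \<in> (polys V :: ('v, 'a::comm_ring_1) mpoly set)"
  by (simp add: polys_def)

lemma polys_diff:
  "p \<in> polys V \<Longrightarrow> q \<in> polys V \<Longrightarrow> p - q \<in> (polys V :: ('v, 'a::comm_ring_1) mpoly set)"
  by (metis polys_add_closed polys_uminus uminus_add_conv_diff add.commute)

lemma polys_sum:
  "(\<And>x. x \<in> A \<Longrightarrow> f x \<in> polys V) \<Longrightarrow> sum f A \<in> (polys V :: ('v, 'a::comm_ring_1) mpoly set)"
  by (induction A rule: infinite_finite_induct) (auto simp: polys_add_closed)

lemma polys_mono: "V \<subseteq> W \<Longrightarrow> polys V \<subseteq> polys W"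
  by (auto simp: polys_def)

lemma polys_single: "Poly_Mapping.keys m \<subseteq> V \<Longrightarrow> Poly_Mapping.single m a \<in> polys V"
  by (auto simp: polys_def split: if_splits)

lemma hom_polys_polys: "p \<in> hom_polys V d \<Longrightarrow> p \<in> polys V"
  by (simp add: hom_polys_def)

lemma hom_polys_mono: "V \<subseteq> W \<Longrightarrow> hom_polys V d \<subseteq> hom_polys W d"
  using polys_mono by (fastforce simp: hom_polys_def)

lemma hom_polys_zero [simp]: "0 \<in> hom_polys V d"
  by (simp add: hom_polys_def)

lemma hom_polys_add:
  fixes p q :: "('v, 'a::comm_ring_1) mpoly"
  shows "p \<in> hom_polys V d \<Longrightarrow> q \<in> hom_polys V d \<Longrightarrow> p + q \<in> hom_polys V d"
  using Poly_Mapping.keys_add[of p q] by (auto simp: hom_polys_def polys_add_closed)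

lemma hom_polys_uminus:
  fixes p :: "('v, 'a::comm_ring_1) mpoly"
  shows "p \<in> hom_polys V d \<Longrightarrow> - p \<in> hom_polys V d"
  by (simp add: hom_polys_def polys_uminus)

lemma hom_polys_diff:
  fixes p q :: "('v, 'a::comm_ring_1) mpoly"
  shows "p \<in> hom_polys V d \<Longrightarrow> q \<in> hom_polys V d \<Longrightarrow> p - q \<in> hom_polys V d"
  by (metis hom_polys_add hom_polys_uminus uminus_add_conv_diff add.commute)

lemma hom_polys_sum:
  "(\<And>x. x \<in> A \<Longrightarrow> f x \<in> hom_polys V d) \<Longrightarrow> sum f A \<in> (hom_polys V d :: ('v, 'a::comm_ring_1) mpoly set)"
  by (induction A rule: infinite_finite_induct) (auto simp: hom_polys_add)

lemma hom_polys_mult: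
  fixes p q :: "('v, 'a::comm_ring_1) mpoly"
  assumes "p \<in> hom_polys V d" "q \<in> hom_polys V e"
  shows "p * q \<in> hom_polys V (d + e)"
proof -
  have "int (mdeg m) = d + e" if "m \<in> Poly_Mapping.keys (p * q)" for m
  proof -
    have "m \<in> {a + b |a b. a \<in> Poly_Mapping.keys p \<and> b \<in> Poly_Mapping.keys q}"
      using keys_mult[of p q] that by (rule subsetD)
    then show ?thesis using assms by (auto simp: hom_polys_def mdeg_add)
  qed
  then show ?thesis using assms by (simp add: hom_polys_def polys_mult_closed)
qed

lemma hom_polys_single:
  "Poly_Mapping.keys m \<subseteq> V \<Longrightarrow> int (mdeg m) = d \<Longrightarrow> Poly_Mapping.single m a \<in> hom_polys V d"
  by (auto simp: hom_polys_def polys_def split: if_splits)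

lemma hom_polys_one [simp]: "(1 :: ('v, 'a::comm_ring_1) mpoly) \<in> hom_polys V 0"
  by (simp add: hom_polys_def one_in_polys)

lemma hom_polys_lookup_0: "p \<in> hom_polys V d \<Longrightarrow> d \<noteq> 0 \<Longrightarrow> Poly_Mapping.lookup p 0 = 0"
  by (metis (mono_tags, lifting) hom_polys_def in_keys_iff mdeg_zero mem_Collect_eq of_nat_0)

lemma hom_polys_neg: "p \<in> hom_polys V d \<Longrightarrow> d < 0 \<Longrightarrow> p = 0"
  by (rule poly_mapping_eqI) (auto simp: hom_polys_def in_keys_iff)

lemma hom_polys_const: "p \<in> hom_polys V 0 \<Longrightarrow> p = Poly_Mapping.single 0 (Poly_Mapping.lookup p 0)"
  by (rule poly_mapping_eqI)
    (auto simp: hom_polys_def in_keys_iff lookup_single when_def mdeg_eq_0_iff)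

lemma lookup_mult_0:
  fixes p q :: "('v, 'a::comm_ring_1) mpoly"
  shows "Poly_Mapping.lookup (p * q) 0 = Poly_Mapping.lookup p 0 * Poly_Mapping.lookup q 0"
proof -
  let ?P = "\<lambda>m::'v \<Rightarrow>\<^sub>0 nat. m = 0"
  have c: "pfilter ?P p = Poly_Mapping.single 0 (Poly_Mapping.lookup p 0)" for p :: "('v, 'a) mpoly"
    by (rule poly_mapping_eqI) (auto simp: lookup_pfilter lookup_single when_def)
  have "a + b = 0 \<longleftrightarrow> a = 0 \<and> b = 0" for a b :: "'v \<Rightarrow>\<^sub>0 nat"
    by (metis mdeg_add mdeg_eq_0_iff add_is_0)
  then have "pfilter ?P (p * q) = pfilter ?P p * pfilter ?P q"
    by (intro pfilter_mult) auto
  then show ?thesis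
    unfolding c mult_single by (metis add_0 lookup_single_eq)
qed

text \<open>Variables and degree are cut at once, so the result lies in K[V] even if the argument
  involves variables outside \<open>V\<close>, as coefficients in spans over the full ring may
  do.\<close>

definition hcomp :: "'v set \<Rightarrow> int \<Rightarrow> ('v, 'a::zero) mpoly \<Rightarrow> ('v, 'a) mpoly" where
  "hcomp V d = pfilter (\<lambda>m. Poly_Mapping.keys m \<subseteq> V \<and> int (mdeg m) = d)"

lemma hcomp_in [simp]: "hcomp V d p \<in> hom_polys V d"
  by (auto simp: hcomp_def hom_polys_def polys_def keys_pfilter)

lemma hcomp_id: "p \<in> hom_polys V d \<Longrightarrow> hcomp V d p = p"
  unfolding hcomp_def by (rule pfilter_id) (auto simp: hom_polys_def polys_def)

lemma hcomp_zero [simp]: "hcomp V d 0 = 0"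
  by (simp add: hcomp_def)

lemma hcomp_sum: "hcomp V d (sum f A) = (\<Sum>x\<in>A. hcomp V d (f x :: ('v, 'a::comm_ring_1) mpoly))"
  by (simp add: hcomp_def pfilter_sum)

lemma hcomp_mult:
  fixes c g :: "('v, 'a::comm_ring_1) mpoly"
  assumes "g \<in> hom_polys V e"
  shows "hcomp V d (c * g) = hcomp V (d - e) c * g"
proof -
  have "hcomp V d (c * g) = hcomp V (d - e) c * pfilter (\<lambda>_. True) g"
    unfolding hcomp_def using assms
    by (intro pfilter_mult) (auto simp: hom_polys_def polys_def keys_plus_nat mdeg_add)
  then show ?thesis by (simp add: pfilter_id)
qed

lemma sum_hcomp:
  fixes p :: "('v, 'a::comm_ring_1) mpoly"
  assumes "p \<in> polys V" "finite D" "(\<lambda>m. int (mdeg m)) ` Poly_Mapping.keys p \<subseteq> D"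
  shows "(\<Sum>d\<in>D. hcomp V d p) = p"
proof (rule poly_mapping_eqI)
  fix m
  have "Poly_Mapping.lookup (hcomp V d p) m = (if d = int (mdeg m) then Poly_Mapping.lookup p m else 0)" for d
    using assms(1) by (auto simp: hcomp_def lookup_pfilter polys_def in_keys_iff)
  then show "Poly_Mapping.lookup (\<Sum>d\<in>D. hcomp V d p) m = Poly_Mapping.lookup p m"
    using assms(2,3) by (cases "Poly_Mapping.lookup p m = 0") (auto simp: lookup_sum sum.delta in_keys_iff)
qed

section \<open>Setting variables to zero\<close>

definition restrict_vars :: "'v set \<Rightarrow> ('v, 'a::zero) mpoly \<Rightarrow> ('v, 'a) mpoly" where
  "restrict_vars V = pfilter (\<lambda>m. Poly_Mapping.keys m \<subseteq> V)"

lemma restrict_vars_in [simp]: "restrict_vars V p \<in> polys V"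
  by (auto simp: restrict_vars_def polys_def keys_pfilter)

lemma restrict_vars_id: "p \<in> polys V \<Longrightarrow> restrict_vars V p = p"
  unfolding restrict_vars_def by (rule pfilter_id) (auto simp: polys_def)

lemma restrict_vars_add:
  "restrict_vars V (p + q) = restrict_vars V p + restrict_vars V (q :: ('v, 'a::comm_ring_1) mpoly)"
  by (simp add: restrict_vars_def pfilter_add)

lemma restrict_vars_zero [simp]: "restrict_vars V 0 = 0"
  by (simp add: restrict_vars_def)

lemma restrict_vars_sum:
  "restrict_vars V (sum f A) = (\<Sum>x\<in>A. restrict_vars V (f x :: ('v, 'a::comm_ring_1) mpoly))"
  by (simp add: restrict_vars_def pfilter_sum)

text \<open>A product monomial avoids the variables outside \<open>V\<close> iff both factors do, so
  \<open>restrict_vars V\<close> is a ring retraction onto K[V]. It brings coefficients back into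
  K[V] and, for \<open>V\<close> the complement of a point, sets one variable to 0.\<close>

lemma restrict_vars_mult:
  "restrict_vars V (p * q) = restrict_vars V p * restrict_vars V (q :: ('v, 'a::comm_ring_1) mpoly)"
  unfolding restrict_vars_def by (rule pfilter_mult) (simp add: keys_plus_nat)

section \<open>Modules over polynomial rings\<close>

definition const :: "'a::zero \<Rightarrow> ('v, 'a) mpoly" where
  "const a = Poly_Mapping.single 0 a"

lemma const_add: "const (a + b) = const a + const (b :: 'a::comm_ring_1)"
  by (simp add: const_def single_add)

lemma const_mult: "const (a * b) = const a * const (b :: 'a::comm_ring_1)"
  by (simp add: const_def mult_single)

lemma const_one [simp]: "const (1 :: 'a::comm_ring_1) = 1"
  by (simp add: const_def)

lemma const_zero [simp]: "const 0 = 0"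
  by (simp add: const_def)

lemma const_hom [simp]: "const a \<in> hom_polys V 0"
  unfolding const_def by (rule hom_polys_single) auto

lemma const_polys [simp]: "const a \<in> polys V"
  by (rule hom_polys_polys[OF const_hom])

lemma lookup_const_0 [simp]: "Poly_Mapping.lookup (const a) 0 = a"
  by (simp add: const_def)

lemma lookup_const_mult: "Poly_Mapping.lookup (const a * p) m = a * Poly_Mapping.lookup p (m :: 'v \<Rightarrow>\<^sub>0 nat)"
  for p :: "('v, 'a::comm_ring_1) mpoly"
proof -
  have "const a * p = Poly_Mapping.map ((*) a) p"
    by (simp only: const_def mult_map_scale_conv_mult)
  also have "Poly_Mapping.lookup \<dots> m = a * Poly_Mapping.lookup p m"
    by transfer (auto simp: when_def)
  finally show ?thesis .
qed

definition fscale :: "'p::comm_ring_1 \<Rightarrow> ('k \<Rightarrow> 'p) \<Rightarrow> 'k \<Rightarrow> 'p" where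
  "fscale p c = (\<lambda>k. p * c k)"

lemma fscale_apply [simp]: "fscale p c k = p * c k"
  by (simp add: fscale_def)

lemma sum_fun_apply: "(\<Sum>x\<in>A. f x) k = (\<Sum>x\<in>A. f x k :: 'b::comm_monoid_add)"
  by (induction A rule: infinite_finite_induct) auto

lemma module_mult: "Modules.module ((*) :: 'p::comm_ring_1 \<Rightarrow> 'p \<Rightarrow> 'p)"
  by unfold_locales (auto simp: distrib_left distrib_right mult.assoc)

lemma module_fscale: "Modules.module (fscale :: 'p::comm_ring_1 \<Rightarrow> ('k \<Rightarrow> 'p) \<Rightarrow> 'k \<Rightarrow> 'p)"
  by unfold_locales (auto simp: fscale_def distrib_left distrib_right mult.assoc)

lemma vector_space_const: "vector_space (\<lambda>a (p :: ('v, 'a::field) mpoly). const a * p)"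
  by unfold_locales (auto simp: distrib_left distrib_right mult.assoc const_add const_mult)

lemma vector_space_fscale: "vector_space (\<lambda>a (c :: 'k \<Rightarrow> ('v, 'a::field) mpoly). fscale (const a) c)"
  by unfold_locales (auto simp: fscale_def distrib_left distrib_right mult.assoc const_add const_mult)

text \<open>\<open>ideal.span\<close> and \<open>fmod.span\<close> are the ideal and the submodule
  generated over the full polynomial ring. The interpretations \<open>pvec\<close> and
  \<open>fvec\<close> provide the K-vector space structures on the same objects, and independence is
  always meant there.\<close>

interpretation ideal: Modules.module "(*) :: 'p::comm_ring_1 \<Rightarrow> 'p \<Rightarrow> 'p"
  by (rule module_mult)

interpretation fmod: Modules.module "fscale :: 'p::comm_ring_1 \<Rightarrow> ('k \<Rightarrow> 'p) \<Rightarrow> 'k \<Rightarrow> 'p"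
  by (rule module_fscale)

interpretation pvec: vector_space "\<lambda>a (p :: ('v, 'a::field) mpoly). const a * p"
  by (rule vector_space_const)

text \<open>These instances rewrite \<open>a * (b * x)\<close> to \<open>(a * b) * x\<close> and make the simplifier loop on \<open>mult_ac\<close>.\<close>

declare ideal.scale_scale [simp del] pvec.scale_scale [simp del]

interpretation fvec: vector_space "\<lambda>a (c :: 'k \<Rightarrow> ('v, 'a::field) mpoly). fscale (const a) c"
  by (rule vector_space_fscale)

section \<open>Finite generation of graded submodules\<close>

lemma nat_seq_mono_subseq:
  fixes s :: "nat \<Rightarrow> nat"
  obtains \<phi> :: "nat \<Rightarrow> nat" where "strict_mono \<phi>" "mono (\<lambda>n. s (\<phi> n))"
proof -
  \<comment> \<open>Among the positions beyond \<open>N\<close>, one with the least value bounds all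
    later values from below.\<close>
  have ex: "\<exists>x>N. \<forall>j\<ge>x. s x \<le> s j" for N
    using ex_has_least_nat[of "\<lambda>x. N < x" "Suc N" s] by (metis lessI less_le_trans)
  obtain \<phi> where "\<And>n. \<forall>j\<ge>\<phi> n. s (\<phi> n) \<le> s j" "\<And>n. \<phi> n < \<phi> (Suc n)"
    using dependent_nat_choice[of "\<lambda>_ x. \<forall>j\<ge>x. s x \<le> s j" "\<lambda>_ x y. x < y"] ex by metis
  then show ?thesis
    by (intro that[of \<phi>]) (auto simp: strict_mono_Suc_iff mono_iff_le_Suc less_imp_le)
qed

lemma nat_seqs_mono_subseq:
  assumes "finite F"
  shows "\<exists>\<phi>::nat \<Rightarrow> nat. strict_mono \<phi> \<and> (\<forall>f\<in>F. mono (\<lambda>n. f (\<phi> n) :: nat))"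
  using assms
proof (induction F)
  case empty
  show ?case by (rule exI[of _ id]) (simp add: strict_mono_def)
next
  case (insert f F)
  then obtain \<phi> :: "nat \<Rightarrow> nat" where \<phi>: "strict_mono \<phi>" "\<forall>g\<in>F. mono (\<lambda>n. g (\<phi> n))"
    by blast
  obtain \<psi> :: "nat \<Rightarrow> nat" where \<psi>: "strict_mono \<psi>" "mono (\<lambda>n. f (\<phi> (\<psi> n)))"
    by (rule nat_seq_mono_subseq[of "\<lambda>n. f (\<phi> n)"])
  have "mono (\<lambda>n. g (\<phi> (\<psi> n)))" if "g \<in> F" for g
    using \<phi>(2) that by (auto simp: mono_def strict_mono_less_eq[OF \<psi>(1)])
  then show ?case
    using \<phi>(1) \<psi> by (intro exI[of _ "\<phi> \<circ> \<psi>"]) (auto simp: strict_mono_def)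
qed

lemma dickson:
  fixes m :: "nat \<Rightarrow> 'v \<Rightarrow>\<^sub>0 nat" and k :: "nat \<Rightarrow> nat"
  assumes "finite V" "\<And>n. Poly_Mapping.keys (m n) \<subseteq> V" "\<And>n. k n < r"
  shows "\<exists>i j t. i < j \<and> k i = k j \<and> m j = t + m i"
proof -
  \<comment> \<open>Besides the exponents, both \<open>k\<close> and \<open>r - k\<close> are made
    nondecreasing; since \<open>k\<close> stays below \<open>r\<close>, this forces equal
    positions.\<close>
  obtain \<phi> :: "nat \<Rightarrow> nat" where \<phi>: "strict_mono \<phi>"
    "\<forall>f\<in>{k, \<lambda>n. r - k n} \<union> (\<lambda>v n. Poly_Mapping.lookup (m n) v) ` V. mono (\<lambda>n. f (\<phi> n))"
    using nat_seqs_mono_subseq[of "{k, \<lambda>n. r - k n} \<union> (\<lambda>v n. Poly_Mapping.lookup (m n) v) ` V"] assms(1)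
    by blast
  let ?i = "\<phi> 0" and ?j = "\<phi> 1"
  have "k ?i \<le> k ?j" "r - k ?i \<le> r - k ?j"
    using \<phi>(2) by (auto simp: mono_def)
  then have "k ?i = k ?j" using assms(3)[of ?i] assms(3)[of ?j] by linarith
  moreover have "Poly_Mapping.lookup (m ?i) v \<le> Poly_Mapping.lookup (m ?j) v" for v
  proof (cases "v \<in> V")
    case True
    then show ?thesis using \<phi>(2) by (auto simp: mono_def)
  next
    case False
    then have "v \<notin> Poly_Mapping.keys (m ?i)" using assms(2) by blast
    then show ?thesis by (simp add: in_keys_iff)
  qed
  then have "m ?j = (m ?j - m ?i) + m ?i"
    by (intro poly_mapping_eqI) (simp add: lookup_add lookup_minus)
  moreover have "?i < ?j" using \<phi>(1) by (simp add: strict_mono_def)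
  ultimately show ?thesis by blast
qed

lemma monomial_nonneg: "0 \<le> (t :: 'v::linorder \<Rightarrow>\<^sub>0 nat)"
proof -
  have "\<not> t < 0" by transfer (simp add: less_fun_def)
  then show ?thesis by simp
qed

text \<open>Terms are compared by position and then by the order on exponents. By Dickson's lemma an
  infinite descending chain has a term dividing a later one in the same position, but a divisor is
  never larger than its multiple.\<close>

lemma wf_monomials:
  fixes T :: "(nat \<times> ('v::linorder \<Rightarrow>\<^sub>0 nat)) set"
  assumes V: "finite V" and T: "T = {(k, m). k < r \<and> Poly_Mapping.keys m \<subseteq> V}"
  shows "wf {(a, b). a < b \<and> a \<in> T \<and> b \<in> T}"
  unfolding wf_iff_no_infinite_down_chain
proof
  assume "\<exists>f. \<forall>i. (f (Suc i), f i) \<in> {(a, b). a < b \<and> a \<in> T \<and> b \<in> T}"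
  then obtain f where f: "\<And>i. f (Suc i) < f i" "\<And>i. f i \<in> T" by blast
  have dec: "f j < f i" if "i < j" for i j
    using that by (induction j) (use f(1) less_trans less_antisym in blast)+
  have fT: "Poly_Mapping.keys (snd (f n)) \<subseteq> V" "fst (f n) < r" for n
    using f(2)[of n] T by auto
  obtain i j t where "i < j" "fst (f i) = fst (f j)" "snd (f j) = t + snd (f i)"
    using dickson[OF V, of "\<lambda>n. snd (f n)" "\<lambda>n. fst (f n)" r] fT by blast
  moreover have "snd (f i) \<le> t + snd (f i)"
    using add_right_mono[OF monomial_nonneg, of "snd (f i)" t] by simp
  ultimately have "f i \<le> f j" by (simp add: less_eq_prod_def)
  then show False using dec[OF \<open>i < j\<close>] by simp
qed

lemma lookup_single_mult:
  fixes p :: "'k::cancel_comm_monoid_add \<Rightarrow>\<^sub>0 'a::semiring_0"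
  shows "Poly_Mapping.lookup (Poly_Mapping.single t a * p) (t + m) = a * Poly_Mapping.lookup p m"
proof -
  have "Poly_Mapping.single t a * p
      = (\<Sum>k\<in>Poly_Mapping.keys p. Poly_Mapping.single (t + k) (a * Poly_Mapping.lookup p k))"
    by (subst (1) sum_singles[of p, symmetric]) (simp only: sum_distrib_left mult_single)
  then have "Poly_Mapping.lookup (Poly_Mapping.single t a * p) (t + m)
      = (\<Sum>k\<in>Poly_Mapping.keys p. if k = m then a * Poly_Mapping.lookup p k else 0)"
    by (simp add: lookup_sum lookup_single when_def)
  then show ?thesis by (simp add: sum.delta in_keys_iff)
qed

section \<open>Graded submodules of free modules and their leading terms\<close>

definition hom_vecs :: "'v set \<Rightarrow> int list \<Rightarrow> int \<Rightarrow> (nat \<Rightarrow> ('v, 'a::zero) mpoly) set" where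
  "hom_vecs V ds \<delta> = {c \<in> free_module V (length ds). \<forall>k<length ds. c k \<in> hom_polys V (\<delta> - ds ! k)}"

definition vcomp :: "'v set \<Rightarrow> int list \<Rightarrow> int \<Rightarrow> (nat \<Rightarrow> ('v, 'a::zero) mpoly) \<Rightarrow> nat \<Rightarrow> ('v, 'a) mpoly" where
  "vcomp V ds \<delta> c = (\<lambda>k. if k < length ds then hcomp V (\<delta> - ds ! k) (c k) else 0)"

definition graded_submodule :: "'v set \<Rightarrow> int list \<Rightarrow> (nat \<Rightarrow> ('v, 'a::comm_ring_1) mpoly) set \<Rightarrow> bool" where
  "graded_submodule V ds N \<longleftrightarrow> N \<subseteq> free_module V (length ds) \<and> 0 \<in> N \<and> (\<forall>c\<in>N. \<forall>c'\<in>N. c + c' \<in> N) \<and>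
     (\<forall>p\<in>polys V. \<forall>c\<in>N. fscale p c \<in> N) \<and> (\<forall>\<delta>. \<forall>c\<in>N. vcomp V ds \<delta> c \<in> N)"

lemma vcomp_hom_vecs: "vcomp V ds \<delta> c \<in> hom_vecs V ds \<delta>"
  by (auto simp: vcomp_def hom_vecs_def free_module_def hom_polys_polys[OF hcomp_in])

text \<open>The terms of a vector, each a position together with a monomial; the maximum in the
  product order serves as leading term.\<close>

definition vsupp :: "(nat \<Rightarrow> ('v, 'a::zero) mpoly) \<Rightarrow> (nat \<times> ('v \<Rightarrow>\<^sub>0 nat)) set" where
  "vsupp c = {(k, m). m \<in> Poly_Mapping.keys (c k)}"

lemma vsupp_free_module:
  assumes "c \<in> free_module V r"
  shows "finite (vsupp c)" "vsupp c \<subseteq> {(k, m). k < r \<and> Poly_Mapping.keys m \<subseteq> V}"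
proof -
  have *: "m \<in> Poly_Mapping.keys (c k) \<Longrightarrow> k < r" for k m
    using assms by (metis (mono_tags, lifting) free_module_def keys_zero empty_iff mem_Collect_eq not_less)
  then have "vsupp c = Sigma {..<r} (\<lambda>k. Poly_Mapping.keys (c k))"
    by (auto simp: vsupp_def)
  then show "finite (vsupp c)" by simp
  show "vsupp c \<subseteq> {(k, m). k < r \<and> Poly_Mapping.keys m \<subseteq> V}"
    using * assms by (fastforce simp: vsupp_def free_module_def polys_def)
qed

lemma vsupp_empty_iff: "vsupp c = {} \<longleftrightarrow> c = 0"
proof
  assume "vsupp c = {}"
  then have "Poly_Mapping.keys (c k) = {}" for k by (auto simp: vsupp_def)
  then show "c = 0" by (auto simp: fun_eq_iff intro!: poly_mapping_eqI simp: in_keys_iff)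
qed (simp add: vsupp_def)

text \<open>Otherwise there is a sequence \<open>b\<close> in which \<open>b n\<close> has the least
  leading term among the homogeneous elements of \<open>N\<close> outside the span of its
  predecessors. By Dickson's lemma some leading term divides a later one. Cancelling the later one
  gives a homogeneous element, still outside the span, with a smaller leading term: a
  contradiction.\<close>

lemma graded_submodule_finitely_generated:
  fixes N :: "(nat \<Rightarrow> ('v::linorder, 'a::field) mpoly) set"
  assumes V: "finite V" and N: "graded_submodule V ds N"
    and H: "H = {c \<in> N. \<exists>\<delta>. c \<in> hom_vecs V ds \<delta>}"
  shows "\<exists>B. finite B \<and> B \<subseteq> H \<and> H \<subseteq> fmod.span B"
proof (rule ccontr)
  assume contra: "\<not> ?thesis"
  define lead where "lead = (\<lambda>c :: nat \<Rightarrow> ('v, 'a) mpoly. Max (vsupp c))"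
  define T where "T = {(k, m :: 'v \<Rightarrow>\<^sub>0 nat). k < length ds \<and> Poly_Mapping.keys m \<subseteq> V}"
  have free: "c \<in> free_module V (length ds)" if "c \<in> H" for c
    using that H N by (auto simp: graded_submodule_def)
  have lead: "lead c \<in> vsupp c" "lead c \<in> T" if "c \<in> H" "c \<noteq> 0" for c
  proof -
    show "lead c \<in> vsupp c"
      unfolding lead_def using vsupp_free_module(1)[OF free[OF that(1)]] that(2)
      by (intro Max_in) (auto simp: vsupp_empty_iff)
    then show "lead c \<in> T"
      using vsupp_free_module(2)[OF free[OF that(1)]] by (auto simp: T_def)
  qed
  have wf: "wf (inv_image {(a, b). a < b \<and> a \<in> T \<and> b \<in> T} lead)"
    by (intro wf_inv_image wf_monomials[OF V]) (auto simp: T_def)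
  define P where "P = (\<lambda>f (n::nat) x. x \<in> H \<and> x \<notin> fmod.span (f ` {..<n}) \<and>
      (\<forall>y\<in>H. y \<notin> fmod.span (f ` {..<n}) \<longrightarrow> lead x \<le> lead y))"
  have "\<exists>f. \<forall>n. P f n (f n)"
  proof (rule dependent_wellorder_choice)
    fix r and f g :: "nat \<Rightarrow> nat \<Rightarrow> ('v, 'a) mpoly" and n :: nat
    assume "\<And>y. y < n \<Longrightarrow> f y = g y"
    then have "f ` {..<n} = g ` {..<n}" by auto
    then show "P f n r = P g n r" by (simp add: P_def)
  next
    fix n and f :: "nat \<Rightarrow> nat \<Rightarrow> ('v, 'a) mpoly"
    assume "\<And>y. y < n \<Longrightarrow> P f y (f y)"
    then have "f ` {..<n} \<subseteq> H" by (auto simp: P_def)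
    then obtain y where "y \<in> H - fmod.span (f ` {..<n})" using contra by blast
    then obtain x where x: "x \<in> H - fmod.span (f ` {..<n})"
      "\<And>y. (y, x) \<in> inv_image {(a, b). a < b \<and> a \<in> T \<and> b \<in> T} lead \<Longrightarrow> y \<notin> H - fmod.span (f ` {..<n})"
      by (rule wfE_min[OF wf]) blast
    have "lead x \<le> lead y" if "y \<in> H" "y \<notin> fmod.span (f ` {..<n})" for y
    proof -
      have "x \<noteq> 0" "y \<noteq> 0" using x(1) that fmod.span_zero by auto
      then have "lead x \<in> T" "lead y \<in> T" using lead(2) x(1) that by auto
      then have "\<not> lead y < lead x" using x(2)[of y] that by auto
      then show ?thesis by (simp only: not_less)
    qed
    then show "\<exists>r. P f n r" using x(1) by (auto simp: P_def)
  qed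
  then obtain b where b: "\<And>n. P b n (b n)" by blast
  have bH: "b n \<in> H" and bspan: "b n \<notin> fmod.span (b ` {..<n})" for n
    using b[of n] by (auto simp: P_def)
  have b0: "b n \<noteq> 0" for n using bspan[of n] fmod.span_zero by metis
  have bT: "lead (b n) \<in> T" for n by (rule lead(2)[OF bH b0])
  have bT': "Poly_Mapping.keys (snd (lead (b n))) \<subseteq> V" "fst (lead (b n)) < length ds" for n
    using bT[of n] by (auto simp: T_def)
  obtain i j t where ij: "i < j" "fst (lead (b i)) = fst (lead (b j))"
    "snd (lead (b j)) = t + snd (lead (b i))"
    using dickson[OF V, of "\<lambda>n. snd (lead (b n))" "\<lambda>n. fst (lead (b n))" "length ds"] bT'
    by blast
  define k m where "k = fst (lead (b i))" and "m = snd (lead (b i))"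
  have li: "lead (b i) = (k, m)" and lj: "lead (b j) = (k, t + m)"
    using ij by (auto simp: k_def m_def prod_eq_iff)
  have ki: "m \<in> Poly_Mapping.keys (b i k)" and kj: "t + m \<in> Poly_Mapping.keys (b j k)"
    using lead(1)[OF bH b0, of i] lead(1)[OF bH b0, of j] by (auto simp: li lj vsupp_def)
  have kr: "k < length ds" and tV: "Poly_Mapping.keys t \<subseteq> V"
    using bT[of j] by (auto simp: lj T_def keys_plus_nat)
  \<comment> \<open>The factor for which the leading terms of \<open>b j\<close> and of the monomial
    multiple of \<open>b i\<close> cancel in \<open>y\<close>.\<close>
  define a where "a = Poly_Mapping.lookup (b j k) (t + m) / Poly_Mapping.lookup (b i k) m"
  define y where "y = b j + fscale (Poly_Mapping.single t (- a)) (b i)"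
  have yN: "y \<in> N"
    using N bH H tV polys_single[of t V "- a"] by (auto simp: y_def graded_submodule_def)
  obtain \<delta>i \<delta>j where hi: "b i \<in> hom_vecs V ds \<delta>i" and hj: "b j \<in> hom_vecs V ds \<delta>j"
    using bH H by blast
  have "int (mdeg m) = \<delta>i - ds ! k" "int (mdeg (t + m)) = \<delta>j - ds ! k"
    using hi hj ki kj kr by (auto simp: hom_vecs_def hom_polys_def)
  then have "Poly_Mapping.single t (- a) \<in> hom_polys V (\<delta>j - \<delta>i)"
    using tV by (intro hom_polys_single) (auto simp: mdeg_add)
  then have "Poly_Mapping.single t (- a) * b i l \<in> hom_polys V (\<delta>j - ds ! l)" if "l < length ds" for l
    using hom_polys_mult[of _ V "\<delta>j - \<delta>i" "b i l" "\<delta>i - ds ! l"] hi that by (auto simp: hom_vecs_def)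
  then have "y \<in> hom_vecs V ds \<delta>j"
    using hj yN N by (auto simp: y_def hom_vecs_def graded_submodule_def intro!: hom_polys_add)
  then have yH: "y \<in> H" using yN H by blast
  have ysp: "y \<notin> fmod.span (b ` {..<j})"
  proof
    assume "y \<in> fmod.span (b ` {..<j})"
    moreover have "fscale (Poly_Mapping.single t (- a)) (b i) \<in> fmod.span (b ` {..<j})"
      using ij(1) by (intro fmod.span_scale fmod.span_base) auto
    ultimately have "b j \<in> fmod.span (b ` {..<j})"
      using fmod.span_diff[of y "b ` {..<j}"] by (fastforce simp: y_def)
    then show False using bspan by blast
  qed
  then have y0: "y \<noteq> 0" using fmod.span_zero by metis
  \<comment> \<open>\<open>y\<close> competes with \<open>b j\<close> in the choice of the least
    leading term, so its leading term cannot be smaller, whereas every term of \<open>y\<close> is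
    at most that of \<open>b j\<close>.\<close>
  have le: "(k, t + m) \<le> lead y" using b[of j] yH ysp by (simp add: P_def lj)
  have ly: "lead y \<in> vsupp y" by (rule lead(1)[OF yH y0])
  have max: "s \<le> lead (b n)" if "s \<in> vsupp (b n)" for s n
    using that vsupp_free_module(1)[OF free[OF bH]] by (simp add: lead_def)
  have "s \<le> (k, t + m)" if s: "s \<in> vsupp y" for s
  proof -
    obtain l u where s': "s = (l, u)" "u \<in> Poly_Mapping.keys (y l)"
      using s by (auto simp: vsupp_def)
    then consider "u \<in> Poly_Mapping.keys (b j l)" | "u \<in> Poly_Mapping.keys (Poly_Mapping.single t (- a) * b i l)"
      using Poly_Mapping.keys_add[of "b j l"] by (fastforce simp: y_def)
    then show ?thesis
    proof cases
      case 1
      then show ?thesis using max[of s j] s'(1) by (auto simp: vsupp_def lj)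
    next
      case 2
      then obtain w where w: "u = t + w" "w \<in> Poly_Mapping.keys (b i l)"
        using keys_mult[of "Poly_Mapping.single t (- a)" "b i l"] by (auto split: if_splits)
      then have "(l, w) \<le> (k, m)" using max[of "(l, w)" i] by (auto simp: vsupp_def li)
      then show ?thesis using s'(1) w(1) by (auto intro: add_left_mono)
    qed
  qed
  then have "lead y = (k, t + m)" using le ly by (simp add: antisym)
  then have "Poly_Mapping.lookup (y k) (t + m) \<noteq> 0" using ly by (simp add: vsupp_def in_keys_iff)
  then show False
    using ki by (simp add: y_def lookup_add lookup_single_mult a_def in_keys_iff)
qed

section \<open>Matrices whose columns minimally generate a graded submodule\<close>

lemma span_indexed:
  fixes b :: "'i \<Rightarrow> 'k \<Rightarrow> 'p::comm_ring_1"
  assumes "finite I" "x \<in> fmod.span (b ` I)"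
  shows "\<exists>p. x = (\<Sum>l\<in>I. fscale (p l) (b l))"
  using assms(2)
proof (induction rule: fmod.span_induct_alt)
  case base
  show ?case by (rule exI[of _ "\<lambda>_. 0"]) simp
next
  case (step c x y)
  then obtain p l where p: "y = (\<Sum>l\<in>I. fscale (p l) (b l))" and l: "l \<in> I" "x = b l" by blast
  have "fscale c x = (\<Sum>i\<in>I. fscale (if i = l then c else 0) (b i))"
  proof -
    have "(\<Sum>i\<in>I. fscale (if i = l then c else 0) (b i)) = (\<Sum>i\<in>I. if i = l then fscale c (b i) else 0)"
      by (intro sum.cong) (auto simp: fscale_def)
    then show ?thesis using l assms(1) by simp
  qed
  then have "fscale c x + y = (\<Sum>i\<in>I. fscale ((if i = l then c else 0) + p i) (b i))"
    unfolding p by (simp only: fmod.scale_left_distrib sum.distrib)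
  then show ?case by (intro exI[of _ "\<lambda>i. (if i = l then c else 0) + p i"])
qed

lemma matrix_map_eq_sum:
  "matrix_map r s A c = (\<Sum>l<s. fscale (c l) (\<lambda>k. if k < r then A k l else 0))"
  by (auto simp: matrix_map_def fun_eq_iff sum_fun_apply mult.commute intro!: sum.cong)

text \<open>The columns of \<open>A\<close> are a homogeneous generating system of least size. A
  relation with a nonzero constant term in some coefficient would, in the right degree, express that
  generator by the others. The last conclusion says that the next map of a resolution has its image
  in the maximal ideal times the free module.\<close>

lemma graded_submodule_minimal_generators:
  fixes N :: "(nat \<Rightarrow> ('v::linorder, 'a::field) mpoly) set"
  assumes V: "finite V" and N: "graded_submodule V ds N"
  shows "\<exists>ds' A. (\<forall>k<length ds. \<forall>l<length ds'. A k l \<in> hom_polys V (ds' ! l - ds ! k)) \<and>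
     N = matrix_map (length ds) (length ds') A ` free_module V (length ds') \<and>
     (\<forall>c\<in>free_module V (length ds'). matrix_map (length ds) (length ds') A c = (\<lambda>_. 0) \<longrightarrow>
        (\<forall>l<length ds'. c l \<in> irrelevant_ideal V))"
proof -
  define H where "H = {c \<in> N. \<exists>\<delta>. c \<in> hom_vecs V ds \<delta>}"
  define G where "G = (\<lambda>r b \<delta>. (\<forall>l<r. b l \<in> N \<and> b l \<in> hom_vecs V ds (\<delta> l)) \<and>
     H \<subseteq> fmod.span (b ` {..<r :: nat}))"
  obtain B where B: "finite B" "B \<subseteq> H" "H \<subseteq> fmod.span B"
    using graded_submodule_finitely_generated[OF V N H_def] by blast
  obtain b0 where b0: "bij_betw b0 {..<card B} B"
    using ex_bij_betw_nat_finite[OF B(1)] by (auto simp: atLeast0LessThan)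
  have "\<forall>c\<in>B. \<exists>\<delta>. c \<in> hom_vecs V ds \<delta>" using B(2) by (auto simp: H_def)
  then obtain \<delta>0 where \<delta>0: "\<forall>c\<in>B. c \<in> hom_vecs V ds (\<delta>0 c)"
    by (rule bchoice[THEN exE])
  have "G (card B) b0 (\<lambda>l. \<delta>0 (b0 l))"
    using B b0 \<delta>0 by (auto simp: G_def bij_betw_def H_def)
  then have ex: "\<exists>r b \<delta>. G r b \<delta>" by blast
  define r where "r = (LEAST r. \<exists>b \<delta>. G r b \<delta>)"
  have "\<exists>b \<delta>. G r b \<delta>" unfolding r_def by (rule LeastI_ex) (rule ex)
  then obtain b \<delta> where G: "G r b \<delta>" by blast
  have least: "\<not> G r' b' \<delta>'" if "r' < r" for r' b' \<delta>'
    using that not_less_Least unfolding r_def by blast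
  define ds' where "ds' = map \<delta> [0..<r]"
  define A where "A = (\<lambda>k l. b l k)"
  have len: "length ds' = r" by (simp add: ds'_def)
  have bN: "b l \<in> N" and bh: "b l \<in> hom_vecs V ds (\<delta> l)" if "l < r" for l
    using G that by (auto simp: G_def)
  have Ncl: "N \<subseteq> free_module V (length ds)" "0 \<in> N" "\<And>c c'. c \<in> N \<Longrightarrow> c' \<in> N \<Longrightarrow> c + c' \<in> N"
    "\<And>p c. p \<in> polys V \<Longrightarrow> c \<in> N \<Longrightarrow> fscale p c \<in> N" "\<And>\<delta> c. c \<in> N \<Longrightarrow> vcomp V ds \<delta> c \<in> N"
    using N by (auto simp: graded_submodule_def)
  have col: "(\<lambda>k. if k < length ds then A k l else 0) = b l" if "l < r" for l
    using bN[OF that] Ncl(1) by (auto simp: A_def free_module_def fun_eq_iff)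
  have mm: "matrix_map (length ds) r A c = (\<Sum>l<r. fscale (c l) (b l))" for c
    unfolding matrix_map_eq_sum by (intro sum.cong) (auto simp: col)
  have deg: "A k l \<in> hom_polys V (ds' ! l - ds ! k)" if "k < length ds" "l < r" for k l
    using bh[OF that(2)] that by (auto simp: A_def ds'_def hom_vecs_def)
  have sub1: "matrix_map (length ds) r A c \<in> N" if "c \<in> free_module V r" for c
  proof -
    have "(\<Sum>l\<in>L. fscale (c l) (b l)) \<in> N" if "finite L" "L \<subseteq> {..<r}" for L
      using that
    proof induction
      case empty
      then show ?case using Ncl(2) by (simp add: zero_fun_def)
    next
      case (insert l L)
      then have "fscale (c l) (b l) \<in> N"
        using \<open>c \<in> free_module V r\<close> by (intro Ncl(4) bN) (auto simp: free_module_def)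
      then have "fscale (c l) (b l) + (\<Sum>l\<in>L. fscale (c l) (b l)) \<in> N"
        using insert.IH insert.prems by (intro Ncl(3)) blast+
      then show ?case by (simp only: sum.insert[OF insert.hyps])
    qed
    then show ?thesis by (simp add: mm)
  qed
  have sub2: "c \<in> matrix_map (length ds) r A ` free_module V r" if c: "c \<in> N" for c
  proof -
    \<comment> \<open>The degrees occurring in \<open>c\<close>, where a monomial in position
      \<open>k\<close> is shifted by \<open>ds ! k\<close>.\<close>
    define D where "D = (\<Union>k<length ds. (\<lambda>m. int (mdeg m) + ds ! k) ` Poly_Mapping.keys (c k))"
    have "finite D" by (simp add: D_def)
    have "(\<Sum>d\<in>D. vcomp V ds d c) = c"
    proof
      fix k
      show "(\<Sum>d\<in>D. vcomp V ds d c) k = c k"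
      proof (cases "k < length ds")
        case True
        have "(\<Sum>d\<in>D. vcomp V ds d c) k = (\<Sum>d\<in>D. hcomp V (d - ds ! k) (c k))"
          using True by (simp add: sum_fun_apply vcomp_def)
        also have "\<dots> = (\<Sum>d\<in>(\<lambda>d. d - ds ! k) ` D. hcomp V d (c k))"
          by (subst sum.reindex) (auto simp: inj_on_def)
        also have "\<dots> = c k"
          using \<open>finite D\<close> c Ncl(1) True
          by (intro sum_hcomp) (force simp: free_module_def D_def image_iff)+
        finally show ?thesis .
      next
        case False
        then show ?thesis using c Ncl(1) by (auto simp: sum_fun_apply vcomp_def free_module_def)
      qed
    qed
    moreover have "vcomp V ds d c \<in> fmod.span (b ` {..<r})" for d
      using G Ncl(5)[OF c] vcomp_hom_vecs[of V ds d c] by (auto simp: G_def H_def)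
    ultimately have "c \<in> fmod.span (b ` {..<r})"
      by (metis fmod.span_sum)
    then obtain p where p: "c = (\<Sum>l<r. fscale (p l) (b l))"
      using span_indexed[of "{..<r}" c b] by auto
    \<comment> \<open>The \<open>p l\<close> may involve variables outside \<open>V\<close>.
      Restricting them changes nothing, since \<open>c\<close> and the \<open>b l\<close> have
      entries in K[V].\<close>
    define q where "q = (\<lambda>l. if l < r then restrict_vars V (p l) else 0)"
    have "c = matrix_map (length ds) r A q"
    proof
      fix k
      show "c k = matrix_map (length ds) r A q k"
      proof (cases "k < length ds")
        case True
        have "c k = restrict_vars V (c k)"
          using c Ncl(1) True by (auto simp: free_module_def restrict_vars_id)
        also have "\<dots> = (\<Sum>l<r. restrict_vars V (p l) * restrict_vars V (b l k))"
          by (subst p) (simp add: sum_fun_apply restrict_vars_sum restrict_vars_mult)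
        also have "\<dots> = (\<Sum>l<r. fscale (q l) (b l)) k"
          unfolding sum_fun_apply
        proof (intro sum.cong refl)
          fix l assume "l \<in> {..<r}"
          then have "b l k \<in> polys V"
            using bN[of l] Ncl(1) True by (auto simp: free_module_def)
          then show "restrict_vars V (p l) * restrict_vars V (b l k) = fscale (q l) (b l) k"
            using \<open>l \<in> {..<r}\<close> by (simp add: q_def restrict_vars_id)
        qed
        finally show ?thesis by (simp add: mm)
      next
        case False
        then show ?thesis using c Ncl(1) by (auto simp: matrix_map_def free_module_def)
      qed
    qed
    moreover have "q \<in> free_module V r" by (simp add: q_def free_module_def)
    ultimately show ?thesis by blast
  qed
  have min: "c j \<in> irrelevant_ideal V"
    if c: "c \<in> free_module V r" and c0: "matrix_map (length ds) r A c = (\<lambda>_. 0)" and j: "j < r" for c j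
  proof (rule ccontr)
    assume "c j \<notin> irrelevant_ideal V"
    then have u: "Poly_Mapping.lookup (c j) 0 \<noteq> 0"
      using c j by (auto simp: irrelevant_ideal_def free_module_def)
    define u where "u = Poly_Mapping.lookup (c j) 0"
    \<comment> \<open>The component of the relation in degree \<open>\<delta> j\<close>: the
      coefficient of \<open>b j\<close> becomes the nonzero constant \<open>u\<close>.\<close>
    define h where "h = (\<lambda>l. hcomp V (\<delta> j - \<delta> l) (c l))"
    have hj: "h j = const u"
      using hom_polys_const[OF hcomp_in[of V 0 "c j"]]
      by (simp add: h_def u_def const_def hcomp_def lookup_pfilter)
    have eq: "(\<Sum>l<r. fscale (h l) (b l)) = 0"
    proof
      fix k
      show "(\<Sum>l<r. fscale (h l) (b l)) k = 0 k"
      proof (cases "k < length ds")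
        case True
        have "(\<Sum>l<r. c l * b l k) = 0"
          using c0 by (simp add: mm fun_eq_iff sum_fun_apply)
        then have "0 = hcomp V (\<delta> j - ds ! k) (\<Sum>l<r. c l * b l k)" by simp
        also have "\<dots> = (\<Sum>l<r. h l * b l k)"
          unfolding hcomp_sum
        proof (intro sum.cong refl)
          fix l assume "l \<in> {..<r}"
          then have "b l k \<in> hom_polys V (\<delta> l - ds ! k)"
            using bh[of l] True by (auto simp: hom_vecs_def)
          then show "hcomp V (\<delta> j - ds ! k) (c l * b l k) = h l * b l k"
            by (simp add: hcomp_mult h_def)
        qed
        finally show ?thesis by (simp add: sum_fun_apply)
      next
        case False
        then have "b l k = 0" if "l < r" for l
          using bN[OF that] Ncl(1) by (auto simp: free_module_def)
        then show ?thesis by (simp add: sum_fun_apply)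
      qed
    qed
    have "fscale (h j) (b j) = - (\<Sum>l\<in>{..<r}-{j}. fscale (h l) (b l))"
      using eq j by (simp add: sum.remove[of "{..<r}" j] eq_neg_iff_add_eq_0)
    also have "\<dots> \<in> fmod.span (b ` ({..<r} - {j}))"
      by (intro fmod.span_neg fmod.span_sum fmod.span_scale fmod.span_base) auto
    finally have "fscale (const (inverse u)) (fscale (h j) (b j)) \<in> fmod.span (b ` ({..<r} - {j}))"
      by (rule fmod.span_scale)
    moreover have "fscale (const (inverse u)) (fscale (h j) (b j)) = b j"
      using u by (simp add: hj fmod.scale_scale u_def flip: const_mult)
    ultimately have bj: "b j \<in> fmod.span (b ` ({..<r} - {j}))" by simp
    \<comment> \<open>The redundant generator is overwritten by the last one, so that the remaining
      \<open>r - 1\<close> generators are again indexed by an initial segment.\<close>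
    define b' where "b' = b(j := b (r - 1))"
    define \<delta>' where "\<delta>' = \<delta>(j := \<delta> (r - 1))"
    have img: "b' ` {..<r - 1} \<supseteq> b ` ({..<r} - {j})"
    proof
      fix x assume "x \<in> b ` ({..<r} - {j})"
      then obtain l where "x = b l" "l < r" "l \<noteq> j" by blast
      then show "x \<in> b' ` {..<r - 1}"
        using j by (cases "l = r - 1") (force simp: b'_def image_iff)+
    qed
    have "b ` {..<r} \<subseteq> fmod.span (b ` ({..<r} - {j}))"
      using bj by (auto intro: fmod.span_base)
    then have "fmod.span (b ` {..<r}) \<subseteq> fmod.span (b ` ({..<r} - {j}))"
      by (rule fmod.span_minimal) simp
    also have "\<dots> \<subseteq> fmod.span (b' ` {..<r - 1})" by (rule fmod.span_mono[OF img])
    finally have "G (r - 1) b' \<delta>'"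
      using G j by (auto simp: G_def b'_def \<delta>'_def)
    then show False using least[of "r - 1"] j by auto
  qed
  have "N = matrix_map (length ds) r A ` free_module V r"
    using sub1 sub2 by auto
  then show ?thesis
    using deg min by (intro exI[of _ ds'] exI[of _ A]) (simp add: len)
qed

section \<open>Minimal homogeneous generators\<close>

text \<open>Each coefficient may be replaced by its component of the complementary degree, which
  also puts it into K[V]. All entries of a vector carry the same degree here, without shifts between
  positions.\<close>

lemma hom_span_coeffs:
  fixes b :: "'i \<Rightarrow> 'k \<Rightarrow> ('v, 'a::comm_ring_1) mpoly"
  assumes I: "finite I" and x: "x \<in> fmod.span (b ` I)" "\<And>k. x k \<in> hom_polys V d"
    and b: "\<And>i k. i \<in> I \<Longrightarrow> b i k \<in> hom_polys V (\<delta> i)"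
  shows "\<exists>p. (\<forall>i. p i \<in> hom_polys V (d - \<delta> i)) \<and> x = (\<Sum>i\<in>I. fscale (p i) (b i))"
proof -
  obtain p where p: "x = (\<Sum>i\<in>I. fscale (p i) (b i))"
    using span_indexed[OF I x(1)] by blast
  have "x = (\<Sum>i\<in>I. fscale (hcomp V (d - \<delta> i) (p i)) (b i))"
  proof
    fix k
    have "x k = hcomp V d (x k)" by (simp add: hcomp_id[OF x(2)])
    also have "\<dots> = (\<Sum>i\<in>I. hcomp V d (p i * b i k))"
      by (subst p) (simp add: sum_fun_apply hcomp_sum)
    also have "\<dots> = (\<Sum>i\<in>I. hcomp V (d - \<delta> i) (p i) * b i k)"
      by (intro sum.cong refl hcomp_mult b)
    finally show "x k = (\<Sum>i\<in>I. fscale (hcomp V (d - \<delta> i) (p i)) (b i)) k"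
      by (simp add: sum_fun_apply)
  qed
  then show ?thesis
    by (intro exI[of _ "\<lambda>i. hcomp V (d - \<delta> i) (p i)"]) simp
qed

text \<open>Expressing \<open>b l\<close> through \<open>H\<close> and \<open>H\<close> back through
  the \<open>b i\<close> gives a relation whose coefficient at \<open>l\<close> is a sum of products
  minus 1. By minimality its constant term vanishes, so some coefficient of \<open>b l\<close> over
  \<open>H\<close> has a nonzero constant term. This coefficient is homogeneous of degree
  \<open>\<delta> l - D\<close>, hence the degrees agree.\<close>

lemma minimal_generators_degree:
  fixes b :: "nat \<Rightarrow> 'k \<Rightarrow> ('v, 'a::field) mpoly"
  assumes b: "\<And>l k. l < r \<Longrightarrow> b l k \<in> hom_polys V (\<delta> l)"
    and H: "finite H" "\<And>h k. h \<in> H \<Longrightarrow> h k \<in> hom_polys V D"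
    and gen1: "\<And>l. l < r \<Longrightarrow> b l \<in> fmod.span H"
    and gen2: "\<And>h. h \<in> H \<Longrightarrow> h \<in> fmod.span (b ` {..<r})"
    and min: "\<And>c l. \<forall>l<r. c l \<in> polys V \<Longrightarrow> (\<Sum>l<r. fscale (c l) (b l)) = 0 \<Longrightarrow> l < r \<Longrightarrow>
                Poly_Mapping.lookup (c l) 0 = 0"
    and l: "l < r"
  shows "\<delta> l = D"
proof -
  obtain P where P: "\<And>h. P h \<in> hom_polys V (\<delta> l - D)" "b l = (\<Sum>h\<in>H. fscale (P h) h)"
    using hom_span_coeffs[of H "b l" "\<lambda>h. h" V "\<delta> l" "\<lambda>_. D"] H gen1[OF l] b[OF l] by auto
  have "\<forall>h\<in>H. \<exists>c. (\<forall>i. c i \<in> hom_polys V (D - \<delta> i)) \<and> h = (\<Sum>i<r. fscale (c i) (b i))"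
    using hom_span_coeffs[of "{..<r}" _ b V D \<delta>] gen2 H(2) b by auto
  then obtain c where "\<forall>h\<in>H. (\<forall>i. c h i \<in> hom_polys V (D - \<delta> i)) \<and> h = (\<Sum>i<r. fscale (c h i) (b i))"
    by (rule bchoice[THEN exE])
  note c = bspec[OF this, THEN conjunct1, rule_format] bspec[OF this, THEN conjunct2]
  \<comment> \<open>The coefficients of the resulting relation: the round trip through
    \<open>H\<close> minus the \<open>l\<close>-th unit vector.\<close>
  define s where "s = (\<lambda>i. (\<Sum>h\<in>H. P h * c h i) - (if i = l then 1 else 0))"
  have "(\<Sum>i<r. fscale (s i) (b i)) = (\<Sum>i<r. \<Sum>h\<in>H. fscale (P h) (fscale (c h i) (b i)))
      - (\<Sum>i<r. if i = l then b i else 0)"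
  proof -
    have "fscale (s i) (b i) = (\<Sum>h\<in>H. fscale (P h) (fscale (c h i) (b i))) - (if i = l then b i else 0)" for i
      by (simp add: s_def fmod.scale_left_diff_distrib fmod.scale_sum_left)
    then show ?thesis by (simp only: sum_subtractf)
  qed
  also have "(\<Sum>i<r. \<Sum>h\<in>H. fscale (P h) (fscale (c h i) (b i))) = (\<Sum>h\<in>H. fscale (P h) (\<Sum>i<r. fscale (c h i) (b i)))"
    by (subst sum.swap) (simp only: fmod.scale_sum_right)
  also have "\<dots> = b l"
    unfolding P(2) by (intro sum.cong refl arg_cong[of _ _ "fscale _"] c(2)[symmetric])
  also have "(\<Sum>i<r. if i = l then b i else 0) = b l" using l by simp
  finally have "(\<Sum>i<r. fscale (s i) (b i)) = 0" by (simp only: diff_self)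
  moreover have "\<forall>i<r. s i \<in> polys V"
    using P(1) c(1) unfolding s_def
    by (auto intro!: polys_diff polys_sum polys_mult_closed one_in_polys intro: hom_polys_polys)
  ultimately have "Poly_Mapping.lookup (s l) 0 = 0" using min l by blast
  then have "(\<Sum>h\<in>H. Poly_Mapping.lookup (P h) 0 * Poly_Mapping.lookup (c h l) 0) \<noteq> 0"
    by (simp add: s_def lookup_minus lookup_sum lookup_mult_0)
  then obtain h where "h \<in> H" "Poly_Mapping.lookup (P h) 0 \<noteq> 0"
    by (metis (no_types, lifting) mult_zero_left sum.neutral)
  then have "\<delta> l - D = 0" using hom_polys_lookup_0[OF P(1)] by blast
  then show ?thesis by simp
qed

text \<open>Once all degrees equal \<open>D\<close>, the coefficients passing between the
  \<open>b l\<close> and \<open>H\<close> are constants, so both are bases of one K-vector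
  space.\<close>

lemma minimal_generators_card:
  fixes b :: "nat \<Rightarrow> 'k \<Rightarrow> ('v, 'a::field) mpoly"
  assumes b: "\<And>l k. l < r \<Longrightarrow> b l k \<in> hom_polys V (\<delta> l)"
    and H: "finite H" "\<And>h k. h \<in> H \<Longrightarrow> h k \<in> hom_polys V D" "fvec.independent H"
    and gen1: "\<And>l. l < r \<Longrightarrow> b l \<in> fmod.span H"
    and gen2: "\<And>h. h \<in> H \<Longrightarrow> h \<in> fmod.span (b ` {..<r})"
    and min: "\<And>c l. \<forall>l<r. c l \<in> polys V \<Longrightarrow> (\<Sum>l<r. fscale (c l) (b l)) = 0 \<Longrightarrow> l < r \<Longrightarrow>
                Poly_Mapping.lookup (c l) 0 = 0"
  shows "r = card H"
proof -
  have \<delta>: "\<delta> l = D" if "l < r" for l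
  proof (rule minimal_generators_degree[of r b V \<delta> H D l])
    show "Poly_Mapping.lookup (c j) 0 = 0"
      if "\<forall>l<r. c l \<in> polys V" "(\<Sum>l<r. fscale (c l) (b l)) = 0" "j < r" for c j
      using that by (rule min)
  qed (use b H gen1 gen2 that in auto)
  have bD: "b l k \<in> hom_polys V D" if "l < r" for l k using b[OF that] \<delta>[OF that] by simp
  have inj: "inj_on b {..<r}"
  proof (rule inj_onI, rule ccontr)
    fix i j assume ij: "i \<in> {..<r}" "j \<in> {..<r}" "b i = b j" "i \<noteq> j"
    \<comment> \<open>Two equal generators would give a relation with coefficients 1 and -1, against
      minimality.\<close>
    define c :: "nat \<Rightarrow> ('v, 'a) mpoly" where "c = (\<lambda>l. if l = i then 1 else if l = j then - 1 else 0)"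
    have "(\<Sum>l<r. fscale (c l) (b l)) = (\<Sum>l\<in>{i, j}. fscale (c l) (b l))"
      using ij by (intro sum.mono_neutral_right) (auto simp: c_def)
    also have "\<dots> = 0" using ij(3,4) by (auto simp: c_def fun_eq_iff)
    finally have "Poly_Mapping.lookup (c i) 0 = 0"
      using ij(1) by (intro min) (auto simp: c_def one_in_polys polys_uminus)
    then show False by (simp add: c_def)
  qed
  have ind: "fvec.independent (b ` {..<r})"
  proof (rule fvec.independent_if_scalars_zero)
    fix f x assume f: "(\<Sum>x\<in>b ` {..<r}. fscale (const (f x)) x) = 0" "x \<in> b ` {..<r}"
    then obtain l where l: "l < r" "x = b l" by auto
    have "(\<Sum>l<r. fscale (const (f (b l))) (b l)) = 0"
      using f(1) by (simp add: sum.reindex[OF inj])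
    then have "Poly_Mapping.lookup (const (f (b l)) :: ('v, 'a) mpoly) 0 = 0"
      by (intro min[of "\<lambda>l. const (f (b l))"] l) simp
    then show "f x = 0" using l by simp
  qed simp
  have degree0: "p = const (Poly_Mapping.lookup p 0)" if "p \<in> hom_polys V (D - D)" for p :: "('v, 'a) mpoly"
    using hom_polys_const[of p V] that by (simp add: const_def)
  have "b ` {..<r} \<subseteq> fvec.span H"
  proof clarify
    fix l assume "l < r"
    then obtain P where P: "\<And>h. P h \<in> hom_polys V (D - D)" "b l = (\<Sum>h\<in>H. fscale (P h) h)"
      using hom_span_coeffs[of H "b l" "\<lambda>h. h" V D "\<lambda>_. D"] H gen1 bD by auto
    have "b l = (\<Sum>h\<in>H. fscale (const (Poly_Mapping.lookup (P h) 0)) h)"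
      unfolding P(2) using degree0[OF P(1)] by simp
    then show "b l \<in> fvec.span H"
      by (simp only:) (intro fvec.span_sum fvec.span_scale fvec.span_base)
  qed
  then have 1: "card (b ` {..<r}) \<le> card H"
    using fvec.independent_span_bound[OF H(1) ind] by simp
  have "H \<subseteq> fvec.span (b ` {..<r})"
  proof
    fix h assume "h \<in> H"
    then obtain P where P: "\<And>i. P i \<in> hom_polys V (D - D)" "h = (\<Sum>i<r. fscale (P i) (b i))"
      using hom_span_coeffs[of "{..<r}" h b V D "\<lambda>_. D"] H gen2 bD by auto
    have "h = (\<Sum>i<r. fscale (const (Poly_Mapping.lookup (P i) 0)) (b i))"
      by (subst P(2)) (use degree0[OF P(1)] in simp)
    moreover have "(\<Sum>i<r. fscale (const (Poly_Mapping.lookup (P i) 0)) (b i)) \<in> fvec.span (b ` {..<r})"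
      by (intro fvec.span_sum fvec.span_scale fvec.span_base) auto
    ultimately show "h \<in> fvec.span (b ` {..<r})" by simp
  qed
  then have 2: "card H \<le> card (b ` {..<r})"
    using fvec.independent_span_bound[OF _ H(3), of "b ` {..<r}"] by simp
  show ?thesis using 1 2 card_image[OF inj] by simp
qed

section \<open>Minimal free resolutions of cyclic modules\<close>

lemma poly_ring_simps:
  "carrier (poly_ring V) = polys V" "p \<otimes>\<^bsub>poly_ring V\<^esub> q = p * q" "\<one>\<^bsub>poly_ring V\<^esub> = 1"
  "\<zero>\<^bsub>poly_ring V\<^esub> = 0" "p \<oplus>\<^bsub>poly_ring V\<^esub> q = p + q"
  by (simp_all add: poly_ring_def)

lemma quotient_coset_simps:
  assumes I: "ideal I (poly_ring V :: ('v, 'a::field) mpoly ring)"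
  shows "carrier (quotient_module V I) = (\<lambda>p. I +>\<^bsub>poly_ring V\<^esub> p) ` polys V"
    and "p \<in> polys V \<Longrightarrow> I +>\<^bsub>poly_ring V\<^esub> p = \<zero>\<^bsub>quotient_module V I\<^esub> \<longleftrightarrow> p \<in> I"
    and "p \<in> polys V \<Longrightarrow> q \<in> polys V \<Longrightarrow>
      (I +>\<^bsub>poly_ring V\<^esub> p) \<oplus>\<^bsub>quotient_module V I\<^esub> (I +>\<^bsub>poly_ring V\<^esub> q) = I +>\<^bsub>poly_ring V\<^esub> (p + q)"
    and "p \<in> polys V \<Longrightarrow> q \<in> polys V \<Longrightarrow>
      p \<odot>\<^bsub>quotient_module V I\<^esub> (I +>\<^bsub>poly_ring V\<^esub> q) = I +>\<^bsub>poly_ring V\<^esub> (p * q)"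
proof -
  interpret I: ideal I "poly_ring V :: ('v, 'a) mpoly ring" by (rule I)
  interpret h: ring_hom_ring "poly_ring V :: ('v, 'a) mpoly ring" "poly_ring V Quot I" "(+>\<^bsub>poly_ring V\<^esub>) I"
    by (rule I.rcos_ring_hom_ring)
  show "carrier (quotient_module V I) = (\<lambda>p. I +>\<^bsub>poly_ring V\<^esub> p) ` polys V"
    by (auto simp: quotient_module_def Let_def FactRing_def A_RCOSETS_def' poly_ring_simps)
  show "I +>\<^bsub>poly_ring V\<^esub> p = \<zero>\<^bsub>quotient_module V I\<^esub> \<longleftrightarrow> p \<in> I" if "p \<in> polys V" for p
    using that I.a_rcos_self[of p] I.a_rcos_const[of p]
    by (auto simp: quotient_module_def Let_def FactRing_def poly_ring_simps)
  show "(I +>\<^bsub>poly_ring V\<^esub> p) \<oplus>\<^bsub>quotient_module V I\<^esub> (I +>\<^bsub>poly_ring V\<^esub> q) = I +>\<^bsub>poly_ring V\<^esub> (p + q)"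
    if "p \<in> polys V" "q \<in> polys V" for p q
    using h.hom_add[of p q] that by (simp add: quotient_module_def Let_def poly_ring_simps)
  show "p \<odot>\<^bsub>quotient_module V I\<^esub> (I +>\<^bsub>poly_ring V\<^esub> q) = I +>\<^bsub>poly_ring V\<^esub> (p * q)"
    if "p \<in> polys V" "q \<in> polys V" for p q
    using h.hom_mult[of p q] that by (simp add: quotient_module_def Let_def poly_ring_simps)
qed

lemma augmentation_quotient:
  assumes I: "ideal I (poly_ring V :: ('v, 'a::field) mpoly ring)"
    and p: "\<And>k. k < r \<Longrightarrow> p k \<in> polys V" "\<And>k. k < r \<Longrightarrow> e k = I +>\<^bsub>poly_ring V\<^esub> p k"
    and c: "\<And>k. k < r \<Longrightarrow> c k \<in> polys V"
  shows "augmentation (quotient_module V I) r e c = I +>\<^bsub>poly_ring V\<^esub> (\<Sum>k<r. c k * p k)"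
proof -
  let ?M = "quotient_module V I"
  interpret M: Module.module "poly_ring V :: ('v, 'a) mpoly ring" ?M by (rule module_quotient_module[OF I])
  note simps = quotient_coset_simps[OF I]
  have zero: "\<zero>\<^bsub>?M\<^esub> = I +>\<^bsub>poly_ring V\<^esub> 0"
    using simps(2)[of 0] additive_subgroup.zero_closed[OF ideal.axioms(1)[OF I]]
    by (simp add: poly_ring_simps)
  have tm: "c k \<odot>\<^bsub>?M\<^esub> e k = I +>\<^bsub>poly_ring V\<^esub> (c k * p k)" "c k * p k \<in> polys V" if "k < r" for k
    using that p c by (simp_all add: simps polys_mult_closed)
  have "(\<Oplus>\<^bsub>?M\<^esub>k \<in> {..<n}. c k \<odot>\<^bsub>?M\<^esub> e k) = I +>\<^bsub>poly_ring V\<^esub> (\<Sum>k<n. c k * p k)" if "n \<le> r" for n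
    using that
  proof (induction n)
    case 0
    show ?case by (simp add: zero)
  next
    case (Suc n)
    have "(\<Oplus>\<^bsub>?M\<^esub>k \<in> {..<Suc n}. c k \<odot>\<^bsub>?M\<^esub> e k) = c n \<odot>\<^bsub>?M\<^esub> e n \<oplus>\<^bsub>?M\<^esub> (\<Oplus>\<^bsub>?M\<^esub>k \<in> {..<n}. c k \<odot>\<^bsub>?M\<^esub> e k)"
      unfolding lessThan_Suc using Suc.prems tm by (subst M.finsum_insert) (auto simp: simps(1))
    also have "\<dots> = I +>\<^bsub>poly_ring V\<^esub> (c n * p n + (\<Sum>k<n. c k * p k))"
    proof -
      have "(\<Sum>k<n. c k * p k) \<in> polys V" using Suc.prems tm(2) by (intro polys_sum) auto
      then show ?thesis using Suc tm by (simp add: simps(3))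
    qed
    finally show ?case by (simp add: add.commute)
  qed
  then show ?thesis by (simp add: augmentation_def)
qed

lemma matrix_map_unit:
  assumes "l < s"
  shows "matrix_map r s A (\<lambda>i. if i = l then 1 else 0) = (\<lambda>k. if k < r then A k l else 0)"
  using assms by (auto simp: matrix_map_def fun_eq_iff if_distrib cong: if_cong)

lemma unit_free_module:
  "l < s \<Longrightarrow> (\<lambda>i. if i = l then 1 else 0) \<in> (free_module V s :: (nat \<Rightarrow> ('v, 'a::comm_ring_1) mpoly) set)"
  by (auto simp: free_module_def one_in_polys)

text \<open>The entry degrees make the matrix map commute with taking components, so each component
  of a kernel element is in the kernel.\<close>

lemma graded_submodule_kernel:
  fixes A :: "nat \<Rightarrow> nat \<Rightarrow> ('v, 'a::comm_ring_1) mpoly"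
  assumes A: "\<And>k l. k < length ds \<Longrightarrow> l < length ds' \<Longrightarrow> A k l \<in> hom_polys V (ds' ! l - ds ! k)"
  shows "graded_submodule V ds' {c \<in> free_module V (length ds'). matrix_map (length ds) (length ds') A c = (\<lambda>_. 0)}"
  unfolding graded_submodule_def
proof (intro conjI ballI allI)
  let ?F = "free_module V (length ds') :: (nat \<Rightarrow> ('v, 'a) mpoly) set"
  let ?N = "{c \<in> ?F. matrix_map (length ds) (length ds') A c = (\<lambda>_. 0)}"
  have iff: "c \<in> ?N \<longleftrightarrow> c \<in> ?F \<and> (\<forall>k<length ds. (\<Sum>l<length ds'. A k l * c l) = 0)" for c
    by (auto simp: matrix_map_def fun_eq_iff)
  show "?N \<subseteq> ?F" by blast
  show "0 \<in> ?N" unfolding iff by (simp add: free_module_def)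
  show "c + c' \<in> ?N" if "c \<in> ?N" "c' \<in> ?N" for c c'
    using that unfolding iff
    by (auto simp: free_module_def polys_add_closed distrib_left sum.distrib)
  show "fscale p c \<in> ?N" if "p \<in> polys V" "c \<in> ?N" for p c
  proof -
    have "(\<Sum>l<length ds'. A k l * fscale p c l) = p * (\<Sum>l<length ds'. A k l * c l)" for k
      by (simp add: sum_distrib_left mult_ac)
    then show ?thesis
      using that unfolding iff by (auto simp: free_module_def polys_mult_closed)
  qed
  show "vcomp V ds' \<delta> c \<in> ?N" if c: "c \<in> ?N" for \<delta> c
    unfolding iff
  proof (intro conjI allI impI)
    show "vcomp V ds' \<delta> c \<in> ?F" using vcomp_hom_vecs[of V ds' \<delta> c] by (simp add: hom_vecs_def)
    fix k assume k: "k < length ds"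
    have "(\<Sum>l<length ds'. A k l * vcomp V ds' \<delta> c l)
        = (\<Sum>l<length ds'. hcomp V (\<delta> - ds ! k) (c l * A k l))"
    proof (intro sum.cong refl)
      fix l assume "l \<in> {..<length ds'}"
      then show "A k l * vcomp V ds' \<delta> c l = hcomp V (\<delta> - ds ! k) (c l * A k l)"
        using hcomp_mult[OF A[OF k], of l "\<delta> - ds ! k" "c l"] by (simp add: vcomp_def mult.commute)
    qed
    also have "\<dots> = 0"
      using c k unfolding iff by (simp add: mult.commute flip: hcomp_sum)
    finally show "(\<Sum>l<length ds'. A k l * vcomp V ds' \<delta> c l) = 0" .
  qed
qed

text \<open>The matrices are found by dependent choice, each one covering the kernel of the previous
  one by minimal generators. The columns of \<open>A 0\<close> lie in \<open>I\<close>; those of a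
  later matrix lie in the kernel of its predecessor, whose elements have entries in the maximal
  ideal by the choice of that predecessor.\<close>

lemma minimal_resolution_exists:
  fixes I :: "('v::linorder, 'a::field) mpoly set"
  assumes V: "finite V" and I: "ideal I (poly_ring V)" "I \<subseteq> irrelevant_ideal V"
    and grI: "\<And>p \<delta>. p \<in> I \<Longrightarrow> hcomp V \<delta> p \<in> I"
  shows "\<exists>d A e. minimal_graded_free_resolution V (quotient_module V I) d A e"
proof -
  interpret I: ideal I "poly_ring V :: ('v, 'a) mpoly ring" by (rule I(1))
  note simps = quotient_coset_simps[OF I(1)]
  define Fr where "Fr = (\<lambda>r. free_module V r :: (nat \<Rightarrow> ('v, 'a) mpoly) set)"
  \<comment> \<open>The ideal as a submodule of the free module of rank 1, to be covered by the
    first matrix.\<close>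
  define N0 where "N0 = {c \<in> Fr 1. c 0 \<in> I}"
  have Iadd: "p + q \<in> I" if "p \<in> I" "q \<in> I" for p q
    using additive_subgroup.a_closed[OF I.additive_subgroup_axioms that] by (simp add: poly_ring_simps)
  have Imult: "p * q \<in> I" if "p \<in> polys V" "q \<in> I" for p q
    using I.I_l_closed[OF that(2), of p] that(1) by (simp add: poly_ring_simps)
  have I0: "0 \<in> I" using additive_subgroup.zero_closed[OF I.additive_subgroup_axioms] by (simp add: poly_ring_simps)
  have gr0: "graded_submodule V [0] N0"
    unfolding graded_submodule_def N0_def Fr_def
    by (auto simp: free_module_def I0 Iadd Imult polys_add_closed polys_mult_closed vcomp_def grI
        hom_polys_polys[OF hcomp_in])
  define P where "P = (\<lambda>(n::nat) (ds :: int list, ds' :: int list, A :: nat \<Rightarrow> nat \<Rightarrow> ('v, 'a) mpoly).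
    (\<forall>k<length ds. \<forall>l<length ds'. A k l \<in> hom_polys V (ds' ! l - ds ! k)) \<and>
    (\<forall>c\<in>Fr (length ds'). matrix_map (length ds) (length ds') A c = (\<lambda>_. 0) \<longrightarrow>
        (\<forall>l<length ds'. c l \<in> irrelevant_ideal V)) \<and>
    (n = 0 \<longrightarrow> ds = [0] \<and> N0 = matrix_map (length ds) (length ds') A ` Fr (length ds')))"
  define Q where "Q = (\<lambda>(n::nat) (ds :: int list, ds' :: int list, A :: nat \<Rightarrow> nat \<Rightarrow> ('v, 'a) mpoly)
      (es :: int list, es' :: int list, B :: nat \<Rightarrow> nat \<Rightarrow> ('v, 'a) mpoly). es = ds' \<and>
      {c \<in> Fr (length ds'). matrix_map (length ds) (length ds') A c = (\<lambda>_. 0)}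
        = matrix_map (length es) (length es') B ` Fr (length es'))"
  have "\<exists>f. \<forall>n. P n (f n) \<and> Q n (f n) (f (Suc n))"
  proof (rule dependent_nat_choice)
    obtain ds' A where "(\<forall>k<length [0::int]. \<forall>l<length ds'. A k l \<in> hom_polys V (ds' ! l - [0] ! k)) \<and>
       N0 = matrix_map (length [0::int]) (length ds') A ` free_module V (length ds') \<and>
       (\<forall>c\<in>free_module V (length ds'). matrix_map (length [0::int]) (length ds') A c = (\<lambda>_. 0) \<longrightarrow>
        (\<forall>l<length ds'. c l \<in> irrelevant_ideal V))"
      using graded_submodule_minimal_generators[OF V gr0] by blast
    then have "P 0 ([0], ds', A)" by (simp add: P_def Fr_def)
    then show "\<exists>x. P 0 x" by blast
  next
    fix x n assume Px: "P n x"
    obtain ds ds' A where x: "x = (ds, ds', A)" by (cases x)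
    have A: "\<And>k l. k < length ds \<Longrightarrow> l < length ds' \<Longrightarrow> A k l \<in> hom_polys V (ds' ! l - ds ! k)"
      using Px by (simp add: x P_def)
    obtain es' B where B: "\<forall>k<length ds'. \<forall>l<length es'. B k l \<in> hom_polys V (es' ! l - ds' ! k)"
      "{c \<in> free_module V (length ds'). matrix_map (length ds) (length ds') A c = (\<lambda>_. 0)}
        = matrix_map (length ds') (length es') B ` free_module V (length es')"
      "\<forall>c\<in>free_module V (length es'). matrix_map (length ds') (length es') B c = (\<lambda>_. 0) \<longrightarrow>
        (\<forall>l<length es'. c l \<in> irrelevant_ideal V)"
      using graded_submodule_minimal_generators[OF V graded_submodule_kernel[of ds ds' A, OF A]] by blast
    have "P (Suc n) (ds', es', B)" unfolding P_def Fr_def using B(1,3) by simp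
    moreover have "Q n x (ds', es', B)" unfolding x Q_def Fr_def using B(2) by simp
    ultimately show "\<exists>y. P (Suc n) y \<and> Q n x y" by blast
  qed
  then obtain f where f: "\<And>n. P n (f n)" "\<And>n. Q n (f n) (f (Suc n))" by blast
  define d where "d = (\<lambda>n. fst (f n))"
  define A where "A = (\<lambda>n. snd (snd (f n)))"
  have dS: "fst (snd (f n)) = d (Suc n)" for n
    using f(2)[of n] by (simp add: Q_def d_def split: prod.splits)
  have fn: "f n = (d n, d (Suc n), A n)" for n
    using dS[of n] by (simp add: d_def A_def prod_eq_iff)
  have hom: "A n k l \<in> hom_polys V (d (Suc n) ! l - d n ! k)" if "k < length (d n)" "l < length (d (Suc n))" for n k l
    using f(1)[of n] that by (simp add: fn P_def)
  have ker: "{c \<in> Fr (length (d (Suc n))). matrix_map (length (d n)) (length (d (Suc n))) (A n) c = (\<lambda>_. 0)}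
      = matrix_map (length (d (Suc n))) (length (d (Suc (Suc n)))) (A (Suc n)) ` Fr (length (d (Suc (Suc n))))" for n
    using f(2)[of n] by (simp add: fn Q_def)
  have d0: "d 0 = [0]" and im0: "N0 = matrix_map (length (d 0)) (length (d 1)) (A 0) ` Fr (length (d 1))"
    using f(1)[of 0] by (simp_all add: fn P_def)
  have minker: "c l \<in> irrelevant_ideal V"
    if "c \<in> Fr (length (d (Suc n)))" "matrix_map (length (d n)) (length (d (Suc n))) (A n) c = (\<lambda>_. 0)"
      "l < length (d (Suc n))" for n c l
    using f(1)[of n] that by (simp add: fn P_def)
  have col: "(\<lambda>k. if k < length (d n) then A n k l else 0)
      \<in> matrix_map (length (d n)) (length (d (Suc n))) (A n) ` Fr (length (d (Suc n)))"
    if "l < length (d (Suc n))" for n l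
    unfolding Fr_def
  proof (rule image_eqI)
    show "(\<lambda>k. if k < length (d n) then A n k l else 0)
        = matrix_map (length (d n)) (length (d (Suc n))) (A n) (\<lambda>i. if i = l then 1 else 0)"
      by (rule matrix_map_unit[OF that, symmetric])
  qed (rule unit_free_module[OF that])
  have irr: "A n k l \<in> irrelevant_ideal V" if "k < length (d n)" "l < length (d (Suc n))" for n k l
  proof (cases n)
    case 0
    have "(\<lambda>k. if k < length (d 0) then A 0 k l else 0) \<in> N0"
      using col[of l 0] that(2) by (simp add: im0 0)
    then have "A 0 0 l \<in> I" by (simp add: N0_def d0)
    then show ?thesis using I(2) that(1) by (auto simp: d0 0)
  next
    case (Suc m)
    define c where "c = (\<lambda>k. if k < length (d n) then A n k l else 0)"
    have "c \<in> {c \<in> Fr (length (d n)). matrix_map (length (d m)) (length (d n)) (A m) c = (\<lambda>_. 0)}"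
      using col[OF that(2)] ker[of m] by (simp only: c_def Suc)
    then have "c k \<in> irrelevant_ideal V" using minker[of c m k] that(1) by (simp add: Suc)
    then show ?thesis using that(1) by (simp add: c_def)
  qed
  define e where "e = (\<lambda>k::nat. I +>\<^bsub>poly_ring V\<^esub> (1 :: ('v, 'a) mpoly))"
  have aug: "augmentation (quotient_module V I) (length (d 0)) e c = I +>\<^bsub>poly_ring V\<^esub> c 0" if "c \<in> Fr 1" for c
    using augmentation_quotient[OF I(1), of 1 "\<lambda>_. 1" e c] that
    by (simp add: d0 e_def one_in_polys Fr_def free_module_def)
  have surj: "augmentation (quotient_module V I) (length (d 0)) e ` Fr 1 = carrier (quotient_module V I)"
  proof -
    have "(\<lambda>c. c 0) ` Fr 1 = polys V"
    proof
      show "polys V \<subseteq> (\<lambda>c. c 0) ` Fr 1"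
      proof
        fix p :: "('v, 'a) mpoly" assume "p \<in> polys V"
        then show "p \<in> (\<lambda>c. c 0) ` Fr 1"
          by (intro image_eqI[of _ _ "\<lambda>k. if k = 0 then p else 0"]) (auto simp: Fr_def free_module_def)
      qed
    qed (auto simp: Fr_def free_module_def)
    then have "carrier (quotient_module V I) = (\<lambda>c. I +>\<^bsub>poly_ring V\<^esub> c 0) ` Fr 1"
      unfolding simps(1) by (metis image_image)
    then show ?thesis using aug by (simp cong: image_cong)
  qed
  have ker0: "{c \<in> Fr 1. augmentation (quotient_module V I) (length (d 0)) e c = \<zero>\<^bsub>quotient_module V I\<^esub>} = N0"
    unfolding N0_def using aug simps(2) by (auto simp: Fr_def free_module_def)
  have comp: "e k \<in> component (quotient_module V I) 0" for k
    by (auto simp: e_def quotient_module_def Let_def)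
  have "minimal_graded_free_resolution V (quotient_module V I) d A e"
    unfolding minimal_graded_free_resolution_def graded_free_resolution_def Let_def
    using comp hom surj ker0 im0 ker irr by (simp add: d0 Fr_def)
  then show ?thesis by blast
qed

text \<open>Since \<open>I\<close> lies in the maximal ideal, generating the class of 1 requires
  some generator with a lift of nonzero constant term; by homogeneity that lift is a nonzero
  constant. Any further generator would be a multiple of it, giving a kernel element with an entry
  1, which minimality excludes.\<close>

lemma minimal_resolution_start:
  fixes I :: "('v, 'a::field) mpoly set"
  assumes I: "ideal I (poly_ring V)" "I \<subseteq> irrelevant_ideal V"
    and res: "minimal_graded_free_resolution V (quotient_module V I) d A e"
  shows "d 0 = [0]"
    and "{c \<in> free_module V 1. c 0 \<in> I} = matrix_map 1 (length (d 1)) (A 0) ` free_module V (length (d 1))"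
proof -
  interpret I: ideal I "poly_ring V :: ('v, 'a) mpoly ring" by (rule I(1))
  note simps = quotient_coset_simps[OF I(1)]
  let ?M = "quotient_module V I" and ?r = "length (d 0)" and ?s = "length (d 1)"
  let ?F = "\<lambda>r. free_module V r :: (nat \<Rightarrow> ('v, 'a) mpoly) set"
  have e: "\<And>k. k < ?r \<Longrightarrow> e k \<in> component ?M (d 0 ! k)"
    and surj: "augmentation ?M ?r e ` ?F ?r = carrier ?M"
    and ker: "{c \<in> ?F ?r. augmentation ?M ?r e c = \<zero>\<^bsub>?M\<^esub>} = matrix_map ?r ?s (A 0) ` ?F ?s"
    and irr: "\<And>k l. k < ?r \<Longrightarrow> l < ?s \<Longrightarrow> A 0 k l \<in> irrelevant_ideal V"
    using res by (simp_all add: minimal_graded_free_resolution_def graded_free_resolution_def Let_def)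
  have "\<forall>k\<in>{..<?r}. \<exists>q. q \<in> hom_polys V (d 0 ! k) \<and> e k = I +>\<^bsub>poly_ring V\<^esub> q"
    using e by (auto simp: quotient_module_def Let_def)
  then obtain q where "\<forall>k\<in>{..<?r}. q k \<in> hom_polys V (d 0 ! k) \<and> e k = I +>\<^bsub>poly_ring V\<^esub> q k"
    by (rule bchoice[THEN exE])
  then have q: "\<And>k. k < ?r \<Longrightarrow> q k \<in> hom_polys V (d 0 ! k)"
    "\<And>k. k < ?r \<Longrightarrow> e k = I +>\<^bsub>poly_ring V\<^esub> q k"
    by auto
  have qV: "q k \<in> polys V" if "k < ?r" for k using q(1)[OF that] by (rule hom_polys_polys)
  have aug: "augmentation ?M ?r e c = I +>\<^bsub>poly_ring V\<^esub> (\<Sum>k<?r. c k * q k)" if "c \<in> ?F ?r" for c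
    using that by (intro augmentation_quotient[OF I(1)] qV q(2)) (auto simp: free_module_def)
  have sumV: "(\<Sum>k<?r. c k * q k) \<in> polys V" if "c \<in> ?F ?r" for c
    using that qV by (intro polys_sum polys_mult_closed) (auto simp: free_module_def)
  have kerI: "c \<in> matrix_map ?r ?s (A 0) ` ?F ?s \<longleftrightarrow> c \<in> ?F ?r \<and> (\<Sum>k<?r. c k * q k) \<in> I" for c
    using aug simps(2)[OF sumV] unfolding ker[symmetric] by auto
  have im_irr: "Poly_Mapping.lookup (c k) 0 = 0" if "c \<in> matrix_map ?r ?s (A 0) ` ?F ?s" "k < ?r" for c k
  proof -
    from that(1) obtain b where "c = matrix_map ?r ?s (A 0) b" by blast
    then have "c k = (\<Sum>l<?s. A 0 k l * b l)" using that(2) by (simp add: matrix_map_def)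
    then show ?thesis using irr[OF that(2)] by (simp add: lookup_sum lookup_mult_0 irrelevant_ideal_def)
  qed
  have "I +>\<^bsub>poly_ring V\<^esub> 1 \<in> carrier ?M" unfolding simps(1) by (simp add: one_in_polys)
  then obtain c where c: "c \<in> ?F ?r" "I +>\<^bsub>poly_ring V\<^esub> (\<Sum>k<?r. c k * q k) = I +>\<^bsub>poly_ring V\<^esub> 1"
    unfolding surj[symmetric] using aug by auto
  have "(\<Sum>k<?r. c k * q k) \<in> I +>\<^bsub>poly_ring V\<^esub> (\<Sum>k<?r. c k * q k)"
    using sumV[OF c(1)] by (intro I.a_rcos_self) (simp add: poly_ring_simps)
  \<comment> \<open>The lift of 1 differs from 1 by an element of \<open>I\<close>, so its constant
    term is 1.\<close>
  then obtain h where h: "h \<in> I" "(\<Sum>k<?r. c k * q k) = h + 1"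
    unfolding c(2) by (auto simp: a_r_coset_def' poly_ring_simps)
  have "Poly_Mapping.lookup (\<Sum>k<?r. c k * q k) 0 = 1"
    unfolding h(2) using h(1) I(2) by (auto simp: lookup_add irrelevant_ideal_def)
  then have "(\<Sum>k<?r. Poly_Mapping.lookup (c k) 0 * Poly_Mapping.lookup (q k) 0) \<noteq> 0"
    by (simp add: lookup_sum lookup_mult_0)
  then obtain k where k: "k < ?r" "Poly_Mapping.lookup (q k) 0 \<noteq> 0"
    by (metis (no_types, lifting) mult_zero_right sum.neutral lessThan_iff)
  define u where "u = Poly_Mapping.lookup (q k) 0"
  have dk: "d 0 ! k = 0" using hom_polys_lookup_0[OF q(1)[OF k(1)]] k(2) by blast
  have qk: "q k = const u"
    using hom_polys_const[of "q k" V] q(1)[OF k(1)] by (simp add: dk u_def const_def)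
  have uq: "const (inverse u) * q k = 1" "q k * const (inverse u) = 1"
    using k(2) unfolding qk by (simp_all add: u_def flip: const_mult)
  have "l = k" if l: "l < ?r" for l
  proof (rule ccontr)
    assume "l \<noteq> k"
    \<comment> \<open>The relation expressing generator \<open>l\<close> as a multiple of generator
      \<open>k\<close>; its entry at \<open>l\<close> is 1.\<close>
    define b where "b = (\<lambda>i. if i = l then 1 else if i = k then - (const (inverse u) * q l) else 0)"
    have "(\<Sum>i<?r. b i * q i) = (\<Sum>i\<in>{l, k}. b i * q i)"
      using l k by (intro sum.mono_neutral_right) (auto simp: b_def)
    also have "\<dots> = b l * q l + b k * q k" using \<open>l \<noteq> k\<close> by simp
    also have "b l * q l = q l" by (simp add: b_def)
    also have "b k * q k = - (const (inverse u) * q k * q l)"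
      using \<open>l \<noteq> k\<close> by (simp add: b_def mult_ac)
    also have "\<dots> = - q l" by (simp only: uq mult_1)
    also have "q l + - q l = 0" by simp
    finally have "(\<Sum>i<?r. b i * q i) \<in> I"
      using additive_subgroup.zero_closed[OF I.additive_subgroup_axioms] by (simp add: poly_ring_simps)
    moreover have "b \<in> ?F ?r"
      using l k qV by (auto simp: b_def free_module_def one_in_polys polys_mult_closed polys_uminus)
    ultimately have "Poly_Mapping.lookup (b l) 0 = 0" using kerI im_irr l by blast
    then show False by (simp add: b_def)
  qed
  from this[of "?r - 1"] this[of 0] have "?r - 1 = k" "0 = k" using k(1) by linarith+
  then have r: "?r = 1" using k(1) by linarith
  then have k0: "k = 0" using k(1) by simp
  show "d 0 = [0]" using r dk k0 by (cases "d 0") auto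
  have "c 0 * q 0 \<in> I \<longleftrightarrow> c 0 \<in> I" if "c \<in> ?F 1" for c
  proof
    have V: "c 0 \<in> polys V" "q 0 \<in> polys V" using that qV k(1) k0 by (auto simp: free_module_def)
    have mult: "p * h \<in> I" if "p \<in> polys V" "h \<in> I" for p h
      using I.I_l_closed[OF that(2), of p] that(1) by (simp add: poly_ring_simps)
    show "c 0 * q 0 \<in> I" if "c 0 \<in> I"
      using mult[OF V(2) that] by (simp add: mult.commute)
    show "c 0 \<in> I" if "c 0 * q 0 \<in> I"
      using mult[OF const_polys that, of "inverse u"] uq(1) unfolding k0 by (simp add: mult.left_commute)
  qed
  then show "{c \<in> free_module V 1. c 0 \<in> I} = matrix_map 1 ?s (A 0) ` free_module V ?s"
    using kerI unfolding r by auto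
qed

section \<open>Colon ideals\<close>

lemma var_in_polys: "v \<in> V \<Longrightarrow> var v \<in> polys V"
  unfolding var_def by (rule polys_single) simp

lemma var_hom: "v \<in> V \<Longrightarrow> var v \<in> hom_polys V 1"
  unfolding var_def by (rule hom_polys_single) simp_all

lemma restrict_vars_var: "restrict_vars V (var v) = (if v \<in> V then var v else 0)"
  by (simp add: restrict_vars_def var_def pfilter_single)

lemma ideal_span_mult_right: "x \<in> ideal.span S \<Longrightarrow> x * y \<in> ideal.span S"
  using ideal.span_scale[of x S y] by (simp add: mult.commute)

lemma ideal_span_mult_add: "b \<in> S \<Longrightarrow> y \<in> ideal.span S \<Longrightarrow> c * b + y \<in> ideal.span S"
  by (rule ideal.span_add[OF ideal.span_scale[OF ideal.span_base]])

lemma ideal_span_hom: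
  assumes x: "x \<in> ideal.span S"
    and h: "h 0 = 0" "\<And>a b. h (a + b) = h a + h b" "\<And>a b. h (a * b) = h a * h b"
  shows "h x \<in> ideal.span (h ` S)"
  using x
proof (induction rule: ideal.span_induct_alt)
  case base
  show ?case by (simp add: h ideal.span_zero)
next
  case (step c x y)
  then show ?case unfolding h by (intro ideal_span_mult_add) auto
qed

lemma ideal_span_scaled:
  assumes "x \<in> ideal.span ((*) z ` S)"
  shows "\<exists>s\<in>ideal.span S. x = z * s"
  using assms
proof (induction rule: ideal.span_induct_alt)
  case base
  show ?case using ideal.span_zero[of S] by (intro bexI[of _ 0]) simp_all
next
  case (step c x y)
  then obtain s t where "s \<in> S" "x = z * s" "t \<in> ideal.span S" "y = z * t" by blast
  then show ?case
    by (intro bexI[of _ "c * s + t"] ideal_span_mult_add) (auto simp: algebra_simps)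
qed

text \<open>
  \<open>slice V \<phi>\<close> is the \<open>K[-V]\<close>-linear extension of the functional \<open>\<phi>\<close> along
  \<open>K[UNIV] = K[V] \<otimes> K[-V]\<close>.
\<close>

definition slice :: "'v set \<Rightarrow> (('v, 'a) mpoly \<Rightarrow> 'a) \<Rightarrow> ('v, 'a::field) mpoly \<Rightarrow> ('v, 'a) mpoly" where
  "slice V \<phi> p = (\<Sum>m\<in>Poly_Mapping.keys p. Poly_Mapping.single (pfilter (\<lambda>v. v \<notin> V) m)
     (Poly_Mapping.lookup p m * \<phi> (Poly_Mapping.single (pfilter (\<lambda>v. v \<in> V) m) 1)))"

lemma slice_superset:
  assumes "finite A" "Poly_Mapping.keys p \<subseteq> A"
  shows "slice V \<phi> p = (\<Sum>m\<in>A. Poly_Mapping.single (pfilter (\<lambda>v. v \<notin> V) m)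
     (Poly_Mapping.lookup p m * \<phi> (Poly_Mapping.single (pfilter (\<lambda>v. v \<in> V) m) 1)))"
  unfolding slice_def using assms by (intro sum.mono_neutral_left) (auto simp: in_keys_iff)

lemma slice_zero [simp]: "slice V \<phi> 0 = 0"
  by (simp add: slice_def)

lemma slice_add: "slice V \<phi> (p + q) = slice V \<phi> p + slice V \<phi> q"
proof -
  let ?A = "Poly_Mapping.keys p \<union> Poly_Mapping.keys q"
  have "finite ?A" "Poly_Mapping.keys (p + q) \<subseteq> ?A" by (auto simp: Poly_Mapping.keys_add)
  then show ?thesis
    by (simp add: slice_superset[of ?A] lookup_add distrib_right single_add sum.distrib)
qed

lemma slice_sum: "slice V \<phi> (sum f A) = (\<Sum>x\<in>A. slice V \<phi> (f x))"
  by (induction A rule: infinite_finite_induct) (simp_all add: slice_add)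

lemma slice_single:
  "slice V \<phi> (Poly_Mapping.single m a) = Poly_Mapping.single (pfilter (\<lambda>v. v \<notin> V) m)
     (a * \<phi> (Poly_Mapping.single (pfilter (\<lambda>v. v \<in> V) m) 1))"
  by (subst slice_superset[of "{m}"]) auto

lemma slice_mult:
  fixes p q :: "('v, 'a::field) mpoly"
  assumes "q \<in> polys (- V)"
  shows "slice V \<phi> (p * q) = slice V \<phi> p * q"
proof -
  have "slice V \<phi> (p * q) = (\<Sum>m\<in>Poly_Mapping.keys p. \<Sum>k\<in>Poly_Mapping.keys q.
      slice V \<phi> (Poly_Mapping.single m (Poly_Mapping.lookup p m)) * Poly_Mapping.single k (Poly_Mapping.lookup q k))"
    unfolding mult_sum_singles[of p q] slice_sum
  proof (intro sum.cong refl)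
    fix m k assume "k \<in> Poly_Mapping.keys q"
    then have k: "Poly_Mapping.keys k \<subseteq> - V" using assms by (auto simp: polys_def)
    have "pfilter (\<lambda>v. v \<notin> V) k = k" using k by (intro pfilter_id) auto
    moreover have "pfilter (\<lambda>v. v \<in> V) k = 0"
      using k by (intro poly_mapping_eqI) (auto simp: lookup_pfilter in_keys_iff)
    ultimately show "slice V \<phi> (Poly_Mapping.single (m + k) (Poly_Mapping.lookup p m * Poly_Mapping.lookup q k))
        = slice V \<phi> (Poly_Mapping.single m (Poly_Mapping.lookup p m)) * Poly_Mapping.single k (Poly_Mapping.lookup q k)"
      by (simp add: slice_single pfilter_add mult_single ac_simps)
  qed
  also have "\<dots> = slice V \<phi> p * q"
    by (simp only: sum_product[symmetric] slice_sum[symmetric] sum_singles)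
  finally show ?thesis .
qed

text \<open>The definition of \<open>slice\<close> evaluates \<open>\<phi>\<close> at monomials in
  \<open>V\<close> only; linearity over K recovers its value on all of K[V].\<close>

lemma slice_polys:
  fixes p :: "('v, 'a::field) mpoly"
  assumes "p \<in> polys V" and add: "\<And>x y. \<phi> (x + y) = \<phi> x + \<phi> y"
    and scale: "\<And>a x. \<phi> (const a * x) = a * \<phi> x"
  shows "slice V \<phi> p = const (\<phi> p)"
proof -
  have zero: "\<phi> 0 = 0" using scale[of 0 0] by simp
  have sum: "\<phi> (sum f A) = (\<Sum>x\<in>A. \<phi> (f x))" for f and A :: "('v \<Rightarrow>\<^sub>0 nat) set"
    by (induction A rule: infinite_finite_induct) (simp_all add: zero add)
  have csum: "const (sum f A) = (\<Sum>x\<in>A. const (f x) :: ('v, 'a) mpoly)" for f and A :: "('v \<Rightarrow>\<^sub>0 nat) set"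
    by (induction A rule: infinite_finite_induct) (simp_all add: const_add)
  have "slice V \<phi> p = (\<Sum>m\<in>Poly_Mapping.keys p. const (\<phi> (Poly_Mapping.single m (Poly_Mapping.lookup p m))))"
    unfolding slice_def
  proof (intro sum.cong refl)
    fix m assume "m \<in> Poly_Mapping.keys p"
    then have m: "Poly_Mapping.keys m \<subseteq> V" using assms(1) by (auto simp: polys_def)
    have "pfilter (\<lambda>v. v \<in> V) m = m" using m by (intro pfilter_id) auto
    moreover have "pfilter (\<lambda>v. v \<notin> V) m = 0"
      using m by (intro poly_mapping_eqI) (auto simp: lookup_pfilter in_keys_iff)
    ultimately show "Poly_Mapping.single (pfilter (\<lambda>v. v \<notin> V) m)
        (Poly_Mapping.lookup p m * \<phi> (Poly_Mapping.single (pfilter (\<lambda>v. v \<in> V) m) 1))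
        = const (\<phi> (Poly_Mapping.single m (Poly_Mapping.lookup p m)))"
      using scale[of "Poly_Mapping.lookup p m" "Poly_Mapping.single m 1"]
      by (simp add: const_def mult_single)
  qed
  also have "\<dots> = const (\<phi> p)" by (simp only: csum[symmetric] sum[symmetric] sum_singles)
  finally show ?thesis .
qed

text \<open>It suffices to treat a monomial multiple of some \<open>b\<close> in \<open>B\<close>.
  The part of the monomial outside \<open>V\<close> can be pulled out, and what remains is an
  element of K[V] in the ideal, which \<open>\<phi>\<close> kills.\<close>

lemma slice_ideal_eq_0:
  fixes B :: "('v, 'a::field) mpoly set"
  assumes B: "B \<subseteq> polys V" and add: "\<And>x y. \<phi> (x + y) = \<phi> x + \<phi> y"
    and scale: "\<And>a x. \<phi> (const a * x) = a * \<phi> x"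
    and zero: "\<And>x. x \<in> ideal.span B \<Longrightarrow> \<phi> x = 0"
    and x: "x \<in> ideal.span B"
  shows "slice V \<phi> x = 0"
  using x
proof (induction rule: ideal.span_induct_alt)
  case (step c b y)
  have "slice V \<phi> (Poly_Mapping.single m a * b) = 0" for m a
  proof -
    \<comment> \<open>Applied to a monomial instead of a polynomial, \<open>pfilter\<close> keeps
      the exponents of the selected variables.\<close>
    let ?m1 = "pfilter (\<lambda>v. v \<in> V) m" and ?m2 = "pfilter (\<lambda>v. v \<notin> V) m"
    have m: "m = ?m1 + ?m2"
      by (rule poly_mapping_eqI) (simp add: lookup_add lookup_pfilter)
    have "Poly_Mapping.single m a * b = (Poly_Mapping.single ?m1 1 * b) * Poly_Mapping.single ?m2 a"
      by (subst m) (simp add: mult_single mult_ac)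
    also have "slice V \<phi> \<dots> = slice V \<phi> (Poly_Mapping.single ?m1 1 * b) * Poly_Mapping.single ?m2 a"
      by (intro slice_mult polys_single) (auto simp: keys_pfilter)
    also have "slice V \<phi> (Poly_Mapping.single ?m1 1 * b) = const (\<phi> (Poly_Mapping.single ?m1 1 * b))"
      using B step(1) by (intro slice_polys polys_mult_closed polys_single add scale) (auto simp: keys_pfilter)
    also have "\<phi> (Poly_Mapping.single ?m1 1 * b) = 0"
      using step(1) by (intro zero ideal.span_scale ideal.span_base)
    finally show ?thesis by simp
  qed
  then have "slice V \<phi> ((\<Sum>m\<in>Poly_Mapping.keys c. Poly_Mapping.single m (Poly_Mapping.lookup c m)) * b) = 0"
    by (simp only: sum_distrib_right slice_sum sum.neutral_const)
  then show ?case using step(2) by (simp add: slice_add sum_singles)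
qed simp

text \<open>Extend a basis \<open>D\<close> of the ideal (B) to a basis \<open>E\<close> of the
  whole ring. Modulo (B), \<open>p\<close> is the sum of the products of \<open>c\<close> in
  \<open>E - D\<close> with its slice along the coordinate functional of \<open>c\<close>. That
  functional kills (B), so slicing \<open>p * g\<close> shows that each such slice lies in the colon
  ideal of (I) by \<open>g\<close>.\<close>

lemma colon_disjoint:
  fixes B I :: "('v, 'a::field) mpoly set"
  assumes B: "B \<subseteq> polys V" and I: "I \<subseteq> polys (- V)" and g: "g \<in> polys (- V)"
    and p: "p * g \<in> ideal.span (B \<union> I)"
  shows "p \<in> ideal.span (B \<union> {q. q * g \<in> ideal.span I})"
proof -
  define U where "U = ideal.span B"
  define J where "J = {q. q * g \<in> ideal.span I}"
  obtain D where D: "D \<subseteq> U" "pvec.independent D" "U \<subseteq> pvec.span D"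
    using pvec.maximal_independent_subset by blast
  define E where "E = pvec.extend_basis D"
  have E: "D \<subseteq> E" "pvec.independent E" "pvec.span E = UNIV"
    using pvec.extend_basis_superset[OF D(2)] pvec.independent_extend_basis[OF D(2)]
      pvec.span_extend_basis[OF D(2)] by (auto simp: E_def)
  define lam where "lam = (\<lambda>c x. pvec.representation E x c)"
  have lam_add: "lam c (x + y) = lam c x + lam c y" for c x y
    using pvec.representation_add[OF E(2)] E(3) by (simp add: lam_def)
  have lam_scale: "lam c (const a * x) = a * lam c x" for c a x
    using pvec.representation_scale[OF E(2)] E(3) by (simp add: lam_def)
  \<comment> \<open>An element of \<open>U\<close> is a combination of \<open>D\<close> alone, so
    its coordinates along the rest of \<open>E\<close> vanish.\<close>
  have lam_zero: "lam c x = 0" if "c \<notin> D" "x \<in> U" for c x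
  proof -
    have "pvec.representation E x = pvec.representation D x"
      using that(2) D(3) by (intro pvec.representation_extend[OF E(2) _ E(1)]) auto
    then show ?thesis using that(1) pvec.representation_ne_zero[of D x c] by (auto simp: lam_def)
  qed
  have slice_J: "slice V (lam c) p \<in> J" if "c \<notin> D" for c
  proof -
    obtain x y where xy: "p * g = x + y" "x \<in> ideal.span B" "y \<in> ideal.span I"
      using p by (auto simp: ideal.span_Un)
    have "slice V (lam c) x = 0"
      using lam_zero[OF that] xy(2) by (intro slice_ideal_eq_0[OF B lam_add lam_scale]) (auto simp: U_def)
    moreover have "slice V (lam c) y \<in> ideal.span I" using xy(3)
    proof (induction rule: ideal.span_induct_alt)
      case (step a i y)
      then have "slice V (lam c) (a * i + y) = slice V (lam c) a * i + slice V (lam c) y"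
        using I by (auto simp: slice_add intro!: slice_mult)
      then show ?case using step by (simp add: ideal_span_mult_add)
    qed (simp add: ideal.span_zero)
    moreover have "slice V (lam c) p * g = slice V (lam c) (x + y)"
      by (simp only: slice_mult[OF g, symmetric] xy(1))
    ultimately show ?thesis by (simp add: J_def slice_add)
  qed
  define fst_part :: "('v \<Rightarrow>\<^sub>0 nat) \<Rightarrow> ('v, 'a) mpoly"
    where "fst_part = (\<lambda>m. Poly_Mapping.single (pfilter (\<lambda>v. v \<in> V) m) 1)"
  define snd_part :: "('v \<Rightarrow>\<^sub>0 nat) \<Rightarrow> 'a \<Rightarrow> ('v, 'a) mpoly"
    where "snd_part = (\<lambda>m a. Poly_Mapping.single (pfilter (\<lambda>v. v \<notin> V) m) a)"
  \<comment> \<open>The finitely many basis elements occurring in the \<open>V\<close>-parts of the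
    monomials of \<open>p\<close>.\<close>
  define C where "C = (\<Union>m\<in>Poly_Mapping.keys p. {c. lam c (fst_part m) \<noteq> 0})"
  have finC: "finite C"
    unfolding C_def lam_def by (intro finite_UN_I finite_keys pvec.finite_representation)
  have expand: "x - (\<Sum>c\<in>C - D. const (lam c x) * c) \<in> U" if "m \<in> Poly_Mapping.keys p" "x = fst_part m" for m x
  proof -
    have "{c. lam c x \<noteq> 0} \<subseteq> C" using that by (auto simp: C_def)
    then have "(\<Sum>c\<in>C. const (lam c x) * c) = (\<Sum>c | lam c x \<noteq> 0. const (lam c x) * c)"
      using finC by (intro sum.mono_neutral_right) auto
    also have "\<dots> = x"
      using pvec.sum_nonzero_representation_eq[OF E(2), of x] E(3) by (simp add: lam_def)
    finally have "x = (\<Sum>c\<in>C - D. const (lam c x) * c) + (\<Sum>c\<in>C \<inter> D. const (lam c x) * c)"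
      using sum.Int_Diff[OF finC, of "\<lambda>c. const (lam c x) * c" D] by (simp add: add.commute)
    then have "x - (\<Sum>c\<in>C - D. const (lam c x) * c) = (\<Sum>c\<in>C \<inter> D. const (lam c x) * c)"
      by (simp add: algebra_simps)
    also have "\<dots> \<in> U"
      unfolding U_def using D(1) by (intro ideal.span_sum ideal.span_scale) (auto simp: U_def)
    finally show ?thesis .
  qed
  let ?S = "ideal.span (B \<union> J)"
  have US: "U \<subseteq> ?S" unfolding U_def by (rule ideal.span_mono) auto
  have "p = (\<Sum>m\<in>Poly_Mapping.keys p. fst_part m * snd_part m (Poly_Mapping.lookup p m))"
  proof -
    have "Poly_Mapping.single m a = fst_part m * snd_part m a" for m a
    proof -
      have "m = pfilter (\<lambda>v. v \<in> V) m + pfilter (\<lambda>v. v \<notin> V) m"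
        by (rule poly_mapping_eqI) (simp add: lookup_add lookup_pfilter)
      then show ?thesis by (simp add: fst_part_def snd_part_def mult_single)
    qed
    then show ?thesis using sum_singles[of p] by simp
  qed
  \<comment> \<open>Only the basis elements outside \<open>D\<close> are split off from each
    \<open>V\<close>-part; the remainder is a combination of \<open>D\<close>, hence in (B).
    Exchanging the sums collects the slices of \<open>p\<close>.\<close>
  also have "\<dots> = (\<Sum>m\<in>Poly_Mapping.keys p. (fst_part m - (\<Sum>c\<in>C - D. const (lam c (fst_part m)) * c))
        * snd_part m (Poly_Mapping.lookup p m)) + (\<Sum>c\<in>C - D. c * slice V (lam c) p)"
  proof -
    have "c * slice V (lam c) p = (\<Sum>m\<in>Poly_Mapping.keys p. const (lam c (fst_part m)) * c * snd_part m (Poly_Mapping.lookup p m))" for c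
      unfolding slice_def sum_distrib_left
      by (intro sum.cong refl) (simp add: fst_part_def snd_part_def const_def mult_single mult_ac flip: mult.assoc)
    then have "(\<Sum>c\<in>C - D. c * slice V (lam c) p) = (\<Sum>m\<in>Poly_Mapping.keys p. (\<Sum>c\<in>C - D. const (lam c (fst_part m)) * c)
        * snd_part m (Poly_Mapping.lookup p m))"
      by (simp add: sum_distrib_right sum.swap[of _ "C - D"])
    then show ?thesis by (simp add: left_diff_distrib sum_subtractf)
  qed
  also have "\<dots> \<in> ?S"
  proof (rule ideal.span_add)
    show "(\<Sum>m\<in>Poly_Mapping.keys p. (fst_part m - (\<Sum>c\<in>C - D. const (lam c (fst_part m)) * c))
        * snd_part m (Poly_Mapping.lookup p m)) \<in> ?S"
      using expand US by (intro ideal.span_sum ideal_span_mult_right) blast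
    show "(\<Sum>c\<in>C - D. c * slice V (lam c) p) \<in> ?S"
      using slice_J by (intro ideal.span_sum ideal.span_scale ideal.span_base) auto
  qed
  finally show ?thesis by (simp add: J_def)
qed

section \<open>The colon ideals of a tree\<close>

text \<open>\<open>Min\<close> and \<open>Max\<close> make this a function of the unordered edge;
  symmetry of the expression makes the choice immaterial.\<close>

definition edge_poly :: "nat set \<Rightarrow> (lss_var, 'a::field) mpoly" where
  "edge_poly e = var (X (Min e)) * var (X (Max e)) + var (Y (Min e)) * var (Y (Max e))"

definition minor :: "nat \<Rightarrow> nat \<Rightarrow> (lss_var, 'a::field) mpoly" where
  "minor i j = var (X i) * var (Y j) - var (X j) * var (Y i)"

definition minors :: "nat set \<Rightarrow> (lss_var, 'a::field) mpoly set" where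
  "minors S = {minor i j |i j. i \<in> S \<and> j \<in> S}"

definition nbrs :: "nat set set \<Rightarrow> nat \<Rightarrow> nat set" where
  "nbrs E v = {w. {v, w} \<in> E}"

definition vertex_vars :: "nat set \<Rightarrow> lss_var set" where
  "vertex_vars V = X ` V \<union> Y ` V"

text \<open>The two coordinates play symmetric roles; \<open>coords xx yy\<close> allows to swap them.\<close>

definition coords :: "(nat \<Rightarrow> lss_var) \<Rightarrow> (nat \<Rightarrow> lss_var) \<Rightarrow> bool" where
  "coords xx yy \<longleftrightarrow> xx = X \<and> yy = Y \<or> xx = Y \<and> yy = X"

lemma coords_swap: "coords xx yy \<Longrightarrow> coords yy xx"
  by (auto simp: coords_def)

lemma coords_neq:
  assumes "coords xx yy"
  shows "xx i \<noteq> yy j" "yy j \<noteq> xx i" "xx i = xx j \<longleftrightarrow> i = j" "yy i = yy j \<longleftrightarrow> i = j"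
  using assms by (auto simp: coords_def)

lemma coords_vertex_vars:
  assumes "coords xx yy"
  shows "xx v \<in> vertex_vars V \<longleftrightarrow> v \<in> V" "yy v \<in> vertex_vars V \<longleftrightarrow> v \<in> V"
  using assms by (auto simp: coords_def vertex_vars_def)

lemma edge_poly_pair:
  assumes "coords xx yy"
  shows "edge_poly {i, j} = var (xx i) * var (xx j) + var (yy i) * var (yy j)"
  using assms by (cases "i \<le> j") (auto simp: edge_poly_def coords_def max_def min_def mult.commute add.commute)

lemma minor_coords:
  assumes "coords xx yy" "i \<in> S" "j \<in> S"
  shows "var (xx i) * var (yy j) - var (xx j) * var (yy i) \<in> minors S"
  using assms(1) unfolding coords_def
proof
  assume "xx = X \<and> yy = Y"
  then show ?thesis using assms(2,3) by (auto simp: minors_def minor_def)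
next
  assume "xx = Y \<and> yy = X"
  then have "var (xx i) * var (yy j) - var (xx j) * var (yy i) = minor j i"
    by (simp add: minor_def mult.commute)
  then show ?thesis using assms(2,3) by (auto simp: minors_def)
qed

lemma edge_poly_polys:
  assumes "e \<subseteq> V" "card e = 2"
  shows "edge_poly e \<in> polys (vertex_vars V)"
proof -
  have "finite e" "e \<noteq> {}" using assms(2) card.infinite by fastforce+
  then have "Min e \<in> V" "Max e \<in> V" using assms(1) Min_in Max_in by blast+
  then show ?thesis
    unfolding edge_poly_def
    by (intro polys_add_closed polys_mult_closed var_in_polys) (auto simp: vertex_vars_def)
qed

text \<open>Cramer's rule: f_vi and f_vj are linear forms in x_v and y_v whose coefficient
  determinant is the minor of \<open>i\<close> and \<open>j\<close>.\<close>

lemma minor_mult_edge_ideal: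
  assumes "coords xx yy" "m \<in> minors (nbrs E v)"
  shows "m * var (xx v) \<in> ideal.span (edge_poly ` E)"
proof -
  obtain i j where m: "m = minor i j" "i \<in> nbrs E v" "j \<in> nbrs E v"
    using assms(2) by (auto simp: minors_def)
  have XY: "coords X Y" by (simp add: coords_def)
  have e: "edge_poly {v, i} \<in> ideal.span (edge_poly ` E)" "edge_poly {v, j} \<in> ideal.span (edge_poly ` E)"
    using m by (auto simp: nbrs_def intro: ideal.span_base)
  have 1: "m * var (X v) = var (Y j) * edge_poly {v, i} - var (Y i) * edge_poly {v, j}"
    unfolding m minor_def edge_poly_pair[OF XY] by (simp add: algebra_simps)
  have 2: "m * var (Y v) = var (X i) * edge_poly {v, j} - var (X j) * edge_poly {v, i}"
    unfolding m minor_def edge_poly_pair[OF XY] by (simp add: algebra_simps)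
  have "m * var (X v) \<in> ideal.span (edge_poly ` E)" "m * var (Y v) \<in> ideal.span (edge_poly ` E)"
    unfolding 1 2 using e by (auto intro!: ideal.span_diff ideal.span_scale)
  then show ?thesis using assms(1) by (auto simp: coords_def)
qed

section \<open>Cancelling and splitting off a variable\<close>

lemma var_mult_cancel:
  fixes p :: "('v, 'a::field) mpoly"
  assumes "p * var v = 0"
  shows "p = 0"
proof (rule poly_mapping_eqI)
  fix m
  have "Poly_Mapping.lookup (var v * p) (Poly_Mapping.single v 1 + m) = Poly_Mapping.lookup p m"
    by (simp add: var_def lookup_single_mult)
  then show "Poly_Mapping.lookup p m = Poly_Mapping.lookup 0 m"
    using assms by (simp add: mult.commute)
qed

text \<open>A variable outside \<open>V\<close> is a nonzerodivisor modulo an ideal generated in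
  K[V]: the case of an empty second ideal in \<open>colon_disjoint\<close>.\<close>

lemma ideal_span_colon_var:
  fixes B :: "('v, 'a::field) mpoly set"
  assumes B: "B \<subseteq> polys V" and v: "v \<notin> V" and p: "p * var v \<in> ideal.span B"
  shows "p \<in> ideal.span B"
proof -
  have "p \<in> ideal.span (B \<union> {q. q * var v \<in> ideal.span {}})"
    using p v by (intro colon_disjoint[OF B]) (auto intro: var_in_polys)
  moreover have "{q :: ('v, 'a) mpoly. q * var v \<in> ideal.span {}} \<subseteq> {0}"
    using var_mult_cancel[of _ v] by auto
  then have "B \<union> {q. q * var v \<in> ideal.span {}} \<subseteq> ideal.span B"
    using ideal.span_superset[of B] ideal.span_zero[of B] by blast
  then have "ideal.span (B \<union> {q. q * var v \<in> ideal.span {}}) \<subseteq> ideal.span B"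
    by (rule ideal.span_minimal) simp
  ultimately show ?thesis by blast
qed

text \<open>The first summand is \<open>p\<close> at z = 0. The bound on the exponents of
  \<open>z\<close> in \<open>q\<close> drives the induction on the degree in one variable in
  \<open>rooted_tree_colon_leaf\<close>.\<close>

lemma split_off_var:
  fixes p :: "('v, 'a::field) mpoly"
  shows "\<exists>q. p = restrict_vars (- {z}) p + var z * q \<and>
    (\<forall>n. (\<forall>m\<in>Poly_Mapping.keys p. Poly_Mapping.lookup m z < Suc n) \<longrightarrow>
         (\<forall>m\<in>Poly_Mapping.keys q. Poly_Mapping.lookup m z < n))"
proof -
  define K where "K = {m \<in> Poly_Mapping.keys p. z \<in> Poly_Mapping.keys m}"
  define q where "q = (\<Sum>m\<in>K. Poly_Mapping.single (m - Poly_Mapping.single z 1) (Poly_Mapping.lookup p m))"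
  have "var z * q = (\<Sum>m\<in>K. Poly_Mapping.single m (Poly_Mapping.lookup p m))"
    unfolding q_def sum_distrib_left
  proof (intro sum.cong refl)
    fix m assume "m \<in> K"
    then have "Poly_Mapping.single z 1 + (m - Poly_Mapping.single z 1) = m"
      by (intro poly_mapping_eqI) (auto simp: K_def in_keys_iff lookup_add lookup_minus lookup_single when_def)
    then show "var z * Poly_Mapping.single (m - Poly_Mapping.single z 1) (Poly_Mapping.lookup p m)
        = Poly_Mapping.single m (Poly_Mapping.lookup p m)"
      by (simp add: var_def mult_single)
  qed
  also have "\<dots> = pfilter (\<lambda>m. z \<in> Poly_Mapping.keys m) p"
  proof -
    have "pfilter (\<lambda>m. z \<in> Poly_Mapping.keys m) p =
       (\<Sum>m\<in>Poly_Mapping.keys (pfilter (\<lambda>m. z \<in> Poly_Mapping.keys m) p).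
          Poly_Mapping.single m (Poly_Mapping.lookup (pfilter (\<lambda>m. z \<in> Poly_Mapping.keys m) p) m))"
      by (rule sum_singles[symmetric])
    also have "\<dots> = (\<Sum>m\<in>K. Poly_Mapping.single m (Poly_Mapping.lookup p m))"
      by (intro sum.cong) (auto simp: keys_pfilter lookup_pfilter K_def)
    finally show ?thesis by simp
  qed
  finally have "p = restrict_vars (- {z}) p + var z * q"
    by (intro poly_mapping_eqI) (auto simp: restrict_vars_def lookup_add lookup_pfilter)
  moreover have "Poly_Mapping.lookup m z < n"
    if n: "\<forall>m\<in>Poly_Mapping.keys p. Poly_Mapping.lookup m z < Suc n" and m: "m \<in> Poly_Mapping.keys q" for m n
  proof -
    have "m \<in> (\<Union>k\<in>K. Poly_Mapping.keys (Poly_Mapping.single (k - Poly_Mapping.single z 1) (Poly_Mapping.lookup p k)))"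
      using m Poly_Mapping.keys_sum[of "\<lambda>k. Poly_Mapping.single (k - Poly_Mapping.single z 1) (Poly_Mapping.lookup p k)" K]
      unfolding q_def by blast
    then obtain k where k: "k \<in> K" "m = k - Poly_Mapping.single z 1" by (auto split: if_splits)
    then have "Poly_Mapping.lookup k z < Suc n" "Poly_Mapping.lookup k z > 0"
      using n by (auto simp: K_def in_keys_iff)
    then show ?thesis using k(2) by (simp add: lookup_minus)
  qed
  ultimately show ?thesis by blast
qed

text \<open>The joining edge connects the two roots and the first root survives, so induction
  hypotheses hold at both ends of the edge, in disjoint sets of variables.\<close>

inductive rooted_tree :: "nat set \<Rightarrow> nat set set \<Rightarrow> nat \<Rightarrow> bool" where
  single: "rooted_tree {v} {} v"
| join: "rooted_tree V1 E1 v \<Longrightarrow> rooted_tree V2 E2 w \<Longrightarrow> V1 \<inter> V2 = {} \<Longrightarrow>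
    rooted_tree (V1 \<union> V2) (insert {v, w} (E1 \<union> E2)) v"

lemma rooted_tree_props:
  assumes "rooted_tree V E v"
  shows "finite V" "v \<in> V" "e \<in> E \<Longrightarrow> e \<subseteq> V" "e \<in> E \<Longrightarrow> card e = 2"
proof -
  have "finite V \<and> v \<in> V \<and> (\<forall>e\<in>E. e \<subseteq> V \<and> card e = 2)"
    using assms
  proof induction
    case (join V1 E1 v V2 E2 w)
    then have "card {v, w} = 2" by (auto simp: card_insert_if)
    then show ?case using join by auto
  qed auto
  then show "finite V" "v \<in> V" "e \<in> E \<Longrightarrow> e \<subseteq> V" "e \<in> E \<Longrightarrow> card e = 2" by auto
qed

lemma ideal_span_subset_trans:
  assumes "x \<in> ideal.span A" "A \<subseteq> ideal.span B"
  shows "x \<in> ideal.span B"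
  using ideal.span_minimal[OF assms(2) ideal.subspace_span] assms(1) by (rule subsetD)

text \<open>Write p x_v = c f_vw + (element of \<open>L\<close>), where \<open>L\<close> omits the
  joining edge. Once c at x_v = 0 is known to multiply f_vw into \<open>L\<close> plus x_v times
  minors, correcting \<open>p\<close> by multiples of f_vw and minors gives an element multiplying
  x_v into \<open>L\<close>, to which the hypothesis for the first tree applies. The coordinates are
  arbitrary because the hypothesis for the second tree is used with them swapped.\<close>

lemma rooted_tree_colon_root:
  fixes p :: "(lss_var, 'a::field) mpoly"
  assumes "rooted_tree V E v" "coords xx yy" "p * var (xx v) \<in> ideal.span (edge_poly ` E)"
  shows "p \<in> ideal.span (edge_poly ` E \<union> minors (nbrs E v))"
  using assms
proof (induction arbitrary: xx yy p rule: rooted_tree.induct)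
  case (single v)
  then have "p = 0" using var_mult_cancel[of p "xx v"] by simp
  then show ?case by (simp add: ideal.span_zero)
next
  case (join V1 E1 v V2 E2 w)
  note co = join.prems(1)
  note co' = coords_swap[OF co]
  note nq = coords_neq[OF co]
  let ?F = "edge_poly :: nat set \<Rightarrow> (lss_var, 'a) mpoly"
  let ?E = "insert {v, w} (E1 \<union> E2)"
  define L where "L = ideal.span (?F ` E1 \<union> ?F ` E2)"
  define J where "J = ideal.span (?F ` ?E \<union> minors (nbrs ?E v))"
  define x where "x = (\<lambda>i. var (xx i) :: (lss_var, 'a) mpoly)"
  define y where "y = (\<lambda>i. var (yy i) :: (lss_var, 'a) mpoly)"
  note t1 = rooted_tree_props[OF join.hyps(1)] and t2 = rooted_tree_props[OF join.hyps(2)]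
  have v1: "v \<in> V1" "v \<notin> V2" and w2: "w \<in> V2" "w \<notin> V1" using t1(2) t2(2) join.hyps(3) by auto
  have fvw: "?F {v, w} = x v * x w + y v * y w"
    by (simp add: edge_poly_pair[OF co] x_def y_def)
  have nb: "nbrs E1 v \<subseteq> nbrs ?E v" "w \<in> nbrs ?E v" by (auto simp: nbrs_def)
  have nb1: "i \<in> V1" "i \<noteq> v" if "i \<in> nbrs E1 v" for i
    using that t1(3,4)[of "{v, i}"] by (auto simp: nbrs_def)
  have L1: "a \<in> ideal.span (?F ` E1) \<Longrightarrow> a \<in> L" and L2: "a \<in> ideal.span (?F ` E2) \<Longrightarrow> a \<in> L" for a
    unfolding L_def using ideal.span_mono[of "?F ` E1" "?F ` E1 \<union> ?F ` E2"]
      ideal.span_mono[of "?F ` E2" "?F ` E1 \<union> ?F ` E2"] by auto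
  have LJ: "L \<subseteq> J" unfolding L_def J_def by (rule ideal.span_mono) auto
  have MJ: "ideal.span (minors (nbrs ?E v)) \<subseteq> J" unfolding J_def by (rule ideal.span_mono) auto
  have fJ: "?F {v, w} \<in> J" unfolding J_def by (rule ideal.span_base) simp
  obtain c where c: "p * x v - c * ?F {v, w} \<in> L"
    using join.prems(2) unfolding L_def image_insert image_Un x_def
    by (auto simp: ideal.span_breakdown_eq)
  define r where "r = (restrict_vars (- {xx v}) :: (lss_var, 'a) mpoly \<Rightarrow> _)"
  have r: "r 0 = 0" "r (a + b) = r a + r b" "r (a * b) = r a * r b" "r (a - b) = r a - r b" for a b
    by (simp_all add: r_def restrict_vars_add restrict_vars_mult) (simp add: restrict_vars_def pfilter_diff)
  have rx: "r (x i) = (if i = v then 0 else x i)" and ry: "r (y i) = y i" for i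
    by (auto simp: r_def x_def y_def restrict_vars_var nq)
  obtain c' where c': "c = r c + x v * c'"
    using split_off_var[of c "xx v"] by (auto simp: r_def x_def)
  \<comment> \<open>Edges avoiding \<open>v\<close> are unaffected by x_v = 0, while an edge {v, i}
    turns into y_v y_i.\<close>
  define T where "T = ?F ` {e \<in> E1 \<union> E2. v \<notin> e}"
  have rF: "r (?F e) \<in> T \<union> (\<lambda>i. y v * y i) ` nbrs E1 v" if e: "e \<in> E1 \<union> E2" for e
  proof (cases "v \<in> e")
    case True
    then have "e \<in> E1" using e v1(2) t2(3) by auto
    then obtain i where i: "e = {v, i}" "i \<noteq> v"
      using True t1(4)[of e] by (auto simp: card_2_iff)
    then have "?F e = x v * x i + y v * y i" by (simp add: edge_poly_pair[OF co] x_def y_def)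
    then have "r (?F e) = y v * y i" by (simp add: r rx ry)
    then show ?thesis using \<open>e \<in> E1\<close> i(1) by (auto simp: nbrs_def)
  next
    case False
    have "card e = 2" using e t1(4) t2(4) by auto
    then obtain i j where "e = {i, j}" by (auto simp: card_2_iff)
    then have "?F e = x i * x j + y i * y j" "i \<noteq> v" "j \<noteq> v"
      using False by (auto simp: edge_poly_pair[OF co] x_def y_def)
    then have "r (?F e) = ?F e" by (simp add: r rx ry)
    then show ?thesis using e False by (auto simp: T_def)
  qed
  have "r (p * x v - c * ?F {v, w}) \<in> ideal.span (r ` (?F ` E1 \<union> ?F ` E2))"
    using c unfolding L_def by (rule ideal_span_hom) (simp_all add: r)
  then have "r (p * x v - c * ?F {v, w}) \<in> ideal.span (T \<union> (*) (y v) ` (y ` nbrs E1 v))"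
    using rF by (elim ideal_span_subset_trans) (force intro!: ideal.span_base simp: image_image)
  moreover have "r (p * x v - c * ?F {v, w}) = - (r c * (y v * y w))"
    by (simp add: r rx ry fvw)
  ultimately have "r c * (y v * y w) \<in> ideal.span (T \<union> (*) (y v) ` (y ` nbrs E1 v))"
    using ideal.span_neg by fastforce
  \<comment> \<open>The contribution of the edges at \<open>v\<close> is y_v times some
    \<open>s\<close>, and y_v does not occur in \<open>T\<close>, so the factor y_v can be
    cancelled.\<close>
  then obtain a b where ab: "r c * (y v * y w) = a + b" "a \<in> ideal.span T" "b \<in> ideal.span ((*) (y v) ` (y ` nbrs E1 v))"
    by (auto simp: ideal.span_Un)
  obtain s where s: "s \<in> ideal.span (y ` nbrs E1 v)" "b = y v * s"
    using ideal_span_scaled[OF ab(3)] by blast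
  have "(r c * y w - s) * y v = a" using ab(1) s(2) by (simp add: algebra_simps)
  then have "(r c * y w - s) * var (yy v) \<in> ideal.span T" using ab(2) by (simp add: y_def)
  moreover have "T \<subseteq> polys (- {yy v})"
  proof -
    have "?F e \<in> polys (- {yy v})" if "e \<in> E1 \<union> E2" "v \<notin> e" for e
    proof -
      have "?F e \<in> polys (vertex_vars e)" using that t1(4) t2(4) by (intro edge_poly_polys) auto
      moreover have "vertex_vars e \<subseteq> - {yy v}" using coords_vertex_vars(2)[OF co] that(2) by auto
      ultimately show ?thesis using polys_mono by blast
    qed
    then show ?thesis by (auto simp: T_def)
  qed
  ultimately have "r c * y w - s \<in> ideal.span T"
    using ideal_span_colon_var[of T "- {yy v}" "yy v"] by blast
  have F12: "?F ` E1 \<subseteq> polys (vertex_vars V1)" "?F ` E2 \<subseteq> polys (vertex_vars V2)"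
    by (rule image_subsetI, rule edge_poly_polys, erule t1(3) t2(3), erule t1(4) t2(4))+
  \<comment> \<open>All of \<open>B1\<close> lives in the variables of the first tree, whereas y_w
    and the edges of the second tree do not involve them.\<close>
  define B1 where "B1 = ?F ` {e \<in> E1. v \<notin> e} \<union> y ` nbrs E1 v"
  have "r c * y w \<in> ideal.span (B1 \<union> ?F ` E2)"
  proof -
    have "T \<subseteq> B1 \<union> ?F ` E2" "y ` nbrs E1 v \<subseteq> B1 \<union> ?F ` E2" by (auto simp: T_def B1_def)
    then have "r c * y w - s \<in> ideal.span (B1 \<union> ?F ` E2)" "s \<in> ideal.span (B1 \<union> ?F ` E2)"
      using \<open>r c * y w - s \<in> ideal.span T\<close> s(1) ideal.span_mono by blast+
    from ideal.span_add[OF this] show ?thesis by simp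
  qed
  moreover have "B1 \<subseteq> polys (vertex_vars V1)"
    using t1(3,4) nb1(1) coords_vertex_vars(2)[OF co]
    by (auto simp: B1_def y_def intro!: edge_poly_polys var_in_polys)
  moreover have disj: "vertex_vars V2 \<subseteq> - vertex_vars V1" "vertex_vars V1 \<subseteq> - vertex_vars V2"
    using join.hyps(3) by (auto simp: vertex_vars_def)
  moreover have "?F ` E2 \<subseteq> polys (- vertex_vars V1)" "?F ` E1 \<subseteq> polys (- vertex_vars V2)"
    using F12 polys_mono[OF disj(1)] polys_mono[OF disj(2)] by blast+
  moreover have "y w \<in> polys (- vertex_vars V1)"
    using w2 coords_vertex_vars(2)[OF co] by (auto simp: y_def intro!: var_in_polys)
  ultimately have rc: "r c \<in> ideal.span (B1 \<union> {q. q * y w \<in> ideal.span (?F ` E2)})"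
    by (intro colon_disjoint)
  \<comment> \<open>This set is an ideal, so membership of \<open>r c\<close> need only be checked
    on generators of the ideal containing it.\<close>
  define W where "W = {z. \<exists>a\<in>L. \<exists>j\<in>ideal.span (minors (nbrs ?E v)). z * ?F {v, w} = a + x v * j}"
  have "ideal.subspace W"
  proof (rule ideal.subspaceI)
    show "0 \<in> W" unfolding W_def L_def using ideal.span_zero by force
    show "z + z' \<in> W" if "z \<in> W" "z' \<in> W" for z z'
    proof -
      from that obtain a j a' j' where "a \<in> L" "j \<in> ideal.span (minors (nbrs ?E v))" "z * ?F {v, w} = a + x v * j"
        "a' \<in> L" "j' \<in> ideal.span (minors (nbrs ?E v))" "z' * ?F {v, w} = a' + x v * j'"
        unfolding W_def by blast
      then have "(z + z') * ?F {v, w} = (a + a') + x v * (j + j')" "a + a' \<in> L"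
          "j + j' \<in> ideal.span (minors (nbrs ?E v))"
        by (auto simp: L_def distrib_left distrib_right intro: ideal.span_add)
      then show ?thesis unfolding W_def by blast
    qed
    show "d * z \<in> W" if "z \<in> W" for d z
    proof -
      from that obtain a j where "a \<in> L" "j \<in> ideal.span (minors (nbrs ?E v))" "z * ?F {v, w} = a + x v * j"
        unfolding W_def by blast
      then have "(d * z) * ?F {v, w} = d * a + x v * (d * j)" "d * a \<in> L"
          "d * j \<in> ideal.span (minors (nbrs ?E v))"
        by (auto simp: L_def distrib_left mult.assoc mult.left_commute intro: ideal.span_scale)
      then show ?thesis unfolding W_def by blast
    qed
  qed
  moreover have "B1 \<union> {q. q * y w \<in> ideal.span (?F ` E2)} \<subseteq> W"
  proof -
    have WL: "z \<in> W" if "z * ?F {v, w} \<in> L" for z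
      using that ideal.span_zero unfolding W_def by force
    have "?F e \<in> W" if "e \<in> E1 \<union> E2" for e
    proof (rule WL)
      have "?F e \<in> L" using that unfolding L_def by (intro ideal.span_base) auto
      then show "?F e * ?F {v, w} \<in> L" unfolding L_def by (rule ideal_span_mult_right)
    qed
    moreover have "y i \<in> W" if i: "i \<in> nbrs E1 v" for i
    proof -
      \<comment> \<open>Here the minors pairing an old neighbour \<open>i\<close> of
        \<open>v\<close> with the new neighbour \<open>w\<close> arise.\<close>
      have "y i * ?F {v, w} = y w * ?F {v, i} + x v * (x w * y i - x i * y w)"
        unfolding fvw by (simp add: edge_poly_pair[OF co] x_def y_def algebra_simps)
      moreover have "y w * ?F {v, i} \<in> L"
        using i unfolding L_def by (intro ideal.span_scale ideal.span_base) (auto simp: nbrs_def)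
      moreover have "x w * y i - x i * y w \<in> ideal.span (minors (nbrs ?E v))"
        unfolding x_def y_def using nb i by (intro ideal.span_base minor_coords[OF co]) auto
      ultimately show ?thesis unfolding W_def by blast
    qed
    moreover have "q \<in> W" if q: "q * y w \<in> ideal.span (?F ` E2)" for q
    proof -
      \<comment> \<open>The induction hypothesis at \<open>w\<close> with the coordinates exchanged;
        a minor at \<open>w\<close> multiplies both x_w and y_w, hence f_vw, into the ideal of the
        second tree.\<close>
      have "q \<in> ideal.span (?F ` E2 \<union> minors (nbrs E2 w))"
        using join.IH(2)[OF co'] q by (simp add: y_def)
      moreover have "?F ` E2 \<union> minors (nbrs E2 w) \<subseteq> W"
      proof -
        have "z \<in> W" if z: "z \<in> minors (nbrs E2 w)" for z
        proof (rule WL)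
          have "z * ?F {v, w} = x v * (z * x w) + y v * (z * y w)"
            unfolding fvw by (simp add: algebra_simps)
          moreover have "z * x w \<in> L" "z * y w \<in> L"
            using minor_mult_edge_ideal[OF co z] minor_mult_edge_ideal[OF co' z] L2 by (auto simp: x_def y_def)
          ultimately show "z * ?F {v, w} \<in> L"
            unfolding L_def by (auto intro!: ideal.span_add[OF ideal.span_scale ideal.span_scale])
        qed
        then show ?thesis using \<open>\<And>e. e \<in> E1 \<union> E2 \<Longrightarrow> ?F e \<in> W\<close> by auto
      qed
      ultimately show ?thesis
        using ideal.span_minimal[OF _ \<open>ideal.subspace W\<close>] by blast
    qed
    ultimately show ?thesis by (auto simp: B1_def)
  qed
  ultimately have "r c \<in> W" using rc ideal.span_minimal by blast
  then obtain a j where aj: "a \<in> L" "j \<in> ideal.span (minors (nbrs ?E v))" "r c * ?F {v, w} = a + x v * j"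
    by (auto simp: W_def)
  \<comment> \<open>Substituting c = \<open>r c\<close> + x_v c' makes every correction a multiple
    of x_v. The ideal \<open>L\<close> on the right splits into the two trees, so
    \<open>colon_disjoint\<close> reduces the rest to the colon ideal of the first one.\<close>
  have "(p - j - c' * ?F {v, w}) * x v = (p * x v - c * ?F {v, w}) + a"
  proof -
    have "c * ?F {v, w} = a + x v * j + x v * c' * ?F {v, w}"
      by (subst c') (simp only: distrib_right aj(3))
    then show ?thesis by (simp add: algebra_simps)
  qed
  also have "\<dots> \<in> L" using c aj(1) unfolding L_def by (rule ideal.span_add)
  finally have "(p - j - c' * ?F {v, w}) * x v \<in> ideal.span (?F ` E2 \<union> ?F ` E1)"
    by (simp add: L_def Un_commute)
  then have "p - j - c' * ?F {v, w} \<in> ideal.span (?F ` E2 \<union> {q. q * x v \<in> ideal.span (?F ` E1)})"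
  proof (rule colon_disjoint[rotated 3])
    show "?F ` E2 \<subseteq> polys (vertex_vars V2)" by fact
    show "?F ` E1 \<subseteq> polys (- vertex_vars V2)" by fact
    show "x v \<in> polys (- vertex_vars V2)"
      using v1 coords_vertex_vars(1)[OF co] by (auto simp: x_def intro!: var_in_polys)
  qed
  then have "p - j - c' * ?F {v, w} \<in> J"
  proof (rule subsetD[OF ideal.span_minimal, rotated -1])
    show "?F ` E2 \<union> {q. q * x v \<in> ideal.span (?F ` E1)} \<subseteq> J"
    proof -
      have "q \<in> J" if "q * x v \<in> ideal.span (?F ` E1)" for q
      proof -
        have "q \<in> ideal.span (?F ` E1 \<union> minors (nbrs E1 v))"
          using join.IH(1)[OF co] that by (simp add: x_def)
        also have "\<dots> \<subseteq> J"
          unfolding J_def using nb by (intro ideal.span_mono) (auto simp: minors_def)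
        finally show ?thesis .
      qed
      then show ?thesis unfolding J_def by (auto intro: ideal.span_base)
    qed
  qed (simp add: J_def)
  moreover have "j \<in> J" "c' * ?F {v, w} \<in> J"
    using aj(2) MJ fJ by (auto simp: J_def intro: ideal.span_scale)
  ultimately have "(p - j - c' * ?F {v, w}) + j + c' * ?F {v, w} \<in> J"
    unfolding J_def by (intro ideal.span_add)
  then show ?case by (simp add: J_def)
qed

text \<open>Both x_u and y_u are new, so they cancel modulo the edge ideal. At x_u = 0 the relation
  becomes one for y_w alone, which places that part of \<open>p\<close> in the root colon ideal;
  subtracting it and cancelling x_u lowers the degree in x_u.\<close>

lemma rooted_tree_colon_leaf:
  fixes p :: "(lss_var, 'a::field) mpoly"
  assumes T: "rooted_tree V E w" and u: "u \<notin> V"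
    and p: "p * edge_poly {w, u} \<in> ideal.span (edge_poly ` E)"
  shows "p \<in> ideal.span (edge_poly ` E \<union> minors (nbrs E w))"
proof -
  let ?F = "edge_poly :: nat set \<Rightarrow> (lss_var, 'a) mpoly"
  let ?L = "ideal.span (?F ` E)"
  let ?J = "ideal.span (?F ` E \<union> minors (nbrs E w))"
  note t = rooted_tree_props[OF T]
  have XY: "coords X Y" "coords Y X" by (simp_all add: coords_def)
  have fwu: "?F {w, u} = var (X w) * var (X u) + var (Y w) * var (Y u)"
    by (rule edge_poly_pair[OF XY(1)])
  have FV: "?F ` E \<subseteq> polys (vertex_vars V)" using t(3,4) by (auto intro!: edge_poly_polys)
  have uV: "X u \<notin> vertex_vars V" "Y u \<notin> vertex_vars V" "w \<noteq> u" using u t(2) by (auto simp: vertex_vars_def)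
  have JL: "q * ?F {w, u} \<in> ?L" if "q \<in> ?J" for q
    using that
  proof (induction rule: ideal.span_induct_alt)
    case base
    then show ?case by (simp add: ideal.span_zero)
  next
    case (step c z q)
    have "z * ?F {w, u} \<in> ?L"
      using step(1)
    proof
      assume "z \<in> ?F ` E"
      then show ?thesis by (intro ideal_span_mult_right ideal.span_base)
    next
      assume z: "z \<in> minors (nbrs E w)"
      have "z * ?F {w, u} = var (X u) * (z * var (X w)) + var (Y u) * (z * var (Y w))"
        unfolding fwu by (simp add: algebra_simps)
      also have "\<dots> \<in> ?L"
        by (intro ideal.span_add ideal.span_scale minor_mult_edge_ideal[OF XY(1) z] minor_mult_edge_ideal[OF XY(2) z])
      finally show ?thesis .
    qed
    then have "c * (z * ?F {w, u}) + q * ?F {w, u} \<in> ?L" using step(2) by (rule ideal.span_add[OF ideal.span_scale])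
    then show ?case by (simp add: distrib_right mult.assoc)
  qed
  have "q \<in> ?J" if "\<forall>m\<in>Poly_Mapping.keys q. Poly_Mapping.lookup m (X u) < n" "q * ?F {w, u} \<in> ?L" for n q
    using that
  proof (induction n arbitrary: q)
    case 0
    then have "q = 0" by (auto intro!: poly_mapping_eqI simp: in_keys_iff)
    then show ?case by (simp add: ideal.span_zero)
  next
    case (Suc n)
    define r where "r = (restrict_vars (- {X u}) :: (lss_var, 'a) mpoly \<Rightarrow> _)"
    have r: "r 0 = 0" "r (a + b) = r a + r b" "r (a * b) = r a * r b" for a b
      by (simp_all add: r_def restrict_vars_add restrict_vars_mult)
    obtain q1 where q1: "q = r q + var (X u) * q1" "\<forall>m\<in>Poly_Mapping.keys q1. Poly_Mapping.lookup m (X u) < n"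
      using split_off_var[of q "X u"] Suc.prems(1) by (auto simp: r_def)
    have rF: "r ` ?F ` E = ?F ` E"
    proof -
      have "r f = f" if "f \<in> ?F ` E" for f
        unfolding r_def using that FV uV(1) polys_mono[of "vertex_vars V" "- {X u}"] by (intro restrict_vars_id) auto
      then show ?thesis by force
    qed
    have "r (q * ?F {w, u}) \<in> ?L"
      using ideal_span_hom[OF Suc.prems(2), of r] r by (simp add: rF)
    moreover have "r (q * ?F {w, u}) = (r q * var (Y w)) * var (Y u)"
    proof -
      have "r (var (X u)) = 0" "r (var (Y w)) = var (Y w)" "r (var (Y u)) = var (Y u)"
        by (simp_all add: r_def restrict_vars_var)
      then show ?thesis by (simp add: fwu r mult.assoc)
    qed
    ultimately have "r q * var (Y w) \<in> ?L"
      using ideal_span_colon_var[OF FV uV(2)] by simp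
    then have rq: "r q \<in> ?J" by (rule rooted_tree_colon_root[OF T XY(2)])
    have "(q1 * ?F {w, u}) * var (X u) = q * ?F {w, u} - r q * ?F {w, u}"
      by (subst q1(1)) (simp add: algebra_simps)
    also have "\<dots> \<in> ?L" using Suc.prems(2) JL[OF rq] by (rule ideal.span_diff)
    finally have "q1 * ?F {w, u} \<in> ?L" by (rule ideal_span_colon_var[OF FV uV(1)])
    then have "q1 \<in> ?J" using Suc.IH q1(2) by blast
    then have "r q + var (X u) * q1 \<in> ?J" using rq by (intro ideal.span_add ideal.span_scale)
    then show ?case using q1(1) by simp
  qed
  moreover have "\<exists>n. \<forall>m\<in>Poly_Mapping.keys p. Poly_Mapping.lookup m (X u) < n"
    using finite_nat_set_iff_bounded[of "(\<lambda>m. Poly_Mapping.lookup m (X u)) ` Poly_Mapping.keys p"] by auto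
  ultimately show ?thesis using p by blast
qed

section \<open>Growing a tree by leaves\<close>

text \<open>A second description of trees: generators of the syzygies are counted one edge at a
  time, whereas \<open>rooted_tree\<close> splits a tree at an edge of its root.\<close>

inductive leaf_tree :: "nat set \<Rightarrow> nat set set \<Rightarrow> bool" where
  single: "leaf_tree {v} {}"
| leaf: "leaf_tree V E \<Longrightarrow> w \<in> V \<Longrightarrow> u \<notin> V \<Longrightarrow> leaf_tree (insert u V) (insert {w, u} E)"

text \<open>The new leaf is absorbed by whichever of the two joined trees contains
  \<open>w\<close>.\<close>

lemma rooted_tree_leaf:
  assumes "rooted_tree V E v" "w \<in> V" "u \<notin> V"
  shows "rooted_tree (insert u V) (insert {w, u} E) v"
  using assms
proof induction
  case (single v)
  then show ?case
    using rooted_tree.join[OF rooted_tree.single[of v] rooted_tree.single[of u]] by (auto simp: insert_commute)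
next
  case (join V1 E1 v V2 E2 x)
  show ?case
  proof (cases "w \<in> V1")
    case True
    then have "rooted_tree (insert u V1) (insert {w, u} E1) v" using join by auto
    from rooted_tree.join[OF this join.hyps(2)] show ?thesis
      using join.hyps(3) join.prems by (simp add: insert_commute)
  next
    case False
    then have "rooted_tree (insert u V2) (insert {w, u} E2) x" using join by auto
    from rooted_tree.join[OF join.hyps(1) this] show ?thesis
      using join.hyps(3) join.prems by (simp add: insert_commute)
  qed
qed

text \<open>A free choice of root is needed since the next leaf may be attached at any vertex. If
  the new leaf is itself the root, it is joined as a one-point tree to the old tree rooted at
  \<open>w\<close>.\<close>

lemma leaf_tree_rooted_tree:
  assumes "leaf_tree V E" "v \<in> V"
  shows "rooted_tree V E v"
  using assms
proof (induction arbitrary: v)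
  case (single v)
  then show ?case by (auto intro: rooted_tree.single)
next
  case (leaf V E w u)
  show ?case
  proof (cases "v = u")
    case True
    then show ?thesis
      using rooted_tree.join[OF rooted_tree.single[of u] leaf.IH[OF leaf.hyps(2)]] leaf.hyps(3)
      by (simp add: insert_commute)
  next
    case False
    then show ?thesis using leaf by (intro rooted_tree_leaf) auto
  qed
qed

lemma leaf_tree_props:
  assumes "leaf_tree V E"
  shows "finite V" "finite E" "card V = Suc (card E)" "e \<in> E \<Longrightarrow> e \<subseteq> V"  "e \<in> E \<Longrightarrow> card e = 2"
proof -
  have "finite V \<and> finite E \<and> card V = Suc (card E) \<and> (\<forall>e\<in>E. e \<subseteq> V \<and> card e = 2)"
    using assms
  proof induction
    case (leaf V E w u)
    then have "{w, u} \<notin> E" "card {w, u} = 2" by (auto simp: card_insert_if)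
    then show ?case using leaf by (auto simp: card_insert_if)
  qed auto
  then show "finite V" "finite E" "card V = Suc (card E)" "e \<in> E \<Longrightarrow> e \<subseteq> V" "e \<in> E \<Longrightarrow> card e = 2"
    by auto
qed

text \<open>Simple paths are what turns an additional edge between \<open>a\<close> and
  \<open>b\<close> into a cycle.\<close>

lemma leaf_tree_path:
  assumes "leaf_tree V E" "a \<in> V" "b \<in> V"
  shows "\<exists>p. p \<noteq> [] \<and> hd p = a \<and> last p = b \<and> distinct p \<and> set p \<subseteq> V \<and> successively (\<lambda>x y. {x, y} \<in> E) p"
  using assms
proof (induction arbitrary: a b)
  case (single v)
  then show ?case by (intro exI[of _ "[v]"]) auto
next
  case (leaf V E w u)
  have mono: "successively (\<lambda>x y. {x, y} \<in> insert {w, u} E) p" if "successively (\<lambda>x y. {x, y} \<in> E) p" for p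
    using that by (rule successively_mono) auto
  consider "a = u" "b = u" | "a = u" "b \<in> V" | "a \<in> V" "b = u" | "a \<in> V" "b \<in> V"
    using leaf.prems by auto
  then show ?case
  proof cases
    case 1
    then show ?thesis by (intro exI[of _ "[u]"]) auto
  next
    case 2
    obtain p where p: "p \<noteq> []" "hd p = w" "last p = b" "distinct p" "set p \<subseteq> V" "successively (\<lambda>x y. {x, y} \<in> E) p"
      using leaf.IH[OF leaf.hyps(2) 2(2)] by blast
    then show ?thesis
      using 2 leaf.hyps(3) mono[OF p(6)]
      by (intro exI[of _ "u # p"]) (auto simp: successively_Cons insert_commute)
  next
    case 3
    obtain p where p: "p \<noteq> []" "hd p = a" "last p = w" "distinct p" "set p \<subseteq> V" "successively (\<lambda>x y. {x, y} \<in> E) p"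
      using leaf.IH[OF 3(1) leaf.hyps(2)] by blast
    then show ?thesis
      using 3 leaf.hyps(3) mono[OF p(6)]
      by (intro exI[of _ "p @ [u]"]) (auto simp: successively_append_iff)
  next
    case 4
    obtain p where p: "p \<noteq> []" "hd p = a" "last p = b" "distinct p" "set p \<subseteq> V" "successively (\<lambda>x y. {x, y} \<in> E) p"
      using leaf.IH[OF 4] by blast
    then show ?thesis using mono[OF p(6)] by blast
  qed
qed

lemma is_tree_leaf_tree:
  assumes "is_tree V E"
  shows "leaf_tree V E"
proof -
  have V: "finite V" "V \<noteq> {}" and E: "\<And>e. e \<in> E \<Longrightarrow> e \<subseteq> V \<and> card e = 2"
    and con: "\<And>u v. u \<in> V \<Longrightarrow> v \<in> V \<Longrightarrow> (u, v) \<in> {(a, b). {a, b} \<in> E}\<^sup>*"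
    and acyc: "\<And>c. \<not> graph_cycle E c"
    using assms by (auto simp: is_tree_def simple_graph_def connected_graph_def)
  define P where "P = (\<lambda>V'. V' \<subseteq> V \<and> (\<exists>E'\<subseteq>E. leaf_tree V' E'))"
  obtain v where "v \<in> V" using V(2) by blast
  then have "P {v}" by (auto simp: P_def intro: leaf_tree.single)
  moreover have "\<forall>V'. P V' \<longrightarrow> card V' \<le> card V" using V(1) by (auto simp: P_def intro: card_mono)
  ultimately obtain V' where V': "P V'" "\<And>W. P W \<Longrightarrow> card W \<le> card V'"
    using ex_has_greatest_nat[of P "{v}" card "Suc (card V)"] by (auto simp: less_Suc_eq_le)
  then obtain E' where E': "V' \<subseteq> V" "E' \<subseteq> E" "leaf_tree V' E'" by (auto simp: P_def)
  obtain r where r: "r \<in> V'" using leaf_tree_props(3)[OF E'(3)] by fastforce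
  have "V' = V"
  proof (rule ccontr)
    assume "V' \<noteq> V"
    then obtain x where x: "x \<in> V" "x \<notin> V'" using E'(1) by blast
    have "(r, x) \<in> {(a, b). {a, b} \<in> E}\<^sup>*" using con r x(1) E'(1) by blast
    \<comment> \<open>A walk from inside \<open>V'\<close> to a vertex outside must cross its
      boundary.\<close>
    then have "x \<notin> V' \<longrightarrow> (\<exists>a b. {a, b} \<in> E \<and> a \<in> V' \<and> b \<notin> V')"
      by (induction rule: rtrancl_induct) (use r in auto)
    then obtain a b where ab: "{a, b} \<in> E" "a \<in> V'" "b \<notin> V'" using x(2) by blast
    have "P (insert b V')"
      unfolding P_def
    proof (intro conjI exI[of _ "insert {a, b} E'"])
      show "leaf_tree (insert b V') (insert {a, b} E')" by (rule leaf_tree.leaf[OF E'(3) ab(2,3)])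
    qed (use E'(1,2) E[OF ab(1)] ab(1) in auto)
    then have "card (insert b V') \<le> card V'" by (rule V'(2))
    then show False using ab(3) leaf_tree_props(1)[OF E'(3)] by simp
  qed
  moreover have "E' = E"
  proof (rule ccontr)
    assume "E' \<noteq> E"
    then obtain e where e: "e \<in> E" "e \<notin> E'" using E'(2) by blast
    then obtain a b where ab: "e = {a, b}" "a \<noteq> b" using E[OF e(1)] by (auto simp: card_2_iff)
    then have "a \<in> V'" "b \<in> V'" using E[OF e(1)] \<open>V' = V\<close> by auto
    then obtain p where p: "p \<noteq> []" "hd p = a" "last p = b" "distinct p" "successively (\<lambda>x y. {x, y} \<in> E') p"
      using leaf_tree_path[OF E'(3)] by blast
    have hl: "p ! 0 = a" "p ! (length p - 1) = b"
      using p by (simp_all add: hd_conv_nth last_conv_nth)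
    have edge: "{p ! i, p ! Suc i} \<in> E'" if "Suc i < length p" for i
      using p(5) that by (simp add: successively_conv_nth)
    have "length p \<noteq> 0" "length p \<noteq> 1" using p(1) hl ab(2) by auto
    moreover have "length p \<noteq> 2" using edge[of 0] hl e(2) ab(1) by (auto simp: numeral_2_eq_2)
    ultimately have "3 \<le> length p" by linarith
    moreover have "{p ! i, p ! (Suc i mod length p)} \<in> E" if i: "i < length p" for i
    proof (cases "Suc i < length p")
      case True
      then show ?thesis using edge[OF True] E'(2) by auto
    next
      case False
      then have "Suc i = length p" using i by simp
      then show ?thesis using hl e(1) ab(1) by (metis diff_Suc_1 insert_commute mod_self)
    qed
    ultimately have "graph_cycle E p" using p(4) by (simp add: graph_cycle_def)
    then show False using acyc by blast
  qed
  ultimately show ?thesis using E'(3) by simp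
qed

section \<open>The syzygies of the edge polynomials of a tree\<close>

lemma card_nbrs:
  assumes "\<And>e. e \<in> E \<Longrightarrow> card e = 2"
  shows "card (nbrs E v) = vertex_degree E v"
proof -
  have "bij_betw (\<lambda>w. {v, w}) (nbrs E v) {e \<in> E. v \<in> e}"
    unfolding bij_betw_def
  proof
    show "inj_on (\<lambda>w. {v, w}) (nbrs E v)" by (auto simp: inj_on_def doubleton_eq_iff)
    show "(\<lambda>w. {v, w}) ` nbrs E v = {e \<in> E. v \<in> e}"
    proof
      show "{e \<in> E. v \<in> e} \<subseteq> (\<lambda>w. {v, w}) ` nbrs E v"
      proof
        fix e assume e: "e \<in> {e \<in> E. v \<in> e}"
        then obtain w where "e = {v, w}" using assms[of e] by (auto simp: card_2_iff)
        then show "e \<in> (\<lambda>w. {v, w}) ` nbrs E v" using e by (auto simp: nbrs_def)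
      qed
    qed (auto simp: nbrs_def)
  qed
  then show ?thesis by (simp add: vertex_degree_def bij_betw_same_card)
qed

section \<open>Linear independence of the quadrics generating the colon ideal\<close>

lemma var_mult_var: "var a * var b = (Poly_Mapping.single (Poly_Mapping.single a 1 + Poly_Mapping.single b 1) 1 :: ('v, 'a::comm_ring_1) mpoly)"
  by (simp add: var_def mult_single)

lemma single_add_single_eq_iff:
  "Poly_Mapping.single a (1::nat) + Poly_Mapping.single b 1 = Poly_Mapping.single c 1 + Poly_Mapping.single d 1
    \<longleftrightarrow> a = c \<and> b = d \<or> a = d \<and> b = c"
proof
  assume eq: "Poly_Mapping.single a (1::nat) + Poly_Mapping.single b 1 = Poly_Mapping.single c 1 + Poly_Mapping.single d 1"
  have inj: "x = y" if "Poly_Mapping.single x (1::nat) = Poly_Mapping.single y 1" for x y :: 'a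
    using arg_cong[OF that, of Poly_Mapping.keys] by simp
  have "a \<in> Poly_Mapping.keys (Poly_Mapping.single c (1::nat) + Poly_Mapping.single d 1)"
    unfolding eq[symmetric] keys_plus_nat by simp
  then consider "a = c" | "a = d" by (auto simp: keys_plus_nat)
  then show "a = c \<and> b = d \<or> a = d \<and> b = c"
  proof cases
    case 1
    then show ?thesis using eq inj[of b d] by simp
  next
    case 2
    then have "Poly_Mapping.single a (1::nat) + Poly_Mapping.single b 1 = Poly_Mapping.single a 1 + Poly_Mapping.single c 1"
      using eq by (simp only: add.commute)
    then show ?thesis using 2 inj[of b c] by simp
  qed
qed (auto simp: add.commute)

text \<open>The monomial \<open>\<mu> j\<close> occurs in \<open>g j\<close> only, with coefficient
  1, so reading off these coefficients recovers the scalars of any linear combination.\<close>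

lemma independent_by_monomials:
  fixes g :: "'i \<Rightarrow> ('v, 'a::field) mpoly"
  assumes K: "finite K" and g: "\<And>i j. i \<in> K \<Longrightarrow> j \<in> K \<Longrightarrow> Poly_Mapping.lookup (g i) (\<mu> j) = (if i = j then 1 else 0)"
  shows "inj_on g K" "pvec.independent (g ` K)"
proof -
  show inj: "inj_on g K"
  proof (rule inj_onI)
    fix i j assume "i \<in> K" "j \<in> K" "g i = g j"
    then show "i = j" using g[of i j] g[of j j] by (auto split: if_splits)
  qed
  show "pvec.independent (g ` K)"
  proof (rule pvec.independent_if_scalars_zero)
    fix f x assume f: "(\<Sum>x\<in>g ` K. const (f x) * x) = 0" "x \<in> g ` K"
    then obtain j where j: "j \<in> K" "x = g j" by blast
    have "0 = Poly_Mapping.lookup (\<Sum>i\<in>K. const (f (g i)) * g i) (\<mu> j)"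
      using f(1) by (simp add: sum.reindex[OF inj])
    also have "\<dots> = (\<Sum>i\<in>K. if i = j then f (g i) else 0)"
      unfolding lookup_sum lookup_const_mult using g j(1) by (intro sum.cong) auto
    also have "\<dots> = f x" using K j by simp
    finally show "f x = 0" by simp
  qed (use K in simp)
qed

text \<open>Requiring i < j keeps one of two opposite minors and drops the zero ones, which is what
  makes the set independent.\<close>

definition colon_gens :: "nat set set \<Rightarrow> nat set \<Rightarrow> (lss_var, 'a::field) mpoly set" where
  "colon_gens E N = edge_poly ` E \<union> {minor i j |i j. i \<in> N \<and> j \<in> N \<and> i < j}"

lemma colon_gens_basis:
  assumes E: "finite E" "\<And>e. e \<in> E \<Longrightarrow> card e = 2" and N: "finite N"
  shows "finite (colon_gens E N :: (lss_var, 'a::field) mpoly set)"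
    and "card (colon_gens E N :: (lss_var, 'a) mpoly set) = card E + (card N choose 2)"
    and "pvec.independent (colon_gens E N :: (lss_var, 'a) mpoly set)"
proof -
  define Q where "Q = {(i, j). i \<in> N \<and> j \<in> N \<and> i < j}"
  define g :: "nat set + nat \<times> nat \<Rightarrow> (lss_var, 'a) mpoly"
    where "g = case_sum edge_poly (\<lambda>(i, j). minor i j)"
  \<comment> \<open>The distinguishing monomials: x_i x_j for an edge, and x_i y_j with i < j for a
    minor, whose other monomial x_j y_i has its indices in the wrong order.\<close>
  define \<mu> where "\<mu> = case_sum (\<lambda>e. Poly_Mapping.single (X (Min e)) (1::nat) + Poly_Mapping.single (X (Max e)) 1)
    (\<lambda>(i, j). Poly_Mapping.single (X i) 1 + Poly_Mapping.single (Y j) 1)"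
  have Qsub: "Q \<subseteq> N \<times> N" by (auto simp: Q_def)
  then have finQ: "finite Q" using N finite_subset by blast
  have cardQ: "card Q = card N choose 2"
  proof -
    have "bij_betw (\<lambda>(i, j). {i, j}) Q {e. e \<subseteq> N \<and> card e = 2}"
      unfolding bij_betw_def
    proof
      show "inj_on (\<lambda>(i, j). {i, j}) Q" by (auto simp: inj_on_def Q_def doubleton_eq_iff)
      show "(\<lambda>(i, j). {i, j}) ` Q = {e. e \<subseteq> N \<and> card e = 2}"
      proof
        show "{e. e \<subseteq> N \<and> card e = 2} \<subseteq> (\<lambda>(i, j). {i, j}) ` Q"
        proof
          fix e assume "e \<in> {e. e \<subseteq> N \<and> card e = 2}"
          then obtain i j where "e = {i, j}" "i \<in> N" "j \<in> N" "i \<noteq> j" by (auto simp: card_2_iff)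
          then have "e = {min i j, max i j}" "(min i j, max i j) \<in> Q"
            by (auto simp: Q_def min_def max_def)
          then show "e \<in> (\<lambda>(i, j). {i, j}) ` Q" by (metis (no_types, lifting) case_prod_conv image_eqI)
        qed
      qed (auto simp: Q_def card_insert_if)
    qed
    then show ?thesis using n_subsets[OF N, of 2] by (simp add: bij_betw_same_card)
  qed
  have img: "g ` (E <+> Q) = colon_gens E N"
  proof -
    have "(\<lambda>q. g (Inr q)) ` Q = {minor i j |i j. i \<in> N \<and> j \<in> N \<and> i < j}"
      by (force simp: Q_def g_def image_iff)
    moreover have "(\<lambda>e. g (Inl e)) ` E = edge_poly ` E" by (simp add: g_def)
    ultimately show ?thesis unfolding Plus_def image_Un image_image by (simp only: colon_gens_def)
  qed
  have look: "Poly_Mapping.lookup (g k) (\<mu> l) = (if k = l then 1 else 0)" if "k \<in> E <+> Q" "l \<in> E <+> Q" for k l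
  proof -
    have lk: "Poly_Mapping.lookup (var a * var b) (Poly_Mapping.single c 1 + Poly_Mapping.single d 1)
        = (if a = c \<and> b = d \<or> a = d \<and> b = c then 1 else (0::'a))" for a b c d :: lss_var
      unfolding var_mult_var lookup_single single_add_single_eq_iff when_def by simp
    note lk = lk[unfolded One_nat_def]
    have ex: "\<exists>i j. e = {i, j} \<and> i < j" if "e \<in> E" for e
    proof -
      from E(2)[OF that] obtain i j where "e = {i, j}" "i \<noteq> j" by (auto simp: card_2_iff)
      then show ?thesis by (metis insert_commute linorder_neqE_nat)
    qed
    have mm: "Min {i, j} = i" "Max {i, j} = j" if "i < j" for i j :: nat using that by auto
    show ?thesis
    proof (cases k; cases l)
      fix e e' assume kl: "k = Inl e" "l = Inl e'"
      then have "e \<in> E" "e' \<in> E" using that by auto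
      then obtain i j i' j' where ij: "e = {i, j}" "i < j" "e' = {i', j'}" "i' < j'" using ex by metis
      then show ?thesis
        unfolding kl g_def \<mu>_def ij(1,3)
        by (auto simp: edge_poly_def lookup_add lk mm doubleton_eq_iff)
    next
      fix e q assume kl: "k = Inl e" "l = Inr q"
      then show ?thesis
        unfolding g_def \<mu>_def by (auto simp: edge_poly_def lookup_add lk split: prod.splits)
    next
      fix e q assume kl: "k = Inr q" "l = Inl e"
      then show ?thesis
        unfolding g_def \<mu>_def by (auto simp: minor_def lookup_minus lk split: prod.splits)
    next
      fix q q' assume kl: "k = Inr q" "l = Inr q'"
      then have "q \<in> Q" "q' \<in> Q" using that by auto
      then obtain i j i' j' where ij: "q = (i, j)" "i < j" "q' = (i', j')" "i' < j'" by (auto simp: Q_def)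
      then show ?thesis
        unfolding kl g_def \<mu>_def ij(1,3) by (auto simp: minor_def lookup_minus lk)
    qed
  qed
  have fin: "finite (E <+> Q)" using E(1) finQ by simp
  note ind = independent_by_monomials[OF fin, of g \<mu>, OF look]
  show "finite (colon_gens E N :: (lss_var, 'a) mpoly set)" using fin unfolding img[symmetric] by simp
  show "card (colon_gens E N :: (lss_var, 'a) mpoly set) = card E + (card N choose 2)"
    using card_image[OF ind(1)] E(1) finQ cardQ unfolding img by (simp add: card_Plus)
  show "pvec.independent (colon_gens E N :: (lss_var, 'a) mpoly set)" using ind(2) unfolding img .
qed

lemma colon_gens_span:
  "ideal.span (edge_poly ` E \<union> minors N) \<subseteq> ideal.span (colon_gens E N :: (lss_var, 'a::field) mpoly set)"
proof (rule ideal.span_minimal)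
  have "minor i j \<in> ideal.span (colon_gens E N :: (lss_var, 'a) mpoly set)" if "i \<in> N" "j \<in> N" for i j
  proof -
    consider "i < j" | "j < i" | "i = j" by linarith
    then show ?thesis
    proof cases
      case 1
      then show ?thesis using that by (intro ideal.span_base) (auto simp: colon_gens_def)
    next
      case 2
      then have "minor j i \<in> ideal.span (colon_gens E N :: (lss_var, 'a) mpoly set)"
        using that by (intro ideal.span_base) (auto simp: colon_gens_def)
      then have "- minor j i \<in> ideal.span (colon_gens E N :: (lss_var, 'a) mpoly set)"
        by (rule ideal.span_neg)
      moreover have "minor i j = - (minor j i :: (lss_var, 'a) mpoly)" by (simp add: minor_def)
      ultimately show ?thesis by (simp only:)
    next
      case 3
      then show ?thesis by (simp add: minor_def ideal.span_zero)
    qed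
  qed
  moreover have "edge_poly ` E \<subseteq> ideal.span (colon_gens E N :: (lss_var, 'a) mpoly set)"
    using ideal.span_superset by (fastforce simp: colon_gens_def)
  ultimately show "edge_poly ` E \<union> minors N \<subseteq> ideal.span (colon_gens E N :: (lss_var, 'a) mpoly set)"
    by (auto simp: minors_def)
qed simp

section \<open>Homogeneous coefficients and syzygies indexed by edges\<close>

lemma var_mult_var_hom: "a \<in> V \<Longrightarrow> b \<in> V \<Longrightarrow> var a * var b \<in> hom_polys V 2"
  using hom_polys_mult[OF var_hom var_hom, of a V b] by simp

lemma edge_poly_hom:
  assumes "e \<subseteq> V" "card e = 2"
  shows "edge_poly e \<in> hom_polys (vertex_vars V) 2"
proof -
  have "finite e" "e \<noteq> {}" using assms(2) card.infinite by fastforce+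
  then have "Min e \<in> V" "Max e \<in> V" using assms(1) Min_in Max_in by blast+
  then show ?thesis
    unfolding edge_poly_def by (intro hom_polys_add var_mult_var_hom) (auto simp: vertex_vars_def)
qed

lemma minor_hom: "i \<in> V \<Longrightarrow> j \<in> V \<Longrightarrow> minor i j \<in> hom_polys (vertex_vars V) 2"
  unfolding minor_def by (intro hom_polys_diff var_mult_var_hom) (auto simp: vertex_vars_def)

lemma ideal_span_indexed:
  assumes "finite I" "x \<in> ideal.span (g ` I)"
  shows "\<exists>p. x = (\<Sum>i\<in>I. p i * g i)"
  using assms(2)
proof (induction rule: ideal.span_induct_alt)
  case base
  show ?case by (rule exI[of _ "\<lambda>_. 0"]) simp
next
  case (step c x y)
  then obtain p i where p: "y = (\<Sum>i\<in>I. p i * g i)" and i: "i \<in> I" "x = g i" by blast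
  have "c * x = (\<Sum>j\<in>I. (if j = i then c else 0) * g j)"
    using i assms(1) by (simp add: if_distrib[of "\<lambda>c. c * _"] cong: if_cong)
  then have "c * x + y = (\<Sum>j\<in>I. ((if j = i then c else 0) + p j) * g j)"
    unfolding p by (simp only: distrib_right sum.distrib)
  then show ?case by (intro exI)
qed

lemma hom_ideal_span_coeffs:
  fixes g :: "'i \<Rightarrow> ('v, 'a::comm_ring_1) mpoly"
  assumes "finite I" "x \<in> ideal.span (g ` I)" "x \<in> hom_polys V d" "\<And>i. i \<in> I \<Longrightarrow> g i \<in> hom_polys V e"
  shows "\<exists>p. (\<forall>i. p i \<in> hom_polys V (d - e)) \<and> x = (\<Sum>i\<in>I. p i * g i)"
proof -
  obtain p where p: "x = (\<Sum>i\<in>I. p i * g i)" using ideal_span_indexed[OF assms(1,2)] by blast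
  have "x = hcomp V d x" by (simp add: hcomp_id[OF assms(3)])
  also have "\<dots> = (\<Sum>i\<in>I. hcomp V (d - e) (p i) * g i)"
    unfolding p hcomp_sum by (intro sum.cong refl hcomp_mult assms(4))
  finally show ?thesis by (intro exI[of _ "\<lambda>i. hcomp V (d - e) (p i)"]) simp
qed

text \<open>Indexing by edges and requiring zero outside \<open>E\<close> makes a syzygy of a
  subtree literally a syzygy of the larger tree.\<close>

definition edge_syz :: "nat set set \<Rightarrow> (nat set \<Rightarrow> (lss_var, 'a::field) mpoly) set" where
  "edge_syz E = {c. (\<forall>e. e \<notin> E \<longrightarrow> c e = 0) \<and> (\<Sum>e\<in>E. c e * edge_poly e) = 0}"

lemma edge_syz_insert:
  assumes "finite E" "e0 \<notin> E"
  shows "c \<in> edge_syz (insert e0 E) \<longleftrightarrow>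
    (\<forall>e. e \<notin> insert e0 E \<longrightarrow> c e = 0) \<and> c e0 * edge_poly e0 + (\<Sum>e\<in>E. c e * edge_poly e) = 0"
  using assms by (simp add: edge_syz_def)

lemma edge_syz_mono:
  assumes "finite E'" "E \<subseteq> E'"
  shows "edge_syz E \<subseteq> edge_syz E'"
proof
  fix c :: "nat set \<Rightarrow> (lss_var, 'a::field) mpoly" assume c: "c \<in> edge_syz E"
  have "(\<Sum>e\<in>E'. c e * edge_poly e) = (\<Sum>e\<in>E. c e * edge_poly e)"
    using assms c by (intro sum.mono_neutral_right) (auto simp: edge_syz_def)
  then show "c \<in> edge_syz E'" using c assms(2) by (auto simp: edge_syz_def)
qed

lemma subspace_edge_syz: "fmod.subspace (edge_syz E)"
  by (rule fmod.subspaceI)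
    (auto simp: edge_syz_def distrib_right sum.distrib mult.assoc simp flip: sum_distrib_left)

lemma vertex_degree_leaf:
  assumes "finite E" "\<And>e. e \<in> E \<Longrightarrow> e \<subseteq> V" "w \<in> V" "u \<notin> V"
  shows "vertex_degree (insert {w, u} E) v =
    (if v = u then 1 else if v = w then Suc (vertex_degree E w) else vertex_degree E v)"
proof -
  have "{w, u} \<notin> E" using assms by auto
  have "{e \<in> insert {w, u} E. v \<in> e} =
      (if v = w \<or> v = u then insert {w, u} {e \<in> E. v \<in> e} else {e \<in> E. v \<in> e})" by auto
  moreover have "{e \<in> E. u \<in> e} = {}" using assms by auto
  ultimately show ?thesis using \<open>{w, u} \<notin> E\<close> assms(1,3,4) by (auto simp: vertex_degree_def)
qed

text \<open>Evaluation at the new edge \<open>e0\<close> maps the syzygies of the larger tree onto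
  the colon ideal by f_e0, with the old syzygies as kernel. So old generators together with lifts of
  generators of the colon ideal generate, and independence over K is inherited from both
  ends.\<close>

lemma leaf_tree_syzygies:
  assumes "leaf_tree V E"
  shows "\<exists>B :: (nat set \<Rightarrow> (lss_var, 'a::field) mpoly) set. finite B \<and> B \<subseteq> edge_syz E \<and>
    (\<forall>b\<in>B. \<forall>e. b e \<in> hom_polys (vertex_vars V) 2) \<and> fvec.independent B \<and> edge_syz E \<subseteq> fmod.span B \<and>
    card B = ((card V - 1) choose 2) + (\<Sum>v\<in>V. vertex_degree E v choose 3)"
  using assms
proof induction
  case (single v)
  have "edge_syz {} = {0 :: nat set \<Rightarrow> (lss_var, 'a) mpoly}" by (auto simp: edge_syz_def)
  then have "edge_syz {} \<subseteq> fmod.span ({} :: (nat set \<Rightarrow> (lss_var, 'a) mpoly) set)"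
    by (simp only: insert_subset empty_subsetI fmod.span_zero simp_thms)
  moreover have "card {} = ((card {v} - 1) choose 2) + (\<Sum>v\<in>{v}. vertex_degree {} v choose 3)"
    by (simp add: vertex_degree_def binomial_eq_0)
  ultimately show ?case using fvec.independent_empty by blast
next
  case (leaf V E w u)
  then obtain B :: "(nat set \<Rightarrow> (lss_var, 'a) mpoly) set" where B: "finite B" "B \<subseteq> edge_syz E"
    "\<And>b e. b \<in> B \<Longrightarrow> b e \<in> hom_polys (vertex_vars V) 2" "fvec.independent B" "edge_syz E \<subseteq> fmod.span B"
    "card B = ((card V - 1) choose 2) + (\<Sum>v\<in>V. vertex_degree E v choose 3)"
    by blast
  let ?F = "edge_poly :: nat set \<Rightarrow> (lss_var, 'a) mpoly"
  let ?V = "insert u V"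
  define e0 where "e0 = {w, u}"
  let ?E = "insert e0 E"
  note t = leaf_tree_props[OF leaf.hyps(1)]
  have e0: "e0 \<notin> E" "e0 \<subseteq> ?V" "card e0 = 2"
    using t(4) leaf.hyps(2,3) by (auto simp: e0_def card_insert_if)
  have rt: "rooted_tree V E w" using leaf_tree_rooted_tree leaf.hyps(1,2) by blast
  have hom: "hom_polys (vertex_vars V) d \<subseteq> hom_polys (vertex_vars ?V) d" for d
    by (rule hom_polys_mono) (auto simp: vertex_vars_def)
  have nbV: "nbrs E w \<subseteq> V" using t(4) by (auto simp: nbrs_def)
  then have nbfin: "finite (nbrs E w)" using t(1) finite_subset by blast
  define H where "H = (colon_gens E (nbrs E w) :: (lss_var, 'a) mpoly set)"
  have Hb: "finite H" "card H = card E + (card (nbrs E w) choose 2)" "pvec.independent H"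
    unfolding H_def by (rule colon_gens_basis[OF t(2) _ nbfin], erule t(5))+
  have Ehom: "?F e \<in> hom_polys (vertex_vars ?V) 2" if "e \<in> E" for e
    by (rule subsetD[OF hom edge_poly_hom[OF t(4)[OF that] t(5)[OF that]]])
  have Hhom: "h \<in> hom_polys (vertex_vars ?V) 2" if "h \<in> H" for h
    using that nbV Ehom unfolding H_def colon_gens_def
    by (auto intro!: minor_hom)
  have Fhom: "?F e \<in> hom_polys (vertex_vars ?V) 2" if "e \<in> ?E" for e
    using that Ehom edge_poly_hom[OF e0(2,3)] by auto
  have HL: "h * ?F e0 \<in> ideal.span (?F ` E)" if "h \<in> H" for h
    using that unfolding H_def colon_gens_def
  proof
    assume "h \<in> ?F ` E"
    then show ?thesis by (intro ideal_span_mult_right ideal.span_base)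
  next
    assume "h \<in> {minor i j |i j. i \<in> nbrs E w \<and> j \<in> nbrs E w \<and> i < j}"
    then have h: "h \<in> minors (nbrs E w)" by (auto simp: minors_def)
    have XY: "coords X Y" "coords Y X" by (simp_all add: coords_def)
    have "h * ?F e0 = var (X u) * (h * var (X w)) + var (Y u) * (h * var (Y w))"
      unfolding e0_def edge_poly_pair[OF XY(1)] by (simp add: algebra_simps)
    also have "\<dots> \<in> ideal.span (?F ` E)"
      by (intro ideal.span_add ideal.span_scale minor_mult_edge_ideal[OF XY(1) h] minor_mult_edge_ideal[OF XY(2) h])
    finally show ?thesis .
  qed
  have "\<forall>h\<in>H. \<exists>s. s \<in> edge_syz ?E \<and> s e0 = h \<and> (\<forall>e. s e \<in> hom_polys (vertex_vars ?V) 2)"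
  proof
    fix h assume h: "h \<in> H"
    have "h * ?F e0 \<in> hom_polys (vertex_vars ?V) (2 + 2)"
      by (rule hom_polys_mult[OF Hhom[OF h] Fhom]) simp
    then obtain p where p: "\<And>e. p e \<in> hom_polys (vertex_vars ?V) (2 + 2 - 2)" "h * ?F e0 = (\<Sum>e\<in>E. p e * ?F e)"
      using hom_ideal_span_coeffs[OF t(2) HL[OF h], of "vertex_vars ?V" "2 + 2" 2] Fhom by blast
    \<comment> \<open>The lift of \<open>h\<close>: it has the value \<open>h\<close> at
      \<open>e0\<close>, and the coefficients expressing h f_e0 through the old edges enter with a
      minus sign.\<close>
    define s where "s = (\<lambda>e. if e = e0 then h else if e \<in> E then - p e else 0)"
    have "(\<Sum>e\<in>E. s e * ?F e) = (\<Sum>e\<in>E. - (p e * ?F e))"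
      using e0(1) by (intro sum.cong) (auto simp: s_def)
    then have "s \<in> edge_syz ?E"
      unfolding edge_syz_insert[OF t(2) e0(1)] using p(2) by (auto simp: s_def sum_negf)
    moreover have "s e \<in> hom_polys (vertex_vars ?V) 2" for e
      using p(1)[of e] Hhom[OF h] by (auto simp: s_def intro: hom_polys_uminus)
    ultimately show "\<exists>s. s \<in> edge_syz ?E \<and> s e0 = h \<and> (\<forall>e. s e \<in> hom_polys (vertex_vars ?V) 2)"
      by (intro exI[of _ s]) (simp add: s_def)
  qed
  then obtain s where "\<forall>h\<in>H. s h \<in> edge_syz ?E \<and> s h e0 = h \<and> (\<forall>e. s h e \<in> hom_polys (vertex_vars ?V) 2)"
    by (rule bchoice[THEN exE])
  then have s: "\<And>h. h \<in> H \<Longrightarrow> s h \<in> edge_syz ?E" "\<And>h. h \<in> H \<Longrightarrow> s h e0 = h"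
    "\<And>h e. h \<in> H \<Longrightarrow> s h e \<in> hom_polys (vertex_vars ?V) 2" by auto
  have sinj: "inj_on s H" by (metis inj_onI s(2))
  have Be0: "b e0 = 0" if "b \<in> B" for b using B(2) that e0(1) by (auto simp: edge_syz_def)
  have H0: "0 \<notin> H" by (rule contrapos_nn[OF Hb(3)]) (rule pvec.dependent_zero)
  have disj: "B \<inter> s ` H = {}"
  proof (rule ccontr)
    assume "B \<inter> s ` H \<noteq> {}"
    then obtain h where "h \<in> H" "s h \<in> B" by blast
    then show False using Be0[of "s h"] s(2)[of h] H0 by simp
  qed
  let ?B = "B \<union> s ` H"
  have sub: "?B \<subseteq> edge_syz ?E"
    using B(2) s(1) edge_syz_mono[of ?E E] t(2) by auto
  have homB: "\<forall>b\<in>?B. \<forall>e. b e \<in> hom_polys (vertex_vars ?V) 2"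
    using B(3) s(3) hom by blast
  have ind: "fvec.independent ?B"
  proof (rule fvec.independent_if_scalars_zero)
    show "finite ?B" using B(1) Hb(1) by simp
    fix f x assume f: "(\<Sum>x\<in>?B. fscale (const (f x)) x) = 0" "x \<in> ?B"
    have split: "(\<Sum>x\<in>?B. fscale (const (f x)) x) = (\<Sum>x\<in>B. fscale (const (f x)) x) + (\<Sum>h\<in>H. fscale (const (f (s h))) (s h))"
      using B(1) Hb(1) disj by (simp add: sum.union_disjoint sum.reindex[OF sinj])
    \<comment> \<open>At \<open>e0\<close> the old syzygies vanish and each lift returns its
      \<open>h\<close>, so the independence of \<open>H\<close> removes the lifts first.\<close>
    have "(\<Sum>x\<in>B. fscale (const (f x)) x) e0 = 0"
      unfolding sum_fun_apply using Be0 by (intro sum.neutral) simp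
    moreover have "(\<Sum>h\<in>H. fscale (const (f (s h))) (s h)) e0 = (\<Sum>h\<in>H. const (f (s h)) * h)"
      unfolding sum_fun_apply using s(2) by (intro sum.cong) auto
    ultimately have "(\<Sum>h\<in>H. const (f (s h)) * h) = 0"
      using fun_cong[OF f(1), of e0] unfolding split by simp
    then have fH: "f (s h) = 0" if "h \<in> H" for h
      using pvec.independentD[OF Hb(3,1) subset_refl _ that, of "\<lambda>h. f (s h)"] by blast
    then have "(\<Sum>h\<in>H. fscale (const (f (s h))) (s h)) = 0"
      by (intro sum.neutral) (simp add: fscale_def zero_fun_def)
    then have "(\<Sum>x\<in>B. fscale (const (f x)) x) = 0" using f(1) split by simp
    then have "f b = 0" if "b \<in> B" for b
      using fvec.independentD[OF B(4,1) subset_refl _ that] by blast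
    then show "f x = 0" using f(2) fH by auto
  qed
  have gen: "edge_syz ?E \<subseteq> fmod.span ?B"
  proof
    fix c :: "nat set \<Rightarrow> (lss_var, 'a) mpoly" assume c: "c \<in> edge_syz ?E"
    then have "c e0 * ?F e0 = - (\<Sum>e\<in>E. c e * ?F e)"
      unfolding edge_syz_insert[OF t(2) e0(1)] by (simp add: eq_neg_iff_add_eq_0)
    also have "\<dots> \<in> ideal.span (?F ` E)"
      by (intro ideal.span_neg ideal.span_sum ideal.span_scale ideal.span_base) auto
    finally have "c e0 \<in> ideal.span (?F ` E \<union> minors (nbrs E w))"
      unfolding e0_def by (rule rooted_tree_colon_leaf[OF rt leaf.hyps(3)])
    then have "c e0 \<in> ideal.span ((\<lambda>h. h) ` H)"
      using colon_gens_span unfolding H_def by auto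
    then obtain q where q: "c e0 = (\<Sum>h\<in>H. q h * h)"
      using ideal_span_indexed[OF Hb(1), of "c e0" "\<lambda>h. h"] by auto
    \<comment> \<open>A combination of lifts with the same value at \<open>e0\<close> as
      \<open>c\<close>; the difference is an old syzygy.\<close>
    define d where "d = (\<Sum>h\<in>H. fscale (q h) (s h))"
    have "d e0 = c e0" unfolding d_def sum_fun_apply q using s(2) by (intro sum.cong) auto
    have "d \<in> edge_syz ?E"
      unfolding d_def by (intro fmod.subspace_sum[OF subspace_edge_syz] fmod.subspace_scale[OF subspace_edge_syz] s(1))
    with c have "c - d \<in> edge_syz ?E" by (rule fmod.subspace_diff[OF subspace_edge_syz])
    then have "c - d \<in> edge_syz E"
      unfolding edge_syz_insert[OF t(2) e0(1)] using \<open>d e0 = c e0\<close>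
      by (simp add: edge_syz_def) metis
    then have "c - d \<in> fmod.span ?B" using B(5) fmod.span_mono[of B ?B] by blast
    moreover have "d \<in> fmod.span ?B"
      unfolding d_def by (intro fmod.span_sum fmod.span_scale fmod.span_base) auto
    ultimately have "(c - d) + d \<in> fmod.span ?B" by (rule fmod.span_add)
    then show "c \<in> fmod.span ?B" by simp
  qed
  have "card ?B = card B + card H"
    using B(1) Hb(1) disj by (simp add: card_Un_disjoint card_image[OF sinj])
  also have "card H = card E + (vertex_degree E w choose 2)"
    using Hb(2) card_nbrs[of E w] t(5) by simp
  \<comment> \<open>Pascal's rule at \<open>w\<close> and for the number of vertices, using |E| =
    |V| - 1; the new vertex has degree 1 and contributes 0.\<close>
  also have "card B + (card E + (vertex_degree E w choose 2)) =
      ((card ?V - 1) choose 2) + (\<Sum>v\<in>?V. vertex_degree ?E v choose 3)"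
  proof -
    note deg = vertex_degree_leaf[OF t(2,4) leaf.hyps(2,3), folded e0_def]
    have "(\<Sum>v\<in>?V. vertex_degree ?E v choose 3) = (\<Sum>v\<in>V. vertex_degree ?E v choose 3)"
      using t(1) leaf.hyps(3) by (simp add: deg binomial_eq_0)
    also have "\<dots> = (vertex_degree ?E w choose 3) + (\<Sum>v\<in>V - {w}. vertex_degree ?E v choose 3)"
      using t(1) leaf.hyps(2) by (rule sum.remove)
    also have "(\<Sum>v\<in>V - {w}. vertex_degree ?E v choose 3) = (\<Sum>v\<in>V - {w}. vertex_degree E v choose 3)"
      using leaf.hyps(3) by (intro sum.cong refl) (auto simp: deg)
    also have "vertex_degree ?E w choose 3 = (vertex_degree E w choose 3) + (vertex_degree E w choose 2)"
      using leaf.hyps(2,3) by (auto simp: deg numeral_3_eq_3 numeral_2_eq_2)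
    finally have "(\<Sum>v\<in>?V. vertex_degree ?E v choose 3) = (vertex_degree E w choose 2) + (\<Sum>v\<in>V. vertex_degree E v choose 3)"
      using sum.remove[OF t(1) leaf.hyps(2), of "\<lambda>v. vertex_degree E v choose 3"] by simp
    moreover have "(card ?V - 1) choose 2 = ((card V - 1) choose 2) + card E"
      using t(1,3) leaf.hyps(3) by (simp add: numeral_2_eq_2)
    ultimately show ?thesis using B(6) by simp
  qed
  finally have card: "card ?B = ((card ?V - 1) choose 2) + (\<Sum>v\<in>?V. vertex_degree ?E v choose 3)" .
  show ?case
    unfolding e0_def[symmetric]
  proof (intro exI[of _ ?B] conjI)
    show "finite ?B" using B(1) Hb(1) by simp
  qed (fact sub homB ind gen card)+
qed

section \<open>The second syzygies in a minimal resolution\<close>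

lemma fmod_span_image:
  assumes x: "x \<in> fmod.span S" and T: "T 0 = 0" "\<And>a b. T (a + b) = T a + T b" "\<And>p a. T (fscale p a) = fscale p (T a)"
  shows "T x \<in> fmod.span (T ` S)"
  using x
proof (induction rule: fmod.span_induct_alt)
  case base
  show ?case unfolding T(1) by (rule fmod.span_zero)
next
  case (step c x y)
  from step(1) have "T x \<in> T ` S" by (rule imageI)
  then have "fscale c (T x) + T y \<in> fmod.span (T ` S)"
    by (rule fmod.span_add[OF fmod.span_scale[OF fmod.span_base] step(2)])
  then show ?case by (simp only: T)
qed

text \<open>A relation between the columns of \<open>A\<close> is a kernel element, hence in the
  image of the next matrix, whose entries have no constant term. This is minimality in the form
  required by the lemmas on minimal generators.\<close>

lemma matrix_columns_minimal:
  fixes A :: "nat \<Rightarrow> nat \<Rightarrow> ('v, 'a::field) mpoly"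
  assumes ker: "{c \<in> free_module V s. matrix_map r s A c = (\<lambda>_. 0)} = matrix_map s t B ` free_module V t"
    and irr: "\<And>k l. k < s \<Longrightarrow> l < t \<Longrightarrow> B k l \<in> irrelevant_ideal V"
    and c: "\<forall>l<s. c l \<in> polys V" "(\<Sum>l<s. fscale (c l) (\<lambda>k. if k < r then A k l else 0)) = 0" "l < s"
  shows "Poly_Mapping.lookup (c l) 0 = 0"
proof -
  define c' where "c' = (\<lambda>l. if l < s then c l else 0)"
  have "matrix_map r s A c' = (\<Sum>l<s. fscale (c l) (\<lambda>k. if k < r then A k l else 0))"
    unfolding matrix_map_eq_sum by (intro sum.cong) (simp_all add: c'_def)
  then have "matrix_map r s A c' = (\<lambda>_. 0)" using c(2) by (simp only: zero_fun_def)
  moreover have "c' \<in> free_module V s" using c(1) by (simp add: c'_def free_module_def)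
  ultimately have "c' \<in> matrix_map s t B ` free_module V t" unfolding ker[symmetric] by simp
  then obtain b where "c' = matrix_map s t B b" by blast
  then have "c' l = (\<Sum>i<t. B l i * b i)" using c(3) by (simp add: matrix_map_def)
  then have "c l = (\<Sum>i<t. B l i * b i)" using c(3) by (simp add: c'_def)
  then show ?thesis using irr[OF c(3)] by (simp add: lookup_sum lookup_mult_0 irrelevant_ideal_def)
qed

text \<open>The ideal of K[V] is the contraction of the one generated over all variables: setting
  the foreign variables to 0 turns a representation over the large ring into one over K[V].\<close>

lemma edge_ideal_eq:
  assumes E: "\<And>e. e \<in> E \<Longrightarrow> e \<subseteq> {1..n}" "\<And>e. e \<in> E \<Longrightarrow> card e = 2"
  shows "(lss_ideal n E :: (lss_var, 'a::field) mpoly set) = {p \<in> polys (lss_vars n). p \<in> ideal.span (edge_poly ` E)}"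
proof -
  let ?V = "lss_vars n" and ?F = "edge_poly :: nat set \<Rightarrow> (lss_var, 'a) mpoly"
  let ?R = "poly_ring ?V :: (lss_var, 'a) mpoly ring"
  have V: "?V = vertex_vars {1..n}" by (simp add: lss_vars_def vertex_vars_def)
  have gens: "{var (X i) * var (X j) + var (Y i) * var (Y j) | i j. {i, j} \<in> E} = ?F ` E"
  proof -
    have pair: "?F {i, j} = var (X i) * var (X j) + var (Y i) * var (Y j)" for i j
      by (rule edge_poly_pair) (simp add: coords_def)
    have "\<exists>i j. e = {i, j}" if "e \<in> E" for e
      using E(2)[OF that] by (auto simp: card_2_iff)
    then show ?thesis by (auto simp: pair[symmetric]) (metis image_eqI pair)
  qed
  have FV: "?F e \<in> polys ?V" if "e \<in> E" for e
    unfolding V by (rule edge_poly_polys[OF E(1)[OF that] E(2)[OF that]])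
  have finE: "finite E" by (rule finite_subset[of _ "Pow {1..n}"]) (use E(1) in auto)
  have sub: "simple_graph {1..n} E" using E by (simp add: simple_graph_def)
  interpret I: ideal "lss_ideal n E :: (lss_var, 'a) mpoly set" ?R by (rule ideal_lss_ideal[OF sub])
  have mult: "p * q \<in> lss_ideal n E" if "p \<in> polys ?V" "q \<in> lss_ideal n E" for p q :: "(lss_var, 'a) mpoly"
    using I.I_l_closed[OF that(2), of p] that(1) by (simp add: poly_ring_simps)
  have add: "p + q \<in> lss_ideal n E" if "p \<in> lss_ideal n E" "q \<in> lss_ideal n E" for p q :: "(lss_var, 'a) mpoly"
    using additive_subgroup.a_closed[OF I.additive_subgroup_axioms that] by (simp add: poly_ring_simps)
  have zero: "0 \<in> (lss_ideal n E :: (lss_var, 'a) mpoly set)"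
    using additive_subgroup.zero_closed[OF I.additive_subgroup_axioms] by (simp add: poly_ring_simps)
  have cr: "cring ?R" by (rule cring_poly_ring)
  have FI: "?F e \<in> lss_ideal n E" if "e \<in> E" for e
  proof -
    have "?F ` E \<subseteq> Idl\<^bsub>?R\<^esub> (?F ` E)"
      using FV by (intro ring.genideal_self cring.axioms(1)[OF cr]) (auto simp: poly_ring_simps)
    then show ?thesis using that unfolding lss_ideal_def gens by blast
  qed
  show ?thesis
  proof
    show "lss_ideal n E \<subseteq> {p \<in> polys ?V. p \<in> ideal.span (?F ` E)}"
      unfolding lss_ideal_def gens
    proof (rule ring.genideal_minimal[OF cring.axioms(1)[OF cr]])
      show "?F ` E \<subseteq> {p \<in> polys ?V. p \<in> ideal.span (?F ` E)}"
        using FV by (auto intro: ideal.span_base)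
      show "ideal {p \<in> polys ?V. p \<in> ideal.span (?F ` E)} ?R"
      proof (rule idealI[OF cring.axioms(1)[OF cr]])
        show "subgroup {p \<in> polys ?V. p \<in> ideal.span (?F ` E)} (add_monoid ?R)"
        proof (rule group.subgroupI)
          show grp: "Group.group (add_monoid ?R)"
            by (rule abelian_group.a_group[OF ring.is_abelian_group[OF cring.axioms(1)[OF cr]]])
          show "inv\<^bsub>add_monoid ?R\<^esub> p \<in> {p \<in> polys ?V. p \<in> ideal.span (?F ` E)}"
            if p: "p \<in> {p \<in> polys ?V. p \<in> ideal.span (?F ` E)}" for p
          proof -
            have "inv\<^bsub>add_monoid ?R\<^esub> p = - p"
              using p group.inv_equality[OF grp, of "- p" p]
              by (simp add: poly_ring_simps polys_uminus)
            then show ?thesis using p by (simp add: polys_uminus ideal.span_neg)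
          qed
          show "{p \<in> polys ?V. p \<in> ideal.span (?F ` E)} \<noteq> {}"
            using ideal.span_zero[of "?F ` E"] zero_in_polys by blast
        qed (auto simp: poly_ring_def polys_add_closed intro: ideal.span_add)
      qed (auto simp: poly_ring_simps polys_mult_closed intro: ideal.span_scale ideal_span_mult_right)
    qed
    show "{p \<in> polys ?V. p \<in> ideal.span (?F ` E)} \<subseteq> lss_ideal n E"
    proof clarify
      fix p :: "(lss_var, 'a) mpoly" assume p: "p \<in> polys ?V" "p \<in> ideal.span (?F ` E)"
      obtain q where q: "p = (\<Sum>e\<in>E. q e * ?F e)" using ideal_span_indexed[OF finE p(2)] by blast
      have "p = restrict_vars ?V p" by (simp add: restrict_vars_id[OF p(1)])
      also have "\<dots> = (\<Sum>e\<in>E. restrict_vars ?V (q e) * ?F e)"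
        unfolding q restrict_vars_sum restrict_vars_mult by (intro sum.cong refl) (simp add: restrict_vars_id FV)
      also have "\<dots> \<in> lss_ideal n E"
      proof -
        have "A \<subseteq> E \<Longrightarrow> (\<Sum>e\<in>A. restrict_vars ?V (q e) * ?F e) \<in> lss_ideal n E" if "finite A" for A
          using that by induction (auto simp: zero intro!: add mult FI)
        then show ?thesis using finE by blast
      qed
      finally show "p \<in> lss_ideal n E" .
    qed
  qed
qed

text \<open>The basis of F_1 in a given resolution is unrelated to the edges. Its images
  \<open>a l\<close> and the f_e generate the same ideal in degree 2, so constant matrices pass
  between them. They carry the syzygies \<open>B\<close> to a generating set for the columns of the
  second matrix, on which minimality then fixes number and degrees.\<close>

lemma minimal_resolution_second_degrees:
  fixes A :: "nat \<Rightarrow> nat \<Rightarrow> nat \<Rightarrow> (lss_var, 'a::field) mpoly"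
  assumes tree: "leaf_tree {1..n} E"
    and res: "minimal_graded_free_resolution (lss_vars n) (lss_quotient n E) d A e"
    and irr: "(lss_ideal n E :: (lss_var, 'a) mpoly set) \<subseteq> irrelevant_ideal (lss_vars n)"
  shows "d 2 = replicate (((n - 1) choose 2) + (\<Sum>v\<in>{1..n}. vertex_degree E v choose 3)) 4"
proof -
  define V where "V = lss_vars n"
  have V: "V = vertex_vars {1..n}" by (simp add: V_def lss_vars_def vertex_vars_def)
  let ?F = "edge_poly :: nat set \<Rightarrow> (lss_var, 'a) mpoly"
  let ?I = "lss_ideal n E :: (lss_var, 'a) mpoly set"
  note t = leaf_tree_props[OF tree]
  have I: "?I = {p \<in> polys V. p \<in> ideal.span (?F ` E)}"
    unfolding V_def by (rule edge_ideal_eq[OF t(4,5)])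
  have idI: "ideal ?I (poly_ring V)"
    unfolding V_def using t(4,5) by (intro ideal_lss_ideal) (simp add: simple_graph_def)
  have Fhom: "?F x \<in> hom_polys V 2" if "x \<in> E" for x
    unfolding V by (rule edge_poly_hom[OF t(4)[OF that] t(5)[OF that]])
  have FI: "?F x \<in> ?I" if "x \<in> E" for x
    unfolding I using hom_polys_polys[OF Fhom[OF that]] that by (auto intro: ideal.span_base)
  obtain B :: "(nat set \<Rightarrow> (lss_var, 'a) mpoly) set" where B: "finite B" "B \<subseteq> edge_syz E"
    "\<And>b x. b \<in> B \<Longrightarrow> b x \<in> hom_polys V 2" "fvec.independent B" "edge_syz E \<subseteq> fmod.span B"
    "card B = ((n - 1) choose 2) + (\<Sum>v\<in>{1..n}. vertex_degree E v choose 3)"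
    using leaf_tree_syzygies[OF tree] unfolding V[symmetric] by (simp only: card_atLeastAtMost diff_Suc_1) blast
  let ?Fr = "\<lambda>r. free_module V r :: (nat \<Rightarrow> (lss_var, 'a) mpoly) set"
  have res': "minimal_graded_free_resolution V (quotient_module V ?I) d A e"
    using res by (simp add: V_def lss_quotient_def)
  note start = minimal_resolution_start[OF idI irr[folded V_def] res']
  define s where "s = length (d 1)"
  define r where "r = length (d 2)"
  have d0: "d 0 = [0]" by (rule start(1))
  have im0: "{c \<in> ?Fr 1. c 0 \<in> ?I} = matrix_map 1 s (A 0) ` ?Fr s"
    unfolding s_def by (rule start(2))
  have hom: "\<And>i k l. k < length (d i) \<Longrightarrow> l < length (d (Suc i)) \<Longrightarrow> A i k l \<in> hom_polys V (d (Suc i) ! l - d i ! k)"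
    and ker: "\<And>i. {c \<in> ?Fr (length (d (Suc i))). matrix_map (length (d i)) (length (d (Suc i))) (A i) c = (\<lambda>_. 0)}
      = matrix_map (length (d (Suc i))) (length (d (Suc (Suc i)))) (A (Suc i)) ` ?Fr (length (d (Suc (Suc i))))"
    and irrA: "\<And>i k l. k < length (d i) \<Longrightarrow> l < length (d (Suc i)) \<Longrightarrow> A i k l \<in> irrelevant_ideal V"
    using res' by (simp_all add: minimal_graded_free_resolution_def graded_free_resolution_def Let_def)
  define a where "a = A 0 0"
  define b1 where "b1 = (\<lambda>l k. if k < 1 then A 0 k l else 0)"
  define b2 where "b2 = (\<lambda>l k. if k < s then A 1 k l else 0)"
  have ker0: "{c \<in> ?Fr s. matrix_map 1 s (A 0) c = (\<lambda>_. 0)} = matrix_map s r (A 1) ` ?Fr r"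
    using ker[of 0] by (simp add: d0 s_def r_def numeral_2_eq_2)
  have min1: "Poly_Mapping.lookup (c l) 0 = 0"
    if "\<forall>l<s. c l \<in> polys V" "(\<Sum>l<s. fscale (c l) (b1 l)) = 0" "l < s" for c l
    using ker0 _ that(1) that(2)[unfolded b1_def] that(3)
  proof (rule matrix_columns_minimal)
    show "A 1 k l \<in> irrelevant_ideal V" if "k < s" "l < r" for k l
      using irrA[of k 1 l] that by (simp add: s_def r_def numeral_2_eq_2)
  qed
  have ker1: "{c \<in> ?Fr r. matrix_map s r (A 1) c = (\<lambda>_. 0)} = matrix_map r (length (d 3)) (A 2) ` ?Fr (length (d 3))"
    using ker[of 1] by (simp add: s_def r_def numeral_2_eq_2 numeral_3_eq_3)
  have min2: "Poly_Mapping.lookup (c l) 0 = 0"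
    if "\<forall>l<r. c l \<in> polys V" "(\<Sum>l<r. fscale (c l) (b2 l)) = 0" "l < r" for c l
    using ker1 _ that(1) that(2)[unfolded b2_def] that(3)
  proof (rule matrix_columns_minimal)
    show "A 2 k l \<in> irrelevant_ideal V" if "k < r" "l < length (d 3)" for k l
      using irrA[of k 2 l] that by (simp add: r_def numeral_3_eq_3 numeral_2_eq_2)
  qed
  have aI: "a l \<in> ?I" if "l < s" for l
  proof -
    have "matrix_map 1 s (A 0) (\<lambda>i. if i = l then 1 else 0) \<in> {c \<in> ?Fr 1. c 0 \<in> ?I}"
      unfolding im0 by (intro imageI unit_free_module that)
    then show ?thesis unfolding matrix_map_unit[OF that] by (simp add: a_def)
  qed
  have Fa: "\<exists>c. ?F x = (\<Sum>l<s. c l * a l)" if "x \<in> E" for x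
  proof -
    have "(\<lambda>k. if k = 0 then ?F x else 0) \<in> {c \<in> ?Fr 1. c 0 \<in> ?I}"
      using FI[OF that] I by (auto simp: free_module_def)
    then obtain c where c: "(\<lambda>k. if k = 0 then ?F x else 0) = matrix_map 1 s (A 0) c"
      unfolding im0 by blast
    from fun_cong[OF this, of 0] have "?F x = (\<Sum>l<s. c l * a l)"
      by (simp add: matrix_map_def a_def mult.commute)
    then show ?thesis by blast
  qed
  \<comment> \<open>The generators f_e all have degree 2, so every minimal homogeneous system of
    generators of the ideal does.\<close>
  have d1: "d 1 ! l = 2" if l: "l < s" for l
  proof (rule minimal_generators_degree[of s b1 V "\<lambda>l. d 1 ! l" "(\<lambda>x k. if k < 1 then ?F x else 0) ` E" 2 l])
    show "b1 l k \<in> hom_polys V (d 1 ! l)" if "l < s" for l k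
      using hom[of 0 0 l] that by (simp add: b1_def d0 s_def)
    show "finite ((\<lambda>x k. if k < 1 then ?F x else 0) ` E)" using t(2) by simp
    show "h k \<in> hom_polys V 2" if "h \<in> (\<lambda>x k. if k < 1 then ?F x else 0) ` E" for h and k :: nat
      using that Fhom by auto
    show "b1 l \<in> fmod.span ((\<lambda>x k. if k < 1 then ?F x else 0) ` E)" if "l < s" for l
    proof -
      have "a l \<in> ideal.span (?F ` E)" using aI[OF that] I by simp
      then obtain p where p: "a l = (\<Sum>x\<in>E. p x * ?F x)" using ideal_span_indexed[OF t(2)] by blast
      have "b1 l = (\<Sum>x\<in>E. fscale (p x) (\<lambda>k. if k < 1 then ?F x else 0))"
        using p by (auto simp: fun_eq_iff b1_def a_def sum_fun_apply)
      also have "\<dots> \<in> fmod.span ((\<lambda>x k. if k < 1 then ?F x else 0) ` E)"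
        by (intro fmod.span_sum fmod.span_scale fmod.span_base) auto
      finally show ?thesis .
    qed
    show "h \<in> fmod.span (b1 ` {..<s})" if h: "h \<in> (\<lambda>x k. if k < 1 then ?F x else 0) ` E" for h
    proof -
      from h obtain x where x: "x \<in> E" "h = (\<lambda>k. if k < 1 then ?F x else 0)" by blast
      obtain c where c: "?F x = (\<Sum>l<s. c l * a l)" using Fa[OF x(1)] by blast
      have "h = (\<Sum>l<s. fscale (c l) (b1 l))"
        unfolding x(2) c by (auto simp: fun_eq_iff b1_def a_def sum_fun_apply)
      also have "\<dots> \<in> fmod.span (b1 ` {..<s})"
        by (intro fmod.span_sum fmod.span_scale fmod.span_base) auto
      finally show ?thesis .
    qed
  qed (use min1 l in auto)
  have ahom: "a l \<in> hom_polys V 2" if "l < s" for l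
    using hom[of 0 0 l] that d1[OF that] by (simp add: a_def d0 s_def)
  have "\<forall>l\<in>{..<s}. \<exists>p. (\<forall>x. p x \<in> hom_polys V (2 - 2)) \<and> a l = (\<Sum>x\<in>E. p x * ?F x)"
    using aI I ahom Fhom by (intro ballI hom_ideal_span_coeffs[OF t(2)]) auto
  then obtain P where "\<forall>l\<in>{..<s}. (\<forall>x. P l x \<in> hom_polys V (2 - 2)) \<and> a l = (\<Sum>x\<in>E. P l x * ?F x)"
    by (rule bchoice[THEN exE])
  then have P: "\<And>l x. l < s \<Longrightarrow> P l x \<in> hom_polys V 0" "\<And>l. l < s \<Longrightarrow> (\<Sum>x\<in>E. P l x * ?F x) = a l" by auto
  have "\<forall>x\<in>E. \<exists>q. (\<forall>l. q l \<in> hom_polys V (2 - 2)) \<and> ?F x = (\<Sum>l<s. q l * a l)"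
  proof (intro ballI hom_ideal_span_coeffs)
    fix x assume x: "x \<in> E"
    obtain c where c: "?F x = (\<Sum>l<s. c l * a l)" using Fa[OF x] by blast
    show "?F x \<in> ideal.span (a ` {..<s})"
      unfolding c by (intro ideal.span_sum ideal.span_scale ideal.span_base) auto
  qed (use Fhom ahom in auto)
  then obtain Q where "\<forall>x\<in>E. (\<forall>l. Q x l \<in> hom_polys V (2 - 2)) \<and> ?F x = (\<Sum>l<s. Q x l * a l)"
    by (rule bchoice[THEN exE])
  then have Q: "\<And>x l. x \<in> E \<Longrightarrow> Q x l \<in> hom_polys V 0" "\<And>x. x \<in> E \<Longrightarrow> (\<Sum>l<s. Q x l * a l) = ?F x" by auto
  have hom0: "p * q \<in> hom_polys V 0" if "p \<in> hom_polys V 0" "q \<in> hom_polys V 0" for p q :: "(lss_var, 'a) mpoly"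
    using hom_polys_mult[OF that] by simp
  \<comment> \<open>Minimality makes \<open>P\<close> and \<open>Q\<close> mutually inverse matrices of constants, so \<open>T\<close> and \<open>U\<close> below are
    inverse isomorphisms between the syzygies of the \<open>f\<^sub>e\<close> and those of the \<open>a l\<close>.\<close>
  have PQ: "(\<Sum>x\<in>E. P l x * Q x m) = (if m = l then 1 else 0)" if l: "l < s" and m: "m < s" for l m
  proof -
    define c where "c = (\<lambda>m. (\<Sum>x\<in>E. P l x * Q x m) - (if m = l then 1 else 0))"
    have ch: "c m \<in> hom_polys V 0" if "m < s" for m
      unfolding c_def using P(1)[OF l] Q(1) by (intro hom_polys_diff hom_polys_sum hom0) auto
    have "(\<Sum>m<s. (\<Sum>x\<in>E. P l x * Q x m) * a m) = (\<Sum>x\<in>E. P l x * (\<Sum>m<s. Q x m * a m))"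
      unfolding sum_distrib_left sum_distrib_right by (subst sum.swap) (simp only: mult.assoc)
    also have "\<dots> = a l" using Q(2) P(2)[OF l] by simp
    finally have "(\<Sum>m<s. c m * a m) = a l - (\<Sum>m<s. (if m = l then 1 else 0) * a m)"
      by (simp only: c_def left_diff_distrib sum_subtractf)
    also have "\<dots> = 0" using l by (simp add: if_distrib[of "\<lambda>c. c * _"] cong: if_cong)
    finally have "(\<Sum>m<s. fscale (c m) (b1 m)) k = 0" for k
      by (cases "k = 0") (simp_all add: b1_def a_def sum_fun_apply)
    then have "(\<Sum>m<s. fscale (c m) (b1 m)) = 0" unfolding fun_eq_iff zero_fun_apply by blast
    then have "Poly_Mapping.lookup (c m) 0 = 0"
      using ch m by (intro min1[of c m]) (auto intro: hom_polys_polys)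
    then have "c m = 0" using hom_polys_const[OF ch[OF m]] by simp
    then show ?thesis by (simp add: c_def)
  qed
  have QP: "(\<Sum>l<s. Q x l * P l y) = (if y = x then 1 else 0)" if x: "x \<in> E" and y: "y \<in> E" for x y
  proof -
    define c where "c = (\<lambda>y. if y \<in> E then (\<Sum>l<s. Q x l * P l y) - (if y = x then 1 else 0) else 0)"
    have ch: "c y \<in> hom_polys V 0" for y
      unfolding c_def using P(1) Q(1)[OF x] by (auto intro!: hom_polys_diff hom_polys_sum hom0)
    have "(\<Sum>y\<in>E. (\<Sum>l<s. Q x l * P l y) * ?F y) = (\<Sum>l<s. Q x l * (\<Sum>y\<in>E. P l y * ?F y))"
      unfolding sum_distrib_left sum_distrib_right by (subst sum.swap) (simp only: mult.assoc)
    also have "\<dots> = ?F x" using P(2) Q(2)[OF x] by simp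
    finally have "(\<Sum>y\<in>E. c y * ?F y) = ?F x - (\<Sum>y\<in>E. (if y = x then 1 else 0) * ?F y)"
      by (simp add: c_def left_diff_distrib sum_subtractf)
    also have "\<dots> = 0" using x t(2) by (simp add: if_distrib[of "\<lambda>c. c * _"] cong: if_cong)
    finally have "c \<in> edge_syz E" by (simp add: edge_syz_def c_def)
    \<comment> \<open>A syzygy of the f_e with constant entries vanishes: its coefficients over
      \<open>B\<close>, whose entries have degree 2, would have degree -2.\<close>
    then have "c \<in> fmod.span ((\<lambda>b. b) ` B)" using B(5) by auto
    then obtain p where p: "\<And>b. p b \<in> hom_polys V (0 - 2)" "c = (\<Sum>b\<in>B. fscale (p b) b)"
      using hom_span_coeffs[OF B(1), of c "\<lambda>b. b" V 0 "\<lambda>_. 2"] B(3) ch by blast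
    have "p b = 0" for b using hom_polys_neg[OF p(1)] by simp
    then have "c y = 0" unfolding p(2) by (simp add: sum_fun_apply)
    then show ?thesis using y by (simp add: c_def)
  qed
  define T where "T = (\<lambda>(c :: nat set \<Rightarrow> (lss_var, 'a) mpoly) l. if l < s then \<Sum>x\<in>E. c x * Q x l else 0)"
  define U where "U = (\<lambda>(v :: nat \<Rightarrow> (lss_var, 'a) mpoly) x. if x \<in> E then \<Sum>l<s. v l * P l x else 0)"
  have T: "T 0 = 0" "T (c + c') = T c + T c'" "T (fscale p c) = fscale p (T c)" for c c' p
    by (auto simp: T_def fun_eq_iff distrib_right sum.distrib sum_distrib_left mult.assoc)
  have UT: "U (T c) = c" if c: "c \<in> edge_syz E" for c
  proof
    fix y
    show "U (T c) y = c y"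
    proof (cases "y \<in> E")
      case True
      have "U (T c) y = (\<Sum>l<s. (\<Sum>x\<in>E. c x * Q x l) * P l y)" using True by (simp add: U_def T_def)
      also have "\<dots> = (\<Sum>x\<in>E. c x * (\<Sum>l<s. Q x l * P l y))"
        unfolding sum_distrib_left sum_distrib_right by (subst sum.swap) (simp only: mult.assoc)
      also have "\<dots> = (\<Sum>x\<in>E. if y = x then c x else 0)" using QP True by (intro sum.cong) auto
      also have "\<dots> = c y" using True t(2) by simp
      finally show ?thesis .
    next
      case False
      then show ?thesis using c by (simp add: U_def edge_syz_def)
    qed
  qed
  have TU: "T (U v) = v" if v: "\<And>l. \<not> l < s \<Longrightarrow> v l = 0" for v
  proof
    fix m
    show "T (U v) m = v m"
    proof (cases "m < s")
      case True
      have "T (U v) m = (\<Sum>x\<in>E. (\<Sum>l<s. v l * P l x) * Q x m)" using True by (simp add: U_def T_def)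
      also have "\<dots> = (\<Sum>l<s. v l * (\<Sum>x\<in>E. P l x * Q x m))"
        unfolding sum_distrib_left sum_distrib_right by (subst sum.swap) (simp only: mult.assoc)
      also have "\<dots> = (\<Sum>l<s. if m = l then v l else 0)" using PQ True by (intro sum.cong) auto
      also have "\<dots> = v m" using True by simp
      finally show ?thesis .
    next
      case False
      then show ?thesis using v by (simp add: T_def)
    qed
  qed
  have Usyz: "U v \<in> edge_syz E" if "(\<Sum>l<s. v l * a l) = 0" for v
  proof -
    have "(\<Sum>x\<in>E. U v x * ?F x) = (\<Sum>x\<in>E. (\<Sum>l<s. v l * P l x) * ?F x)"
      by (intro sum.cong) (auto simp: U_def)
    also have "\<dots> = (\<Sum>l<s. v l * (\<Sum>x\<in>E. P l x * ?F x))"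
      unfolding sum_distrib_left sum_distrib_right by (subst sum.swap) (simp only: mult.assoc)
    also have "\<dots> = 0" using P(2) that by simp
    finally show ?thesis by (simp add: edge_syz_def U_def)
  qed
  have Tker: "(\<Sum>l<s. T c l * a l) = 0" if "c \<in> edge_syz E" for c
  proof -
    have "(\<Sum>l<s. T c l * a l) = (\<Sum>l<s. (\<Sum>x\<in>E. c x * Q x l) * a l)"
      by (intro sum.cong) (auto simp: T_def)
    also have "\<dots> = (\<Sum>x\<in>E. c x * (\<Sum>l<s. Q x l * a l))"
      unfolding sum_distrib_left sum_distrib_right by (subst sum.swap) (simp only: mult.assoc)
    also have "\<dots> = 0" using Q(2) that by (simp add: edge_syz_def)
    finally show ?thesis .
  qed
  have mm0: "matrix_map 1 s (A 0) v = (\<lambda>_. 0) \<longleftrightarrow> (\<Sum>l<s. v l * a l) = 0" for v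
    by (auto simp: matrix_map_def fun_eq_iff a_def mult.commute)
  have Tinj: "inj_on T B" using UT B(2) by (metis inj_onI subsetD)
  have Thom: "T b l \<in> hom_polys V 2" if "b \<in> B" for b l
  proof -
    have "b x * Q x l \<in> hom_polys V 2" if "x \<in> E" for x
      using hom_polys_mult[OF B(3)[OF \<open>b \<in> B\<close>] Q(1)[OF that]] by simp
    then show ?thesis by (auto simp: T_def intro: hom_polys_sum)
  qed
  \<comment> \<open>As all basis elements of F_1 have degree 2, the entries of a column share one
    degree, two less than the degree of its basis element.\<close>
  have b2hom: "b2 l k \<in> hom_polys V (d 2 ! l - 2)" if "l < r" for l k
    using hom[of k 1 l] that d1[of k] by (simp add: b2_def s_def r_def numeral_2_eq_2)
  have finTB: "finite (T ` B)" using B(1) by simp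
  have TBhom: "h k \<in> hom_polys V 2" if "h \<in> T ` B" for h k using that Thom by auto
  have TBind: "fvec.independent (T ` B)"
  proof (rule fvec.independent_if_scalars_zero[OF finTB])
    fix f x assume f: "(\<Sum>x\<in>T ` B. fscale (const (f x)) x) = 0" "x \<in> T ` B"
    define y where "y = (\<Sum>b\<in>B. fscale (const (f (T b))) b)"
    have "T y = (\<Sum>b\<in>B. fscale (const (f (T b))) (T b))"
    proof -
      have "T (\<Sum>b\<in>C. fscale (const (f (T b))) b) = (\<Sum>b\<in>C. fscale (const (f (T b))) (T b))" for C
        by (induction C rule: infinite_finite_induct) (simp_all only: sum.infinite sum.empty sum.insert T simp_thms)
      then show ?thesis by (simp only: y_def)
    qed
    also have "\<dots> = 0" using f(1) by (simp only: sum.reindex[OF Tinj] o_def)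
    finally have "T y = 0" .
    moreover have "y \<in> edge_syz E"
      unfolding y_def using B(2) by (intro fmod.subspace_sum[OF subspace_edge_syz] fmod.subspace_scale[OF subspace_edge_syz]) auto
    ultimately have "y = U 0" using UT by metis
    also have "\<dots> = 0" by (simp add: U_def fun_eq_iff)
    finally have "f (T b) = 0" if "b \<in> B" for b
      unfolding y_def by (rule fvec.independentD[OF B(4,1) subset_refl _ that])
    then show "f x = 0" using f(2) by auto
  qed
  have gen1: "b2 l \<in> fmod.span (T ` B)" if l: "l < r" for l
  proof -
    have "b2 l \<in> matrix_map s r (A 1) ` ?Fr r"
      unfolding b2_def matrix_map_unit[OF l, symmetric] by (intro imageI unit_free_module l)
    then have "(\<Sum>k<s. b2 l k * a k) = 0" unfolding ker0[symmetric] mm0 by simp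
    then have "U (b2 l) \<in> fmod.span B" using Usyz B(5) by blast
    then have "T (U (b2 l)) \<in> fmod.span (T ` B)" by (rule fmod_span_image) (rule T)+
    moreover have "T (U (b2 l)) = b2 l" by (rule TU) (simp add: b2_def)
    ultimately show ?thesis by simp
  qed
  have gen2: "h \<in> fmod.span (b2 ` {..<r})" if h: "h \<in> T ` B" for h
  proof -
    from h obtain b where b: "b \<in> B" "h = T b" by blast
    have "h \<in> {c \<in> ?Fr s. matrix_map 1 s (A 0) c = (\<lambda>_. 0)}"
    proof -
      have "h l \<in> polys V" for l using TBhom[OF h] by (rule hom_polys_polys)
      moreover have "h l = 0" if "s \<le> l" for l using that by (simp add: b(2) T_def)
      moreover have "(\<Sum>l<s. h l * a l) = 0" using Tker[of b] B(2) b by auto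
      ultimately show ?thesis unfolding mm0 by (simp add: free_module_def)
    qed
    then obtain c where "h = matrix_map s r (A 1) c" unfolding ker0 by blast
    then have "h = (\<Sum>l<r. fscale (c l) (b2 l))" by (simp only: matrix_map_eq_sum b2_def)
    also have "\<dots> \<in> fmod.span (b2 ` {..<r})"
      by (intro fmod.span_sum fmod.span_scale fmod.span_base) auto
    finally show ?thesis .
  qed
  \<comment> \<open>The entries have degree 2 on basis elements of degree 2, which gives total
    degree 4.\<close>
  have d2: "d 2 ! l - 2 = 2" if "l < r" for l
    by (rule minimal_generators_degree[of r b2 V "\<lambda>l. d 2 ! l - 2" "T ` B" 2 l])
      (fact b2hom finTB TBhom gen1 gen2 min2 that)+
  have "r = card (T ` B)"
    by (rule minimal_generators_card[of r b2 V "\<lambda>l. d 2 ! l - 2" "T ` B" 2])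
      (fact b2hom finTB TBhom TBind gen1 gen2 min2)+
  then have len: "length (d 2) = ((n - 1) choose 2) + (\<Sum>v\<in>{1..n}. vertex_degree E v choose 3)"
    using card_image[OF Tinj] B(6) by (simp add: r_def)
  show ?thesis
  proof (rule replicate_eqI[OF len])
    fix j assume "j \<in> set (d 2)"
    then obtain l where "l < r" "j = d 2 ! l" by (auto simp: in_set_conv_nth r_def)
    then show "j = 4" using d2[of l] by simp
  qed
qed

section \<open>A linear order on the variables, and the Betti numbers\<close>

primrec lss_rank :: "lss_var \<Rightarrow> nat" where
  "lss_rank (X i) = 2 * i"
| "lss_rank (Y i) = 2 * i + 1"

lemma lss_rank_inj: "lss_rank x = lss_rank y \<Longrightarrow> x = y"
  by (cases x; cases y) (auto, presburger+)

text \<open>The lexicographic order on monomials behind finite generation requires ordered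
  variables; the injective rank places x_i just before y_i.\<close>

instantiation lss_var :: linorder
begin

definition "x \<le> y \<longleftrightarrow> lss_rank x \<le> lss_rank y"
definition "x < y \<longleftrightarrow> lss_rank x < lss_rank y"

instance
  by standard (auto simp: less_eq_lss_var_def less_lss_var_def intro: lss_rank_inj)

end

text \<open>\<open>graded_betti\<close> reads the degrees off a sequence chosen by
  \<open>SOME\<close>. Existence makes the choice a genuine degree sequence of a minimal resolution,
  and all minimal resolutions have the same list in position 2.\<close>

theorem theorem5p1:
  fixes n :: nat
    and E :: "nat set set"
    and M :: "((lss_var, 'a::field) mpoly, (lss_var, 'a) mpoly set) graded_module"
  assumes tree: "is_tree {1..n} E"
    and M: "M = lss_quotient n E"
  shows "betti (lss_vars n) M 2 = graded_betti (lss_vars n) M 2 4 \<and>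
         graded_betti (lss_vars n) M 2 4 =
           ((n - 1) choose 2) + (\<Sum>v \<in> {1..n}. vertex_degree E v choose 3)"
proof -
  define V where "V = lss_vars n"
  define N where "N = ((n - 1) choose 2) + (\<Sum>v \<in> {1..n}. vertex_degree E v choose 3)"
  let ?F = "edge_poly :: nat set \<Rightarrow> (lss_var, 'a) mpoly"
  let ?I = "lss_ideal n E :: (lss_var, 'a) mpoly set"
  have lt: "leaf_tree {1..n} E" by (rule is_tree_leaf_tree[OF tree])
  note t = leaf_tree_props[OF lt]
  have I: "?I = {p \<in> polys V. p \<in> ideal.span (?F ` E)}"
    unfolding V_def by (rule edge_ideal_eq[OF t(4,5)])
  have Fhom: "?F x \<in> hom_polys V 2" if "x \<in> E" for x
    using edge_poly_hom[OF t(4)[OF that] t(5)[OF that]] by (simp add: V_def lss_vars_def vertex_vars_def)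
  have comp: "hcomp V \<delta> p \<in> ?I" if "p \<in> ?I" for p \<delta>
  proof -
    have "p \<in> ideal.span (?F ` E)" using that I by simp
    then obtain q where q: "p = (\<Sum>x\<in>E. q x * ?F x)" using ideal_span_indexed[OF t(2)] by blast
    have "hcomp V \<delta> p = (\<Sum>x\<in>E. hcomp V (\<delta> - 2) (q x) * ?F x)"
      unfolding q hcomp_sum by (intro sum.cong refl hcomp_mult Fhom)
    also have "\<dots> \<in> ideal.span (?F ` E)"
      by (intro ideal.span_sum ideal.span_scale ideal.span_base) auto
    finally show ?thesis unfolding I using hom_polys_polys[OF hcomp_in] by blast
  qed
  have irr: "?I \<subseteq> irrelevant_ideal V"
  proof
    fix p assume p: "p \<in> ?I"
    then have "p \<in> ideal.span (?F ` E)" using I by simp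
    then obtain q where q: "p = (\<Sum>x\<in>E. q x * ?F x)" using ideal_span_indexed[OF t(2)] by blast
    have "Poly_Mapping.lookup p 0 = 0"
      unfolding q using hom_polys_lookup_0[OF Fhom] by (simp add: lookup_sum lookup_mult_0)
    then show "p \<in> irrelevant_ideal V" using p I by (simp add: irrelevant_ideal_def)
  qed
  have "finite V" by (simp add: V_def lss_vars_def)
  moreover have "ideal ?I (poly_ring V)"
    unfolding V_def using t(4,5) by (intro ideal_lss_ideal) (simp add: simple_graph_def)
  ultimately have "\<exists>d A e. minimal_graded_free_resolution V M d A e"
    using minimal_resolution_exists[OF _ _ irr comp] by (simp add: M lss_quotient_def V_def)
  then obtain A e where "minimal_graded_free_resolution V M (SOME d. \<exists>A e. minimal_graded_free_resolution V M d A e) A e"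
    using someI_ex[of "\<lambda>d. \<exists>A e. minimal_graded_free_resolution V M d A e"] by blast
  then have "(SOME d. \<exists>A e. minimal_graded_free_resolution V M d A e) 2 = replicate N 4"
    unfolding V_def N_def M
    by (rule minimal_resolution_second_degrees[OF lt _ irr[unfolded V_def]])
  then have gb: "graded_betti V M 2 j = (if j = 4 then N else 0)" for j
    by (auto simp: graded_betti_def count_list_eq_length_filter)
  have "betti V M 2 = N"
  \<comment> \<open>For \<open>N = 0\<close> the support of the sum defining \<open>betti\<close> is
    empty instead of \<open>{4}\<close>.\<close>
  proof (cases "N = 0")
    case True
    then show ?thesis by (simp add: betti_def gb)
  next
    case False
    then have "{j. graded_betti V M 2 j \<noteq> 0} = {4}" by (auto simp: gb)
    then show ?thesis by (simp add: betti_def gb)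
  qed
  then show ?thesis unfolding V_def[symmetric] N_def[symmetric] by (simp add: gb)
qed

end
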